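(* Let $m\in\{0,1,2,\dots\}$ and let $\mathbb D$ be the Dirac operator of the round sphere $S^n$ acting on smooth sections of the spinor bundle $\tilde K\times_{\tilde M}\Sigma$. Then the differential operator \[\mathbb D_m=\mathbb D(\mathbb D^2-1)(\mathbb D^2-4)\cdots(\mathbb D^2-m^2)\] is covariant with respect to $(\pi_{-\frac12-m},\pi_{\frac12+m})$, i.e. $\mathbb D_m\circ\pi_{-\frac12-m}(g)=\pi_{\frac12+m}(g)\circ\mathbb D_m$ for all $g\in SL_2(\Gamma_n)$, where the representations are realized in the compact picture on sections of this bundle.
   Context: Let $n\ge2$, $E^n=\mathbb R^n$, $E^{n-1}=\mathrm{span}(e_2,\dots,e_n)$, $Cl_{n-1}$ the real Clifford algebra of $E^{n-1}$ (relations $uv+vu=-2(u,v)$), with $E^n=\mathbb R\oplus E^{n-1}\subset Cl_{n-1}$, $e_1\leftrightarrow 1$; $a'$, $a^*$ denote the principal automorphism ($e_j\mapsto-e_j$) and the reversion (anti-automorphism fixing $e_j$), $|\cdot|$ the canonical norm, and $\Gamma_n$ the group of products of nonzero vectors. $\tilde G=SL_2(\Gamma_n)$ is the group of matrices $\begin{pmatrix} a&b\\ c&d\end{pmatrix}$ with $a,b,c,d\in\Gamma_n\cup\{0\}$, $ad^*-bc^*=1$, $ab^*,cd^*\in E^n$; it is a twofold cover of $SO_0(1,n+1)$ acting on $S^n\simeq E^n\cup\{\infty\}$ by $x\mapsto(ax+b)(cx+d)^{-1}$. Its subgroups: $\tilde M=\{\mathrm{diag}(m,(m^* )^{-1}):m\in\Gamma_n,|m|=1\}\simeq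 Spin_n$, $A=\{a_t=\mathrm{diag}(t,t^{-1}):t>0\}$, $N=\{\begin{pmatrix}1&v\\0&1\end{pmatrix}:v\in E^n\}$, $\tilde P=\tilde MAN$, and $\tilde K=\{\begin{pmatrix} a&b\\ -b'&a'\end{pmatrix}:|a|^2+|b|^2=1,\ ab^*\in E^n\}\simeq Spin_{n+1}$, with $\tilde K\cap\tilde P=\tilde M$ and $S^n=\tilde G/\tilde P=\tilde K/\tilde M$. $\Sigma$ is a finite-dimensional complex Hilbert space with skew-Hermitian $E_1,\dots,E_n$, $E_iE_j+E_jE_i=-2\delta_{ij}\mathrm{Id}$ (the spinor module), and $\tau$ is the representation of $\tilde M$ given by $\mathrm{diag}(m,(m^* )^{-1})\mapsto\tau(m)$, where $\tau:Cl_{n-1}\to\mathrm{End}(\Sigma)$ is the unital algebra homomorphism with $\tau(e_j)=E_1E_j$. For $\lambda\in\mathbb C$, $\pi_\lambda$ is the representation of $\tilde G$ by left translation $\pi_\lambda(g)f(h)=f(g^{-1}h)$ on the space of smooth $f:\tilde G\to\Sigma$ with $f(h\,\tilde m\,a_t\,\nu)=t^{-2\lambda-n}\tau(\tilde m)^{-1}f(h)$ for $\tilde m\in\tilde M$, $a_t\in A$, $\nu\in N$; its compact picture is obtained by restricting $f$ to $\tilde K$, which identifies the representation space, for every $\lambda$, with the space of smooth sections of the bundle $\tilde K\times_{\tilde M}\Sigma$ over $S^n$ (the spinor bundle). The Dirac operator $\mathbb D$ of the round unit sphere is normalized so that its eigenvalues are $\pm(\frac n2+k)$, $k\in\{0,1,2,\dots\}$.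 *)

theory Defs
  imports "HOL-Analysis.Analysis"
begin

text \<open>The type variable 'n (finite, linearly ordered) indexes the basis vectors
  e_2,...,e_n of E^{n-1}; hence n = CARD('n) + 1 >= 2.  Cl_{n-1} is realised on
  the basis of blades e_A, A a subset of 'n (listed in increasing order), as the
  Euclidean space real^('n set); its Euclidean norm is the canonical norm.\<close>

type_synonym 'n cl = "real ^ ('n set)"

definition cl_sgn :: "'n::{finite,linorder} set \<Rightarrow> 'n set \<Rightarrow> real" where
  "cl_sgn A B = (-1) ^ (card {(a, b). a \<in> A \<and> b \<in> B \<and> b < a} + card (A \<inter> B))"

definition clmul :: "'n::{finite,linorder} cl \<Rightarrow> 'n cl \<Rightarrow> 'n cl" where
  "clmul x y = (\<chi> C. \<Sum>A\<in>UNIV. \<Sum>B\<in>UNIV.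
      if (A - B) \<union> (B - A) = C then cl_sgn A B * (x $ A) * (y $ B) else 0)"

definition clone :: "'n::{finite,linorder} cl" where
  "clone = (\<chi> A. if A = {} then 1 else 0)"

definition clvec :: "'n::{finite,linorder} \<Rightarrow> 'n cl" where
  "clvec j = (\<chi> A. if A = {j} then 1 else 0)"

text \<open>E^n = R (+) E^{n-1} inside Cl_{n-1}, with e_1 identified with 1\<close>
definition isvec :: "'n::{finite,linorder} cl \<Rightarrow> bool" where
  "isvec x \<longleftrightarrow> (\<forall>A. 2 \<le> card A \<longrightarrow> x $ A = 0)"

definition clprin :: "'n::{finite,linorder} cl \<Rightarrow> 'n cl" where
  "clprin x = (\<chi> A. (-1) ^ card A * x $ A)"

definition clrev :: "'n::{finite,linorder} cl \<Rightarrow> 'n cl" where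
  "clrev x = (\<chi> A. (-1) ^ (card A * (card A - 1) div 2) * x $ A)"

inductive_set clgamma :: "'n::{finite,linorder} cl set" where
  base: "isvec v \<Longrightarrow> v \<noteq> 0 \<Longrightarrow> v \<in> clgamma"
| step: "x \<in> clgamma \<Longrightarrow> isvec v \<Longrightarrow> v \<noteq> 0 \<Longrightarrow> clmul x v \<in> clgamma"

text \<open>A 2x2 matrix (a b; c d) is represented as the tuple (a, b, c, d).\<close>
type_synonym 'n mat2 = "'n cl \<times> 'n cl \<times> 'n cl \<times> 'n cl"

definition mmul :: "'n::{finite,linorder} mat2 \<Rightarrow> 'n mat2 \<Rightarrow> 'n mat2" where
  "mmul g h = (case g of (a, b, c, d) \<Rightarrow> case h of (a2, b2, c2, d2) \<Rightarrow>
     (clmul a a2 + clmul b c2, clmul a b2 + clmul b d2,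
      clmul c a2 + clmul d c2, clmul c b2 + clmul d d2))"

definition midm :: "'n::{finite,linorder} mat2" where
  "midm = (clone, 0, 0, clone)"

definition Gt :: "'n::{finite,linorder} mat2 set" where
  "Gt = {(a, b, c, d). a \<in> clgamma \<union> {0} \<and> b \<in> clgamma \<union> {0} \<and>
          c \<in> clgamma \<union> {0} \<and> d \<in> clgamma \<union> {0} \<and>
          clmul a (clrev d) - clmul b (clrev c) = clone \<and>
          isvec (clmul a (clrev b)) \<and> isvec (clmul c (clrev d))}"

definition ginv :: "'n::{finite,linorder} mat2 \<Rightarrow> 'n mat2" where
  "ginv g = (THE h. h \<in> Gt \<and> mmul g h = midm)"

definition Mt :: "'n::{finite,linorder} mat2 set" where
  "Mt = {(m, 0, 0, d) | m d. m \<in> clgamma \<and> norm m = 1 \<and>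
          clmul d (clrev m) = clone \<and> clmul (clrev m) d = clone}"

definition aA :: "real \<Rightarrow> 'n::{finite,linorder} mat2" where
  "aA t = (t *\<^sub>R clone, 0, 0, (1 / t) *\<^sub>R clone)"

definition nN :: "'n::{finite,linorder} cl \<Rightarrow> 'n mat2" where
  "nN v = (clone, v, 0, clone)"

definition Kt :: "'n::{finite,linorder} mat2 set" where
  "Kt = Gt \<inter> {(a, b, c, d). c = - clprin b \<and> d = clprin a \<and>
          (norm a)\<^sup>2 + (norm b)\<^sup>2 = 1 \<and> isvec (clmul a (clrev b))}"

definition madj :: "complex ^'d ^'d \<Rightarrow> complex ^'d ^'d" where
  "madj M = (\<chi> i j. cnj (M $ j $ i))"

text \<open>E1 plays the role of E_1 and E j of E_j for j = 2..n.\<close>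
definition spinor_module :: "complex^'d^'d \<Rightarrow> ('n::{finite,linorder} \<Rightarrow> complex^'d^'d) \<Rightarrow> bool" where
  "spinor_module E1 E \<longleftrightarrow>
     madj E1 = - E1 \<and> (\<forall>j. madj (E j) = - E j) \<and>
     E1 ** E1 = - mat 1 \<and>
     (\<forall>j. E1 ** E j + E j ** E1 = 0) \<and>
     (\<forall>i j. E i ** E j + E j ** E i = (if i = j then - 2 *\<^sub>R mat 1 else 0))"

definition tau_blade :: "complex^'d^'d \<Rightarrow> ('n::{finite,linorder} \<Rightarrow> complex^'d^'d) \<Rightarrow> 'n set \<Rightarrow> complex^'d^'d" where
  "tau_blade E1 E A = foldr (\<lambda>j M. (E1 ** E j) ** M) (sorted_list_of_set A) (mat 1)"

text \<open>the unital algebra homomorphism tau with tau(e_j) = E_1 E_j\<close>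
definition tau :: "complex^'d^'d \<Rightarrow> ('n::{finite,linorder} \<Rightarrow> complex^'d^'d) \<Rightarrow> 'n cl \<Rightarrow> complex^'d^'d" where
  "tau E1 E x = (\<Sum>A\<in>UNIV. (x $ A) *\<^sub>R tau_blade E1 E A)"

definition is_section :: "complex^'d^'d \<Rightarrow> ('n::{finite,linorder} \<Rightarrow> complex^'d^'d) \<Rightarrow> ('n mat2 \<Rightarrow> complex^'d) \<Rightarrow> bool" where
  "is_section E1 E phi \<longleftrightarrow>
     (\<forall>k\<in>Kt. \<forall>m\<in>Mt. phi (mmul k m) = matrix_inv (tau E1 E (fst m)) *v phi k)"

text \<open>C^k and C^infinity on an open set of a Euclidean space; smoothness on a
  subset (here the compact submanifold K~) means: restriction of a C^infinity
  function defined on an open neighbourhood.\<close>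
fun Ck :: "nat \<Rightarrow> ('a::euclidean_space \<Rightarrow> 'b::euclidean_space) \<Rightarrow> 'a set \<Rightarrow> bool" where
  "Ck 0 f U = continuous_on U f"
| "Ck (Suc k) f U = (f differentiable_on U \<and> (\<forall>v. Ck k (\<lambda>x. frechet_derivative f (at x) v) U))"

definition smooth_on :: "'a::euclidean_space set \<Rightarrow> ('a \<Rightarrow> 'b::euclidean_space) \<Rightarrow> bool" where
  "smooth_on S f \<longleftrightarrow> (\<exists>U g. open U \<and> S \<subseteq> U \<and> (\<forall>k. Ck k g U) \<and> (\<forall>x\<in>S. g x = f x))"

text \<open>one-parameter subgroup exp(t X_v) of K~, v a unit vector of E^n:
  ( cos t, sin t v ; - sin t v', cos t ).  It acts on 0 by x = tan t v, so
  X_v has length 2 for the round unit-sphere metric; the frame X_{e_j}/2 is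
  orthonormal.\<close>
definition ucurve :: "'n::{finite,linorder} cl \<Rightarrow> real \<Rightarrow> 'n mat2" where
  "ucurve v t = (cos t *\<^sub>R clone, sin t *\<^sub>R v, - (sin t *\<^sub>R clprin v), cos t *\<^sub>R clone)"

definition lie_deriv :: "'n::{finite,linorder} cl \<Rightarrow> ('n mat2 \<Rightarrow> complex^'d) \<Rightarrow> 'n mat2 \<Rightarrow> complex^'d" where
  "lie_deriv v phi k = vector_derivative (\<lambda>t. phi (mmul k (ucurve v t))) (at 0)"

text \<open>D phi = sum_j c(Y_j) Y_j phi over an orthonormal frame Y_j = X_{e_j}/2,
  Clifford multiplication c(e_j) = E_j.\<close>
definition dirac :: "complex^'d^'d \<Rightarrow> ('n::{finite,linorder} \<Rightarrow> complex^'d^'d) \<Rightarrow> ('n mat2 \<Rightarrow> complex^'d) \<Rightarrow> 'n mat2 \<Rightarrow> complex^'d" where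
  "dirac E1 E phi k = (1/2::real) *\<^sub>R
     (E1 *v lie_deriv clone phi k + (\<Sum>j\<in>UNIV. E j *v lie_deriv (clvec j) phi k))"

fun dirac_m :: "complex^'d^'d \<Rightarrow> ('n::{finite,linorder} \<Rightarrow> complex^'d^'d) \<Rightarrow> nat \<Rightarrow> ('n mat2 \<Rightarrow> complex^'d) \<Rightarrow> 'n mat2 \<Rightarrow> complex^'d" where
  "dirac_m E1 E 0 phi = dirac E1 E phi"
| "dirac_m E1 E (Suc j) phi = (\<lambda>k. dirac E1 E (dirac E1 E (dirac_m E1 E j phi)) k
       - (real (Suc j))\<^sup>2 *\<^sub>R dirac_m E1 E j phi k)"

text \<open>extension of a section phi on K~ to the induced-picture function on G~,
  via the Iwasawa decomposition h = k a_t nu:  f(k a_t nu) = t^{-2 lambda - n} phi(k)\<close>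
definition ind_ext :: "complex \<Rightarrow> ('n::{finite,linorder} mat2 \<Rightarrow> complex^'d) \<Rightarrow> 'n mat2 \<Rightarrow> complex^'d" where
  "ind_ext lam phi h = (SOME z. \<exists>k t v. k \<in> Kt \<and> t > 0 \<and> isvec v \<and>
      h = mmul k (mmul (aA t) (nN v)) \<and>
      z = (complex_of_real t powr (- 2 * lam - of_nat (CARD('n) + 1))) *s phi k)"

definition pi_comp :: "complex \<Rightarrow> 'n::{finite,linorder} mat2 \<Rightarrow> ('n mat2 \<Rightarrow> complex^'d) \<Rightarrow> 'n mat2 \<Rightarrow> complex^'d" where
  "pi_comp lam g phi k = ind_ext lam phi (mmul (ginv g) k)"

end

(* For h in SL_2(Gamma_n) with first column h_1, a section extends to G~ by normalising h_1, so
   pi_lambda(g) acts as u^(-lambda-1/2) U, where u(k) = |first column of g^-1 k|^2 and U = pi_(-1/2)(g).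
   Writing g^-1 k = k' a_t n_w, the derivative of U phi splits into the derivative of phi at k' and
   Clifford terms that cancel in the Dirac operator D because sum_j E_j E_j = -n; hence u D U = U D.
   With p_m(X) the product of X - j over j = -m..m, the claim becomes the operator identity
   u^(m+1) p_m(D) u^m = p_m(u D).  On the sphere u - alpha is a first spherical harmonic for a
   constant alpha, and with c = [D, u] one has
     c u = u c,   c^2 = u^2 - 2 alpha u + 1,   [D^2, c] = 2 (u - alpha) D + c.
   These relations imply the identity by induction on m: for s = m + 1 they give
     (D^2 - s^2) p_m(D) u = (D u D + s [D^2, u] + s^2 u - 2 alpha s^2) p_m(D). *)

theory Submission
  imports Defs "HOL-Library.Function_Algebras"
begin

section \<open>The Clifford algebra\<close>

text \<open>Right multiplication by N fixes the first column of a matrix, and a_t scales it by t. An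
  induced function is therefore a homogeneous, M~-equivariant function on the cone of first columns,
  and a group element acts by the linear substitution z -> g^-1 z. This makes derivatives of
  translated sections computable. The relation u D U = U D gives p_m(u D) U = U p_m(D), so that g
  enters the operator identity only through u. The obstacle is that u does not commute with D. The
  relations for c have geometric sources: c is Clifford multiplication by grad u, so c^2 = -|grad
  u|^2; the constant 1 in it reflects that a_t = diag(t, 1/t) has determinant one; and the Hessian
  of u is (alpha - u) times the metric. In the commutator with D^2 the trace of the Hessian
  contributes n c and the brackets of the frame fields -(n - 1) c, which leaves the single c. Since
  these relations close up, all that follows is computation with words in D and u, without
  analysis.\<close>

notation clmul (infixl "\<cdot>" 70)

abbreviation sdiff :: "'a set \<Rightarrow> 'a set \<Rightarrow> 'a set" where
  "sdiff A B \<equiv> (A - B) \<union> (B - A)"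

section \<open>Blade signs and associativity of the Clifford product\<close>

lemma prod_sdiff:
  fixes f :: "'a::finite \<Rightarrow> real"
  assumes "\<And>x. f x * f x = 1"
  shows "prod f (sdiff A B) = prod f A * prod f B"
proof -
  have A: "prod f A = prod f (A - B) * prod f (A \<inter> B)"
    by (subst prod.union_disjoint[symmetric]) (auto intro!: prod.cong)
  have B: "prod f B = prod f (B - A) * prod f (A \<inter> B)"
    by (subst prod.union_disjoint[symmetric]) (auto intro!: prod.cong)
  have "prod f (A \<inter> B) * prod f (A \<inter> B) = 1"
    by (simp add: prod.distrib[symmetric] assms)
  moreover have "prod f (sdiff A B) = prod f (A - B) * prod f (B - A)"
    by (rule prod.union_disjoint) auto
  ultimately show ?thesis unfolding A B by simp
qed

text \<open>The tie counts as -1: a pair with b < a costs a transposition, and a = b a contraction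
  by e_a e_a = -1.\<close>

definition order_sgn :: "'n::linorder \<Rightarrow> 'n \<Rightarrow> real" where
  "order_sgn a b = (if b \<le> a then - 1 else 1)"

lemma order_sgn_sq: "order_sgn a b * order_sgn a b = 1"
  by (simp add: order_sgn_def)

text \<open>In product form the sign is a bicharacter with respect to symmetric difference, the
  group law on blades. Associativity, the anti-automorphism property of the reversion and the
  multiplicativity of \<open>tau\<close> rest on that.\<close>

lemma cl_sgn_eq_prod: "cl_sgn A B = (\<Prod>a\<in>A. \<Prod>b\<in>B. order_sgn a b)"
proof -
  have "(\<Prod>a\<in>A. \<Prod>b\<in>B. order_sgn a b) = (\<Prod>p\<in>A\<times>B. if snd p \<le> fst p then -1 else 1)"
    by (simp add: prod.cartesian_product order_sgn_def case_prod_unfold)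
  also have "\<dots> = (-1) ^ card {p \<in> A \<times> B. snd p \<le> fst p}"
    by (subst prod.inter_filter[symmetric]) auto
  also have "{p \<in> A \<times> B. snd p \<le> fst p} = {(a, b). a \<in> A \<and> b \<in> B \<and> b < a} \<union> (\<lambda>a. (a, a)) ` (A \<inter> B)"
    by (auto simp: image_iff)
  also have "card \<dots> = card {(a, b). a \<in> A \<and> b \<in> B \<and> b < a} + card (A \<inter> B)"
    by (subst card_Un_disjoint) (auto simp: card_image inj_on_def)
  finally show ?thesis by (simp add: cl_sgn_def)
qed

lemma prod_sq_one: "(\<And>x. f x * f x = (1::real)) \<Longrightarrow> prod f A * prod f A = 1"
  by (simp add: prod.distrib[symmetric])

lemma cl_sgn_sq: "cl_sgn A B * cl_sgn A B = 1"
  unfolding cl_sgn_eq_prod by (intro prod_sq_one order_sgn_sq)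

lemma cl_sgn_sdiff_left: "cl_sgn (sdiff A B) C = cl_sgn A C * cl_sgn B C"
  unfolding cl_sgn_eq_prod by (intro prod_sdiff prod_sq_one order_sgn_sq)

lemma cl_sgn_sdiff_right: "cl_sgn A (sdiff B C) = cl_sgn A B * cl_sgn A C"
proof -
  have "(\<Prod>b\<in>sdiff B C. order_sgn a b) = (\<Prod>b\<in>B. order_sgn a b) * (\<Prod>b\<in>C. order_sgn a b)" for a
    by (intro prod_sdiff order_sgn_sq)
  then show ?thesis unfolding cl_sgn_eq_prod by (simp add: prod.distrib)
qed

lemma cl_sgn_empty [simp]: "cl_sgn {} B = 1" "cl_sgn A {} = 1"
  by (simp_all add: cl_sgn_eq_prod)

text \<open>For given A and C only B = \<open>sdiff A C\<close> contributes, since every set is its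
  own inverse under symmetric difference.\<close>

lemma clmul_nth: "(x \<cdot> y) $ C = (\<Sum>A\<in>UNIV. cl_sgn A (sdiff A C) * x $ A * y $ sdiff A C)"
proof -
  have "(\<Sum>B\<in>UNIV. if sdiff A B = C then cl_sgn A B * (x $ A) * (y $ B) else 0)
      = cl_sgn A (sdiff A C) * x $ A * y $ sdiff A C" for A
  proof -
    have "sdiff A B = C \<longleftrightarrow> B = sdiff A C" for B by auto
    then show ?thesis by simp
  qed
  then show ?thesis by (simp add: clmul_def)
qed

lemma sdiff_cancel [simp]: "sdiff A (sdiff A B) = B" by auto

lemma bij_sdiff: "bij (sdiff A)"
  by (rule o_bij[where g = "sdiff A"]) (auto simp: fun_eq_iff)

lemma sum_sdiff_reindex: "(\<Sum>B\<in>UNIV. f (sdiff A B)) = (\<Sum>B\<in>UNIV. f B)"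
  for f :: "'a::finite set \<Rightarrow> 'b::comm_monoid_add"
  using sum.reindex_bij_betw[OF bij_sdiff[of A], of f] by simp

lemma clmul_assoc: "x \<cdot> y \<cdot> z = x \<cdot> (y \<cdot> z)"
proof (rule vec_eq_iff[THEN iffD2], rule allI)
  fix D
  have "(x \<cdot> y \<cdot> z) $ D = (\<Sum>C\<in>UNIV. \<Sum>A\<in>UNIV.
      cl_sgn C (sdiff C D) * cl_sgn A (sdiff A C) * x $ A * y $ sdiff A C * z $ sdiff C D)"
    by (simp only: clmul_nth sum_distrib_left sum_distrib_right mult.assoc)
  also have "\<dots> = (\<Sum>A\<in>UNIV. \<Sum>C\<in>UNIV.
      cl_sgn C (sdiff C D) * cl_sgn A (sdiff A C) * x $ A * y $ sdiff A C * z $ sdiff C D)"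
    by (rule sum.swap)
  \<comment> \<open>Substitution C = \<open>sdiff A B\<close>, a bijection for fixed A.\<close>
  also have "\<dots> = (\<Sum>A\<in>UNIV. \<Sum>B\<in>UNIV.
      cl_sgn (sdiff A B) (sdiff (sdiff A B) D) * cl_sgn A B * x $ A * y $ B * z $ sdiff (sdiff A B) D)"
    (is "(\<Sum>A\<in>UNIV. ?l A) = (\<Sum>A\<in>UNIV. ?r A)")
  proof (rule sum.cong[OF refl])
    fix A
    show "?l A = ?r A"
      using sum_sdiff_reindex[where A = A and f = "\<lambda>C. cl_sgn C (sdiff C D) * cl_sgn A (sdiff A C) * x $ A * y $ sdiff A C * z $ sdiff C D"]
      by (simp only: sdiff_cancel)
  qed
  also have "\<dots> = (\<Sum>A\<in>UNIV. \<Sum>B\<in>UNIV.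
      cl_sgn A (sdiff A D) * cl_sgn B (sdiff B (sdiff A D)) * x $ A * y $ B * z $ sdiff B (sdiff A D))"
  proof (intro sum.cong refl)
    fix A B
    have 1: "sdiff (sdiff A B) D = sdiff B (sdiff A D)" by auto
    \<comment> \<open>The cocycle identity of a twisted group algebra: expanding both sides by
      bimultiplicativity leaves the square of \<open>cl_sgn A B\<close>.\<close>
    have "cl_sgn (sdiff A B) (sdiff B (sdiff A D)) * cl_sgn A B
        = cl_sgn A B * cl_sgn A B * cl_sgn A (sdiff A D) * cl_sgn B (sdiff B (sdiff A D))"
      unfolding cl_sgn_sdiff_left[of A B] cl_sgn_sdiff_right[of A B] by (simp only: mult_ac)
    then show "cl_sgn (sdiff A B) (sdiff (sdiff A B) D) * cl_sgn A B * x $ A * y $ B * z $ sdiff (sdiff A B) D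
       = cl_sgn A (sdiff A D) * cl_sgn B (sdiff B (sdiff A D)) * x $ A * y $ B * z $ sdiff B (sdiff A D)"
      unfolding 1 by (simp only: cl_sgn_sq mult_1_left)
  qed
  also have "\<dots> = (x \<cdot> (y \<cdot> z)) $ D"
    by (simp only: clmul_nth sum_distrib_left sum_distrib_right mult_ac)
  finally show "(x \<cdot> y \<cdot> z) $ D = (x \<cdot> (y \<cdot> z)) $ D" .
qed

lemma bounded_bilinear_clmul: "bounded_bilinear clmul"
proof -
  have "bilinear clmul"
    unfolding bilinear_def linear_iff
    by (auto simp: vec_eq_iff clmul_nth sum.distrib algebra_simps sum_distrib_left)
  then show ?thesis by (simp add: bilinear_conv_bounded_bilinear)
qed

lemmas cl_simps =
  bounded_bilinear.add_left[OF bounded_bilinear_clmul]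
  bounded_bilinear.add_right[OF bounded_bilinear_clmul]
  bounded_bilinear.diff_left[OF bounded_bilinear_clmul]
  bounded_bilinear.diff_right[OF bounded_bilinear_clmul]
  bounded_bilinear.minus_left[OF bounded_bilinear_clmul]
  bounded_bilinear.minus_right[OF bounded_bilinear_clmul]
  bounded_bilinear.scaleR_left[OF bounded_bilinear_clmul]
  bounded_bilinear.scaleR_right[OF bounded_bilinear_clmul]

lemma clmul_zero [simp]: "0 \<cdot> x = 0" "x \<cdot> 0 = 0"
  by (simp_all add: vec_eq_iff clmul_nth)

lemma clone_mult [simp]: "clone \<cdot> x = x" "x \<cdot> clone = x"
proof -
  show "clone \<cdot> x = x"
    unfolding vec_eq_iff clmul_nth clone_def
    by (auto simp: if_distrib[where f = "\<lambda>t. _ * t"] if_distrib[where f = "\<lambda>t. t * _"] cong: if_cong)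
  have "(\<Sum>A\<in>UNIV. cl_sgn A (sdiff A C) * x $ A * clone $ sdiff A C) = x $ C" for C
  proof -
    have "(\<Sum>A\<in>UNIV. cl_sgn A (sdiff A C) * x $ A * clone $ sdiff A C) = (\<Sum>A\<in>UNIV. if A = C then x $ A else 0)"
    proof (rule sum.cong[OF refl])
      fix A
      have "sdiff A C = {} \<longleftrightarrow> A = C" by auto
      then show "cl_sgn A (sdiff A C) * x $ A * clone $ sdiff A C = (if A = C then x $ A else 0)"
        by (auto simp: clone_def)
    qed
    then show ?thesis by simp
  qed
  then show "x \<cdot> clone = x"
    by (simp add: vec_eq_iff clmul_nth)
qed

section \<open>The principal automorphism, the reversion and the inner product\<close>

definition rev_sgn :: "'a set \<Rightarrow> real" where
  "rev_sgn A = (-1) ^ (card A * (card A - 1) div 2)"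

definition prin_sgn :: "'a set \<Rightarrow> real" where
  "prin_sgn A = (-1) ^ card A"

lemma prin_sgn_sdiff: "prin_sgn (sdiff A B) = prin_sgn A * prin_sgn B"
  for A :: "'a::finite set"
  using prod_sdiff[of "\<lambda>_. -1" A B] by (simp add: prin_sgn_def)

lemma prin_sgn_sq [simp]: "prin_sgn A * prin_sgn A = 1"
  by (simp add: prin_sgn_def flip: power_mult_distrib)

text \<open>The sign of e_A e_A: half of the off-diagonal pairs of A are inversions, and the
  diagonal pairs are contractions.\<close>

lemma cl_sgn_same: "cl_sgn A A = rev_sgn A * prin_sgn A"
  for A :: "'n::{finite,linorder} set"
proof -
  let ?L = "{(a, b). a \<in> A \<and> b \<in> A \<and> b < a}" and ?G = "{(a, b). a \<in> A \<and> b \<in> A \<and> a < b}"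
    and ?E = "(\<lambda>a. (a, a)) ` A"
  have "?G = prod.swap ` ?L" by (auto simp: image_iff)
  then have G: "card ?G = card ?L" by (simp add: card_image inj_on_def)
  have "A \<times> A = ?L \<union> ?G \<union> ?E" by (auto simp: image_iff)
  then have "card A * card A = card (?L \<union> ?G \<union> ?E)" by (metis card_cartesian_product)
  also have "\<dots> = card ?L + card ?G + card ?E"
    by (subst card_Un_disjoint | auto)+
  finally have "card A * card A = 2 * card ?L + card A"
    by (simp add: G card_image inj_on_def)
  then have "card A * (card A - 1) div 2 = card ?L"
    by (simp add: diff_mult_distrib2)
  then show ?thesis
    by (simp add: cl_sgn_def rev_sgn_def prin_sgn_def power_add)
qed

text \<open>Up to \<open>prin_sgn\<close> the reversal sign is the quadratic form C ->
  \<open>cl_sgn C C\<close> of the bicharacter. Expanding it on a symmetric difference produces both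
  mixed signs, which is the anti-automorphism property on blades.\<close>

lemma rev_sgn_sdiff: "rev_sgn (sdiff A B) * cl_sgn A B = rev_sgn A * rev_sgn B * cl_sgn B A"
  for A :: "'n::{finite,linorder} set"
proof -
  have e: "rev_sgn C = cl_sgn C C * prin_sgn C" for C :: "'n set"
    unfolding cl_sgn_same by (simp add: mult.assoc)
  have "rev_sgn (sdiff A B) = rev_sgn A * rev_sgn B * cl_sgn A B * cl_sgn B A"
    unfolding e cl_sgn_sdiff_left cl_sgn_sdiff_right prin_sgn_sdiff by (simp add: mult_ac)
  then show ?thesis using cl_sgn_sq[of A B] by (simp add: mult_ac)
qed

lemma rev_sgn_sq [simp]: "rev_sgn A * rev_sgn A = 1"
  by (simp add: rev_sgn_def flip: power_mult_distrib)

lemma clprin_nth: "clprin x $ A = prin_sgn A * x $ A"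
  by (simp add: clprin_def prin_sgn_def)

lemma clrev_nth: "clrev x $ A = rev_sgn A * x $ A"
  by (simp add: clrev_def rev_sgn_def)

lemma clprin_mult: "clprin (x \<cdot> y) = clprin x \<cdot> clprin y"
proof (rule vec_eq_iff[THEN iffD2], rule allI)
  fix C
  have p: "prin_sgn C = prin_sgn A * prin_sgn (sdiff A C)" for A :: "'a set"
    using prin_sgn_sdiff[of A "sdiff A C"] by (simp only: sdiff_cancel)
  have "prin_sgn C * (cl_sgn A (sdiff A C) * x $ A * y $ sdiff A C)
    = cl_sgn A (sdiff A C) * (prin_sgn A * x $ A) * (prin_sgn (sdiff A C) * y $ sdiff A C)" for A
    unfolding p[of A] by (simp only: mult_ac)
  then show "clprin (x \<cdot> y) $ C = (clprin x \<cdot> clprin y) $ C"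
    unfolding clprin_nth clmul_nth sum_distrib_left by (intro sum.cong refl)
qed

lemma clrev_mult: "clrev (x \<cdot> y) = clrev y \<cdot> clrev x"
proof (rule vec_eq_iff[THEN iffD2], rule allI)
  fix C
  have s: "rev_sgn C * cl_sgn A (sdiff A C) = rev_sgn A * rev_sgn (sdiff A C) * cl_sgn (sdiff A C) A" for A :: "'a set"
    using rev_sgn_sdiff[of A "sdiff A C"] by (simp only: sdiff_cancel)
  have "clrev (x \<cdot> y) $ C = (\<Sum>A\<in>UNIV. (rev_sgn C * cl_sgn A (sdiff A C)) * (x $ A * y $ sdiff A C))"
    by (simp only: clrev_nth clmul_nth sum_distrib_left mult.assoc)
  also have "\<dots> = (\<Sum>A\<in>UNIV. cl_sgn (sdiff A C) A * clrev y $ sdiff A C * clrev x $ A)"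
    unfolding s clrev_nth by (simp only: mult_ac)
  also have "\<dots> = (\<Sum>A\<in>UNIV. cl_sgn (sdiff C A) (sdiff C (sdiff C A)) * clrev y $ sdiff C A * clrev x $ sdiff C (sdiff C A))"
  proof (intro sum.cong refl)
    fix A :: "'a set"
    have "sdiff A C = sdiff C A" by auto
    then show "cl_sgn (sdiff A C) A * clrev y $ sdiff A C * clrev x $ A
      = cl_sgn (sdiff C A) (sdiff C (sdiff C A)) * clrev y $ sdiff C A * clrev x $ sdiff C (sdiff C A)"
      by (simp only: sdiff_cancel)
  qed
  also have "\<dots> = (\<Sum>B\<in>UNIV. cl_sgn B (sdiff C B) * clrev y $ B * clrev x $ sdiff C B)"
    by (rule sum_sdiff_reindex)
  also have "\<dots> = (clrev y \<cdot> clrev x) $ C"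
    unfolding clmul_nth by (simp only: Un_commute)
  finally show "clrev (x \<cdot> y) $ C = (clrev y \<cdot> clrev x) $ C" .
qed

lemma clprin_linear [simp]:
  "clprin (x + y) = clprin x + clprin y" "clprin (x - y) = clprin x - clprin y"
  "clprin (- x) = - clprin x" "clprin (r *\<^sub>R x) = r *\<^sub>R clprin x" "clprin 0 = 0"
  "clprin clone = clone" "clprin (clprin x) = x"
proof -
  show "clprin (clprin x) = x"
    unfolding vec_eq_iff clprin_nth by (metis prin_sgn_sq mult.assoc mult_1)
  show "clprin clone = clone"
    by (simp add: vec_eq_iff clprin_nth clone_def prin_sgn_def)
qed (simp_all add: vec_eq_iff clprin_nth distrib_left right_diff_distrib)

lemma clrev_linear [simp]:
  "clrev (x + y) = clrev x + clrev y" "clrev (x - y) = clrev x - clrev y"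
  "clrev (- x) = - clrev x" "clrev (r *\<^sub>R x) = r *\<^sub>R clrev x" "clrev 0 = 0"
  "clrev clone = clone" "clrev (clrev x) = x"
proof -
  show "clrev (clrev x) = x"
    unfolding vec_eq_iff clrev_nth by (metis rev_sgn_sq mult.assoc mult_1)
  show "clrev clone = clone"
    by (simp add: vec_eq_iff clrev_nth clone_def rev_sgn_def)
qed (simp_all add: vec_eq_iff clrev_nth distrib_left right_diff_distrib)

lemma clrev_clprin: "clrev (clprin x) = clprin (clrev x)"
  by (simp add: vec_eq_iff clprin_nth clrev_nth)

text \<open>Clifford conjugation. Multiplication by the conjugate of x is adjoint to multiplication
  by x, and on the Clifford group the conjugate is the inverse up to the squared norm.\<close>

definition clbar :: "'n::{finite,linorder} cl \<Rightarrow> 'n cl" where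
  "clbar x = clprin (clrev x)"

lemma clbar_linear [simp]:
  "clbar (x + y) = clbar x + clbar y" "clbar (x - y) = clbar x - clbar y"
  "clbar (- x) = - clbar x" "clbar (r *\<^sub>R x) = r *\<^sub>R clbar x" "clbar 0 = 0"
  "clbar clone = clone" "clbar (clbar x) = x"
  by (simp_all add: clbar_def clrev_clprin)

lemma clbar_mult: "clbar (x \<cdot> y) = clbar y \<cdot> clbar x"
  by (simp add: clbar_def clrev_mult clprin_mult)

lemma clbar_clrev: "clbar (clrev x) = clprin x" "clrev (clbar x) = clprin x"
    "clbar (clprin x) = clrev x" "clprin (clbar x) = clrev x"
  by (simp_all add: clbar_def clrev_clprin)

text \<open>Only products of equal blades reach the scalar part, and e_A times its conjugate is
  1.\<close>

lemma inner_clmul_clbar: "inner x y = (x \<cdot> clbar y) $ {}"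
proof -
  have "(x \<cdot> clbar y) $ {} = (\<Sum>A\<in>UNIV. cl_sgn A A * (prin_sgn A * rev_sgn A) * (x $ A * y $ A))"
    by (simp add: clmul_nth clbar_def clprin_nth clrev_nth mult_ac)
  also have "\<dots> = (\<Sum>A\<in>UNIV. x $ A * y $ A)"
  proof (rule sum.cong[OF refl])
    fix A :: "'a set"
    have "cl_sgn A A * (prin_sgn A * rev_sgn A) = (prin_sgn A * prin_sgn A) * (rev_sgn A * rev_sgn A)"
      unfolding cl_sgn_same by (simp only: mult_ac)
    then show "cl_sgn A A * (prin_sgn A * rev_sgn A) * (x $ A * y $ A) = x $ A * y $ A" by simp
  qed
  finally show ?thesis by (simp add: inner_vec_def)
qed

lemma norm_clprin [simp]: "norm (clprin x) = norm x"
proof -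
  have "inner (clprin x) (clprin x) = inner x x"
    unfolding inner_vec_def clprin_nth
  proof (intro sum.cong refl)
    fix A
    have "(prin_sgn A * x $ A) * (prin_sgn A * x $ A) = (prin_sgn A * prin_sgn A) * (x $ A * x $ A)"
      by (simp only: mult_ac)
    then show "inner (prin_sgn A * x $ A) (prin_sgn A * x $ A) = inner (x $ A) (x $ A)" by simp
  qed
  then show ?thesis by (simp add: norm_eq_sqrt_inner)
qed

lemma norm_clrev [simp]: "norm (clrev x) = norm x"
proof -
  have "inner (clrev x) (clrev x) = inner x x"
    unfolding inner_vec_def clrev_nth
  proof (intro sum.cong refl)
    fix A
    have "(rev_sgn A * x $ A) * (rev_sgn A * x $ A) = (rev_sgn A * rev_sgn A) * (x $ A * x $ A)"
      by (simp only: mult_ac)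
    then show "inner (rev_sgn A * x $ A) (rev_sgn A * x $ A) = inner (x $ A) (x $ A)" by simp
  qed
  then show ?thesis by (simp add: norm_eq_sqrt_inner)
qed

lemma norm_clbar [simp]: "norm (clbar x) = norm x"
  by (simp add: clbar_def)

lemma inner_clbar_clbar [simp]: "inner (clbar x) (clbar y) = inner x y"
proof -
  have "norm (clbar x + clbar y) = norm (x + y)"
    by (metis clbar_linear(1) norm_clbar)
  then show ?thesis by (simp add: dot_norm)
qed

lemma inner_clmul_right: "inner (x \<cdot> y) z = inner x (z \<cdot> clbar y)"
  by (simp add: inner_clmul_clbar clbar_mult clmul_assoc)

text \<open>Conjugation is an isometric anti-automorphism that exchanges left and right
  multiplication, so the adjoint formula for the right side transfers.\<close>

lemma inner_clmul_left: "inner (y \<cdot> x) z = inner x (clbar y \<cdot> z)"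
proof -
  have "inner (y \<cdot> x) z = inner (clbar x \<cdot> clbar y) (clbar z)"
    by (metis clbar_mult inner_clbar_clbar)
  also have "\<dots> = inner x (clbar y \<cdot> z)"
    by (metis clbar_linear(7) clbar_mult inner_clbar_clbar inner_clmul_right)
  finally show ?thesis .
qed

lemma norm_clone [simp]: "norm (clone :: 'n::{finite,linorder} cl) = 1"
proof -
  have "inner (clone :: 'n cl) clone = 1"
    by (simp add: inner_clmul_clbar) (simp add: clone_def)
  then show ?thesis by (simp add: norm_eq_sqrt_inner)
qed

lemma clone_neq_zero [simp]: "clone \<noteq> (0 :: 'n::{finite,linorder} cl)"
  by (metis norm_clone norm_zero zero_neq_one)

section \<open>Vectors, the Clifford group and Vahlen matrices\<close>

lemma axis_mult: "axis A 1 \<cdot> axis B 1 = cl_sgn A B *\<^sub>R axis (sdiff A B) 1"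
proof (rule vec_eq_iff[THEN iffD2], rule allI)
  fix C
  have "(axis A 1 \<cdot> axis B 1) $ C = (\<Sum>A'\<in>UNIV. if A' = A then cl_sgn A (sdiff A C) * (axis B 1 :: 'a cl) $ sdiff A C else 0)"
    unfolding clmul_nth by (rule sum.cong[OF refl]) (simp add: axis_def)
  also have "\<dots> = cl_sgn A (sdiff A C) * (axis B 1 :: 'a cl) $ sdiff A C" by simp
  also have "\<dots> = (cl_sgn A B *\<^sub>R axis (sdiff A B) 1) $ C"
  proof -
    have "sdiff A C = B \<longleftrightarrow> C = sdiff A B" by auto
    then show ?thesis by (auto simp: axis_def)
  qed
  finally show "(axis A 1 \<cdot> axis B 1) $ C = (cl_sgn A B *\<^sub>R axis (sdiff A B) 1) $ C" .
qed

lemma clone_axis: "clone = axis {} 1" and clvec_axis: "clvec j = axis {j} 1"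
  by (simp_all add: vec_eq_iff clone_def clvec_def axis_def)

text \<open>The type \<open>'n option\<close> indexes e_1, ..., e_n, with \<open>None\<close> for
  e_1 = 1; its cardinality is n.\<close>

fun frame :: "'n option \<Rightarrow> 'n::{finite,linorder} cl" where
  "frame None = clone"
| "frame (Some j) = clvec j"

lemma sum_option: "(\<Sum>a\<in>UNIV. f a) = f None + (\<Sum>j\<in>UNIV. f (Some j))"
  for f :: "'n::finite option \<Rightarrow> 'b::comm_monoid_add"
  by (simp add: UNIV_option_conv sum.reindex o_def)

lemma isvec_frame [simp]: "isvec (frame a)"
  by (cases a) (auto simp: isvec_def clone_def clvec_def)

lemma isvec_clone [simp]: "isvec clone"
  using isvec_frame[of None] by simp

lemma isvec_closed [simp]:
  "isvec 0" "isvec x \<Longrightarrow> isvec y \<Longrightarrow> isvec (x + y)" "isvec x \<Longrightarrow> isvec y \<Longrightarrow> isvec (x - y)"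
  "isvec x \<Longrightarrow> isvec (r *\<^sub>R x)" "isvec x \<Longrightarrow> isvec (clprin x)"
  by (simp_all add: isvec_def clprin_nth)

lemma isvec_minus_iff [simp]: "isvec (- x) \<longleftrightarrow> isvec x"
  by (simp add: isvec_def)

lemma isvec_scaleR_iff: "r \<noteq> 0 \<Longrightarrow> isvec (r *\<^sub>R x) \<longleftrightarrow> isvec x"
  by (simp add: isvec_def)

lemma clrev_vec: "isvec x \<Longrightarrow> clrev x = x"
proof -
  assume x: "isvec x"
  have "rev_sgn A * x $ A = x $ A" for A
  proof (cases "2 \<le> card A")
    case False
    then have "card A = 0 \<or> card A = 1" by linarith
    then show ?thesis by (auto simp: rev_sgn_def)
  qed (use x in \<open>simp add: isvec_def\<close>)
  then show ?thesis by (simp add: vec_eq_iff clrev_nth)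
qed

lemma clbar_vec: "isvec x \<Longrightarrow> clbar x = clprin x"
  by (simp add: clbar_def clrev_vec)

lemma inner_frame: "inner (frame a) (frame b) = (if a = b then 1 else 0)"
  by (cases a; cases b) (auto simp: clone_axis clvec_axis inner_axis_axis)

lemma isvec_expand:
  assumes "isvec x" shows "x = (\<Sum>a\<in>UNIV. inner x (frame a) *\<^sub>R frame a)"
proof (rule vec_eq_iff[THEN iffD2], rule allI)
  fix A
  have "(\<Sum>a\<in>UNIV. inner x (frame a) *\<^sub>R frame a) $ A
     = x $ {} * clone $ A + (\<Sum>j\<in>UNIV. x $ {j} * clvec j $ A)"
    by (simp add: sum_option) (simp add: clone_axis clvec_axis inner_axis)
  also have "\<dots> = x $ A"
  proof (cases "2 \<le> card A")
    case True
    then have "x $ A = 0" "A \<noteq> {}" "\<And>j. A \<noteq> {j}" using assms by (auto simp: isvec_def)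
    then show ?thesis by (simp add: clone_def clvec_def)
  next
    case False
    then have "card A = 0 \<or> card A = 1" by linarith
    then consider "A = {}" | i where "A = {i}" by (auto simp: card_1_singleton_iff)
    then show ?thesis
    proof cases
      case 2
      have "(\<Sum>j\<in>UNIV. x $ {j} * clvec j $ A) = (\<Sum>j\<in>UNIV. if j = i then x $ {i} else 0)"
        by (rule sum.cong[OF refl]) (auto simp: clvec_def 2)
      then show ?thesis by (simp add: 2 clone_def)
    qed (simp add: clone_def clvec_def)
  qed
  finally show "x $ A = (\<Sum>a\<in>UNIV. inner x (frame a) *\<^sub>R frame a) $ A" by simp
qed

lemma isvec_linear_eqI:
  assumes "linear f" "linear g" "\<And>a. f (frame a) = g (frame a)" "isvec x"
  shows "f x = g x"
  by (subst (1 2) isvec_expand[OF assms(4)])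
     (simp add: linear_sum[OF assms(1)] linear_sum[OF assms(2)] linear_scale[OF assms(1)] linear_scale[OF assms(2)] assms(3))

text \<open>As e_1 = 1 commutes with everything, the relation that is uniform in all n indices
  concerns the products x y' and polarises x x' = |x|^2.\<close>

lemma frame_anticommute:
  fixes a b :: "'n::{finite,linorder} option"
  shows "frame a \<cdot> clprin (frame b) + frame b \<cdot> clprin (frame a) = (2 * inner (frame a) (frame b)) *\<^sub>R clone"
proof -
  have p: "clprin (clvec j :: 'n cl) = - clvec j" for j :: 'n
    by (simp add: vec_eq_iff clprin_nth clvec_def prin_sgn_def)
  have q: "(clvec i :: 'n cl) \<cdot> clvec j + clvec j \<cdot> clvec i = (- 2 * (if i = j then 1 else 0)) *\<^sub>R clone" for i j :: 'n
  proof (cases "i = j")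
    case True
    then show ?thesis
      by (simp add: clvec_axis clone_axis axis_mult cl_sgn_eq_prod order_sgn_def scaleR_left_distrib[symmetric] vec_eq_iff)
  next
    case False
    have "sdiff {i} {j} = {i, j}" "sdiff {j} {i} = {i, j}" using False by auto
    then show ?thesis using False
      by (auto simp: clvec_axis clone_axis axis_mult cl_sgn_eq_prod order_sgn_def scaleR_left_distrib[symmetric])
  qed
  show ?thesis
  proof (cases a; cases b)
    fix i j assume "a = Some i" "b = Some j"
    then have "frame a \<cdot> clprin (frame b) + frame b \<cdot> clprin (frame a) = - (clvec i \<cdot> clvec j + clvec j \<cdot> clvec i)"
      by (simp add: p cl_simps)
    then show ?thesis using inner_frame[of a b] \<open>a = Some i\<close> \<open>b = Some j\<close> by (simp only: q) simp
  next
    fix i assume "a = None" "b = None"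
    then show ?thesis using inner_frame[of a b] by (simp add: scaleR_2)
  next
    fix i assume "a = None" "b = Some i"
    then show ?thesis using inner_frame[of a b] by (simp add: p)
  next
    fix i assume "a = Some i" "b = None"
    then show ?thesis using inner_frame[of a b] by (simp add: p)
  qed
qed

lemma vec_polar:
  assumes "isvec v" "isvec w"
  shows "v \<cdot> clprin w + w \<cdot> clprin v = (2 * inner v w) *\<^sub>R clone"
proof -
  have 1: "v \<cdot> clprin (frame b) + frame b \<cdot> clprin v = (2 * inner v (frame b)) *\<^sub>R clone" for b
    by (rule isvec_linear_eqI[where f = "\<lambda>v. v \<cdot> clprin (frame b) + frame b \<cdot> clprin v" and g = "\<lambda>v. (2 * inner v (frame b)) *\<^sub>R clone"])
       (auto intro!: linearI simp: cl_simps algebra_simps inner_add_left frame_anticommute assms)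
  show ?thesis
    by (rule isvec_linear_eqI[where f = "\<lambda>w. v \<cdot> clprin w + w \<cdot> clprin v" and g = "\<lambda>w. (2 * inner v w) *\<^sub>R clone"])
       (auto intro!: linearI simp: cl_simps algebra_simps inner_add_right 1 assms)
qed

lemma vec_polar':
  assumes "isvec v" "isvec w"
  shows "clprin v \<cdot> w + clprin w \<cdot> v = (2 * inner v w) *\<^sub>R clone"
proof -
  have "clprin (v \<cdot> clprin w + w \<cdot> clprin v) = clprin ((2 * inner v w) *\<^sub>R clone)"
    using vec_polar[OF assms] by simp
  then show ?thesis by (simp add: clprin_mult)
qed

lemma scaleR_cancelD: "r *\<^sub>R x = r *\<^sub>R y \<Longrightarrow> r \<noteq> 0 \<Longrightarrow> x = y"
  for x y :: "'a::real_vector"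
  by simp

lemma vec_clprin:
  assumes "isvec v" shows "v \<cdot> clprin v = (norm v)\<^sup>2 *\<^sub>R clone" "clprin v \<cdot> v = (norm v)\<^sup>2 *\<^sub>R clone"
proof -
  have "2 *\<^sub>R (v \<cdot> clprin v) = 2 *\<^sub>R ((norm v)\<^sup>2 *\<^sub>R clone)"
    using vec_polar[OF assms assms] by (simp add: power2_norm_eq_inner scaleR_2[symmetric])
  then show "v \<cdot> clprin v = (norm v)\<^sup>2 *\<^sub>R clone" by (rule scaleR_cancelD) simp
  have "2 *\<^sub>R (clprin v \<cdot> v) = 2 *\<^sub>R ((norm v)\<^sup>2 *\<^sub>R clone)"
    using vec_polar'[OF assms assms] by (simp add: power2_norm_eq_inner scaleR_2[symmetric])
  then show "clprin v \<cdot> v = (norm v)\<^sup>2 *\<^sub>R clone" by (rule scaleR_cancelD) simp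
qed

text \<open>The reflection formula v w v = 2 (v, w') v - |v|^2 w', obtained by exchanging w and v
  with the polar relation.\<close>

lemma isvec_triple:
  assumes "isvec v" "isvec w" shows "isvec (v \<cdot> w \<cdot> v)"
proof -
  have "w \<cdot> v = (2 * inner v (clprin w)) *\<^sub>R clone - clprin v \<cdot> clprin w"
    using vec_polar'[of "v" "clprin w"] assms by (simp add: algebra_simps)
  then have "v \<cdot> w \<cdot> v = (2 * inner v (clprin w)) *\<^sub>R v - (v \<cdot> clprin v) \<cdot> clprin w"
    by (simp add: clmul_assoc cl_simps)
  then show ?thesis using assms by (simp add: vec_clprin cl_simps)
qed

lemma isvec_triple_polar:
  assumes "isvec v" "isvec w" "isvec z" shows "isvec (w \<cdot> v \<cdot> z + z \<cdot> v \<cdot> w)"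
proof -
  have "w \<cdot> v \<cdot> z + z \<cdot> v \<cdot> w = (w + z) \<cdot> v \<cdot> (w + z) - w \<cdot> v \<cdot> w - z \<cdot> v \<cdot> z"
    by (simp add: cl_simps algebra_simps)
  then show ?thesis using assms by (simp add: isvec_triple)
qed

section \<open>The Clifford group\<close>

abbreviation clgamma0 :: "'n::{finite,linorder} cl set" where
  "clgamma0 \<equiv> clgamma \<union> {0}"

lemma clgamma_mult: "y \<in> clgamma \<Longrightarrow> x \<in> clgamma \<Longrightarrow> x \<cdot> y \<in> clgamma"
  by (induction rule: clgamma.induct) (auto intro: clgamma.intros simp flip: clmul_assoc)

lemma clgamma0_mult: "x \<in> clgamma0 \<Longrightarrow> y \<in> clgamma0 \<Longrightarrow> x \<cdot> y \<in> clgamma0"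
  by (auto intro: clgamma_mult)

lemma vec_clgamma0: "isvec v \<Longrightarrow> v \<in> clgamma0"
  by (auto intro: clgamma.base)

lemma clprin_eq_0_iff [simp]: "clprin x = 0 \<longleftrightarrow> x = 0"
  by (metis clprin_linear(5) clprin_linear(7))

lemma clgamma_clprin: "x \<in> clgamma \<Longrightarrow> clprin x \<in> clgamma"
  by (induction rule: clgamma.induct) (auto intro: clgamma.intros simp: clprin_mult)

lemma clgamma_clrev: "x \<in> clgamma \<Longrightarrow> clrev x \<in> clgamma"
  by (induction rule: clgamma.induct)
     (auto intro: clgamma.intros clgamma_mult simp: clrev_mult clrev_vec)

lemma clgamma_scaleR: "r \<noteq> 0 \<Longrightarrow> x \<in> clgamma \<Longrightarrow> r *\<^sub>R x \<in> clgamma"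
  using clgamma_mult[of x "r *\<^sub>R clone"] clgamma.base[of "r *\<^sub>R clone"] by (simp add: cl_simps)

lemma clgamma0_closed:
  fixes x :: "'n::{finite,linorder} cl"
  shows "x \<in> clgamma0 \<Longrightarrow> clprin x \<in> clgamma0" "x \<in> clgamma0 \<Longrightarrow> clrev x \<in> clgamma0"
  "x \<in> clgamma0 \<Longrightarrow> clbar x \<in> clgamma0" "x \<in> clgamma0 \<Longrightarrow> r *\<^sub>R x \<in> clgamma0"
  "x \<in> clgamma0 \<Longrightarrow> - x \<in> clgamma0"
proof -
  show s: "x \<in> clgamma0 \<Longrightarrow> r *\<^sub>R x \<in> clgamma0" for r and x :: "'n cl"
    by (cases "r = 0") (auto intro: clgamma_scaleR)
  show "x \<in> clgamma0 \<Longrightarrow> - x \<in> clgamma0" using s[of x "-1"] by simp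
qed (auto intro: clgamma_clprin clgamma_clrev simp: clbar_def)

text \<open>The induction yields only some positive scalar; that it is the squared norm is read off
  afterwards from the scalar part.\<close>

lemma clgamma_clbar_ex:
  assumes "x \<in> clgamma"
  shows "\<exists>r>0. x \<cdot> clbar x = r *\<^sub>R clone \<and> clbar x \<cdot> x = r *\<^sub>R clone"
  using assms
proof induction
  case (base v)
  then show ?case by (intro exI[of _ "(norm v)\<^sup>2"]) (simp add: clbar_vec vec_clprin)
next
  case (step x v)
  then obtain r where r: "r > 0" "x \<cdot> clbar x = r *\<^sub>R clone" "clbar x \<cdot> x = r *\<^sub>R clone" by blast
  have "x \<cdot> v \<cdot> clbar (x \<cdot> v) = x \<cdot> (v \<cdot> clprin v) \<cdot> clbar x"
       "clbar (x \<cdot> v) \<cdot> (x \<cdot> v) = clprin v \<cdot> (clbar x \<cdot> x) \<cdot> v"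
    using step by (simp_all add: clbar_mult clbar_vec clmul_assoc)
  then show ?case using step r
    by (intro exI[of _ "r * (norm v)\<^sup>2"]) (simp add: vec_clprin cl_simps mult.commute)
qed

lemma clone_nth_empty: "clone $ {} = 1" by (simp add: clone_def)

lemma clgamma_clbar:
  assumes "x \<in> clgamma0"
  shows "x \<cdot> clbar x = (norm x)\<^sup>2 *\<^sub>R clone" "clbar x \<cdot> x = (norm x)\<^sup>2 *\<^sub>R clone"
proof -
  have "x \<cdot> clbar x = (norm x)\<^sup>2 *\<^sub>R clone \<and> clbar x \<cdot> x = (norm x)\<^sup>2 *\<^sub>R clone"
  proof (cases "x = 0")
    case False
    then obtain r where r: "x \<cdot> clbar x = r *\<^sub>R clone" "clbar x \<cdot> x = r *\<^sub>R clone"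
      using clgamma_clbar_ex assms by blast
    have "(norm x)\<^sup>2 = r"
      using r(1) by (simp add: power2_norm_eq_inner inner_clmul_clbar clone_nth_empty)
    then show ?thesis using r by simp
  qed simp
  then show "x \<cdot> clbar x = (norm x)\<^sup>2 *\<^sub>R clone" "clbar x \<cdot> x = (norm x)\<^sup>2 *\<^sub>R clone" by auto
qed

lemma clgamma_nonzero: "x \<in> clgamma \<Longrightarrow> x \<noteq> 0"
  using clgamma_clbar_ex[of x] by auto

lemma clgamma_clrev_clprin:
  assumes "x \<in> clgamma0"
  shows "clrev x \<cdot> clprin x = (norm x)\<^sup>2 *\<^sub>R clone" "clprin x \<cdot> clrev x = (norm x)\<^sup>2 *\<^sub>R clone"
  using clgamma_clbar[OF clgamma0_closed(2)[OF assms]] by (simp_all add: clbar_clrev)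

lemma inner_clgamma_left:
  "x \<in> clgamma0 \<Longrightarrow> inner (x \<cdot> y) (x \<cdot> z) = (norm x)\<^sup>2 * inner y z"
  by (simp add: inner_clmul_left clmul_assoc[symmetric] clgamma_clbar cl_simps)

lemma inner_clgamma_right:
  "x \<in> clgamma0 \<Longrightarrow> inner (y \<cdot> x) (z \<cdot> x) = (norm x)\<^sup>2 * inner y z"
  by (simp add: inner_clmul_right clmul_assoc clgamma_clbar cl_simps)

lemma norm_clgamma_left: "x \<in> clgamma0 \<Longrightarrow> norm (x \<cdot> y) = norm x * norm y"
  by (rule power2_eq_imp_eq) (simp_all add: power2_norm_eq_inner inner_clgamma_left power_mult_distrib)

text \<open>Absorbing one vector factor w of x at a time replaces v by w v w, again a vector. This
  is the action of the Clifford group on E^n.\<close>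

lemma isvec_sandwich:
  assumes "x \<in> clgamma0" "isvec v" shows "isvec (x \<cdot> v \<cdot> clrev x)"
proof -
  have "isvec (x \<cdot> v \<cdot> clrev x)" if "x \<in> clgamma" for x
    using that assms(2)
  proof (induction arbitrary: v)
    case (base w v) then show ?case by (simp add: clrev_vec isvec_triple)
  next
    case (step x w)
    have "x \<cdot> w \<cdot> v \<cdot> clrev (x \<cdot> w) = x \<cdot> (w \<cdot> v \<cdot> w) \<cdot> clrev x"
      using step by (simp add: clrev_mult clrev_vec clmul_assoc)
    then show ?case using step by (simp add: isvec_triple)
  qed
  then show ?thesis using assms by auto
qed

lemma isvec_clrev: "isvec x \<Longrightarrow> isvec (clrev x)"
  by (simp add: clrev_vec)

lemma isvec_clrev_swap: "isvec (a \<cdot> clrev b) \<Longrightarrow> isvec (b \<cdot> clrev a)"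
  by (drule isvec_clrev) (simp add: clrev_mult)

lemma isvec_clrev_swap': "isvec (clrev a \<cdot> b) \<Longrightarrow> isvec (clrev b \<cdot> a)"
  by (drule isvec_clrev) (simp add: clrev_mult)

text \<open>Up to a positive factor b^-1 is the conjugate of b, and b^-1 a is the sandwich of the
  vector \<open>a \<cdot> clrev b\<close> between b^-1 and its reversal.\<close>

lemma vec_quotient_left:
  assumes "isvec (a \<cdot> clrev b)" "b \<in> clgamma"
  obtains v where "isvec v" "a = b \<cdot> v"
proof
  let ?r = "(norm b)\<^sup>2"
  have b: "b \<in> clgamma0" "?r \<noteq> 0" using assms clgamma_nonzero by auto
  have "?r *\<^sub>R (clbar b \<cdot> a) = clbar b \<cdot> (a \<cdot> clrev b) \<cdot> clrev (clbar b)"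
    by (simp add: clmul_assoc clbar_clrev clgamma_clrev_clprin[OF b(1)] cl_simps)
  then have "isvec (?r *\<^sub>R (clbar b \<cdot> a))"
    using isvec_sandwich[OF clgamma0_closed(3)[OF b(1)] assms(1)] by simp
  then show "isvec ((1 / ?r) *\<^sub>R (clbar b \<cdot> a))" using b(2) by (simp add: isvec_scaleR_iff)
  show "a = b \<cdot> ((1 / ?r) *\<^sub>R (clbar b \<cdot> a))"
    using b(2) by (simp add: cl_simps clmul_assoc[symmetric] clgamma_clbar[OF b(1)])
qed

lemma vec_quotient_right:
  assumes "isvec (clrev b \<cdot> a)" "b \<in> clgamma"
  obtains v where "isvec v" "a = v \<cdot> b"
proof -
  have "isvec (clrev a \<cdot> clrev (clrev b))"
    using isvec_clrev[OF assms(1)] by (simp add: clrev_mult)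
  then obtain v where "isvec v" "clrev a = clrev b \<cdot> v"
    using vec_quotient_left clgamma_clrev[OF assms(2)] by metis
  then show thesis
    using that[of v] by (metis clrev_linear(7) clrev_mult clrev_vec)
qed

text \<open>Multiplication by the conjugate of x identifies y as a multiple of that conjugate, which
  commutes with x.\<close>

lemma clgamma_left_inverse:
  assumes "x \<in> clgamma0" "x \<cdot> y = r *\<^sub>R clone" "r \<noteq> 0" shows "y \<cdot> x = r *\<^sub>R clone" "x \<noteq> 0"
proof -
  show "x \<noteq> 0" using assms by auto
  have n: "(norm x)\<^sup>2 \<noteq> 0" using \<open>x \<noteq> 0\<close> by simp
  have "(norm x)\<^sup>2 *\<^sub>R y = clbar x \<cdot> (x \<cdot> y)"
    by (simp add: clmul_assoc[symmetric] clgamma_clbar[OF assms(1)] cl_simps)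
  also have "\<dots> = r *\<^sub>R clbar x" by (simp add: assms cl_simps)
  finally have "(norm x)\<^sup>2 *\<^sub>R (y \<cdot> x) = (norm x)\<^sup>2 *\<^sub>R (r *\<^sub>R clone)"
    by (metis (no_types, lifting) assms(1) cl_simps(7) clgamma_clbar(2) scaleR_left_commute)
  then show "y \<cdot> x = r *\<^sub>R clone" using n by (rule scaleR_cancelD)
qed

text \<open>The row conditions imply the column conditions: writing \<open>a = b w\<close> and \<open>c = d z\<close>, the
  pseudo-determinant is \<open>b (w - z) d\<^sup>*\<close>, so that \<open>d\<^sup>* b\<close> is the inverse of a vector.\<close>
lemma vahlen_column:
  assumes "a \<in> clgamma0" "b \<in> clgamma0" "c \<in> clgamma0" "d \<in> clgamma0"
    and "isvec (a \<cdot> clrev b)" "isvec (c \<cdot> clrev d)"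
    and det: "a \<cdot> clrev d - b \<cdot> clrev c = r *\<^sub>R clone" and r: "r \<noteq> 0"
  shows "isvec (clrev d \<cdot> b)" "clrev d \<cdot> a - clrev b \<cdot> c = r *\<^sub>R clone"
proof -
  have "isvec (clrev d \<cdot> b) \<and> clrev d \<cdot> a - clrev b \<cdot> c = r *\<^sub>R clone"
  proof (cases "b = 0")
    case True
    then have "clrev d \<cdot> a = r *\<^sub>R clone"
      using clgamma_left_inverse(1)[OF assms(1) _ r] det by simp
    then show ?thesis using True by simp
  next
    case b: False
    show ?thesis
    proof (cases "d = 0")
      case True
      then have "b \<cdot> clrev c = (- r) *\<^sub>R clone" using det by (simp add: minus_equation_iff)
      then have "clrev c \<cdot> b = (- r) *\<^sub>R clone"
        using clgamma_left_inverse(1)[OF assms(2)] r by (metis neg_equal_0_iff_equal)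
      then have "clrev (clrev c \<cdot> b) = (- r) *\<^sub>R clone" by simp
      then show ?thesis using True by (simp add: clrev_mult)
    next
      case d: False
      obtain w where w: "isvec w" "a = b \<cdot> w"
        using vec_quotient_left[OF assms(5)] b assms(2) by blast
      obtain z where z: "isvec z" "c = d \<cdot> z"
        using vec_quotient_left[OF assms(6)] d assms(4) by blast
      have e: "b \<cdot> ((w - z) \<cdot> clrev d) = r *\<^sub>R clone"
        using det by (simp add: w z clrev_mult clrev_vec cl_simps clmul_assoc)
      have "(w - z) \<cdot> (clrev d \<cdot> b) = r *\<^sub>R clone"
        using clgamma_left_inverse(1)[OF assms(2) e r] by (simp add: clmul_assoc)
      moreover have wz: "isvec (w - z)" using w z by simp
      ultimately have inv: "(clrev d \<cdot> b) \<cdot> (w - z) = r *\<^sub>R clone" "w - z \<noteq> 0"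
        using clgamma_left_inverse[OF vec_clgamma0[OF wz] _ r] by auto
      have "(norm (w - z))\<^sup>2 *\<^sub>R (clrev d \<cdot> b) = (clrev d \<cdot> b) \<cdot> ((w - z) \<cdot> clprin (w - z))"
        unfolding vec_clprin(1)[OF wz] by (simp add: cl_simps)
      also have "\<dots> = r *\<^sub>R clprin (w - z)"
        unfolding clmul_assoc[symmetric, of "clrev d \<cdot> b"] inv(1) by (simp add: cl_simps scaleR_diff_right)
      finally have "isvec ((norm (w - z))\<^sup>2 *\<^sub>R (clrev d \<cdot> b))" using wz by (metis isvec_closed(4,5))
      then have v: "isvec (clrev d \<cdot> b)" using inv(2) by (simp add: isvec_scaleR_iff)
      have "clrev b \<cdot> d = clrev d \<cdot> b" using clrev_vec[OF v] by (simp add: clrev_mult)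
      then have "clrev d \<cdot> a - clrev b \<cdot> c = (clrev d \<cdot> b) \<cdot> (w - z)"
        by (simp add: w z cl_simps clmul_assoc[symmetric])
      then show ?thesis using v inv(1) by simp
    qed
  qed
  then show "isvec (clrev d \<cdot> b)" "clrev d \<cdot> a - clrev b \<cdot> c = r *\<^sub>R clone" by auto
qed

section \<open>Vahlen matrices form a group\<close>

lemma GtD:
  assumes "(a, b, c, d) \<in> Gt"
  shows "a \<in> clgamma0" "b \<in> clgamma0" "c \<in> clgamma0" "d \<in> clgamma0"
    "isvec (a \<cdot> clrev b)" "isvec (c \<cdot> clrev d)" "a \<cdot> clrev d - b \<cdot> clrev c = clone"
    "isvec (clrev d \<cdot> b)" "isvec (clrev c \<cdot> a)" "clrev d \<cdot> a - clrev b \<cdot> c = clone"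
proof -
  show *: "a \<in> clgamma0" "b \<in> clgamma0" "c \<in> clgamma0" "d \<in> clgamma0"
    "isvec (a \<cdot> clrev b)" "isvec (c \<cdot> clrev d)" "a \<cdot> clrev d - b \<cdot> clrev c = clone"
    using assms unfolding Gt_def by blast+
  show "isvec (clrev d \<cdot> b)" "clrev d \<cdot> a - clrev b \<cdot> c = clone"
    using vahlen_column[OF *(1-6), of 1] * by simp_all
  \<comment> \<open>Exchanging the two columns changes the sign of the pseudo-determinant, which is
    why \<open>vahlen_column\<close> allows an arbitrary nonzero r.\<close>
  have e: "b \<cdot> clrev c - a \<cdot> clrev d = (- 1) *\<^sub>R clone" using *(7) by (simp add: algebra_simps)
  then show "isvec (clrev c \<cdot> a)"
    using vahlen_column(1)[OF *(2,1,4,3) isvec_clrev_swap[OF *(5)] isvec_clrev_swap[OF *(6)] e] by simp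
qed

lemma GtI:
  assumes "a \<in> clgamma0" "b \<in> clgamma0" "c \<in> clgamma0" "d \<in> clgamma0"
    "isvec (a \<cdot> clrev b)" "isvec (c \<cdot> clrev d)" "a \<cdot> clrev d - b \<cdot> clrev c = clone"
  shows "(a, b, c, d) \<in> Gt"
  using assms unfolding Gt_def by blast

text \<open>The Clifford group is not closed under sums, but this one factors as b (w + z) p with
  vectors w and z.\<close>

lemma clgamma0_row_column:
  assumes "a \<in> clgamma0" "b \<in> clgamma0" "p \<in> clgamma0" "q \<in> clgamma0"
    "isvec (a \<cdot> clrev b)" "isvec (clrev p \<cdot> q)"
  shows "a \<cdot> p + b \<cdot> q \<in> clgamma0"
proof (cases "b = 0 \<or> p = 0")
  case True
  then show ?thesis using assms by (auto intro: clgamma_mult)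
next
  case False
  obtain w where w: "isvec w" "a = b \<cdot> w"
    using vec_quotient_left[OF assms(5)] False assms(2) by blast
  obtain z where z: "isvec z" "q = z \<cdot> p"
    using vec_quotient_right[OF assms(6)] False assms(3) by blast
  have "a \<cdot> p + b \<cdot> q = b \<cdot> (w + z) \<cdot> p"
    by (simp add: w z cl_simps clmul_assoc)
  also have "\<dots> \<in> clgamma0"
    by (intro clgamma0_mult assms vec_clgamma0 isvec_closed w z)
  finally show ?thesis .
qed

text \<open>The two pure terms are sandwiches of vectors, and the determinant turns one mixed term
  into \<open>a \<cdot> clrev b\<close> plus a remainder. The remainder is a vector only together
  with the other mixed term: after a = b w both stand between b and its reversal, and q = z p turns
  their sum into the polarised triple product.\<close>

lemma isvec_row:
  assumes ab: "a \<in> clgamma0" "b \<in> clgamma0" "isvec (a \<cdot> clrev b)" and pqrs: "(p, r, q, s) \<in> Gt"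
  shows "isvec ((a \<cdot> p + b \<cdot> q) \<cdot> clrev (a \<cdot> r + b \<cdot> s))"
proof -
  note G = GtD[OF pqrs]
  have "(a \<cdot> p + b \<cdot> q) \<cdot> clrev (a \<cdot> r + b \<cdot> s)
     = a \<cdot> (p \<cdot> clrev r) \<cdot> clrev a + b \<cdot> (q \<cdot> clrev s) \<cdot> clrev b + a \<cdot> (p \<cdot> clrev s) \<cdot> clrev b + b \<cdot> (q \<cdot> clrev r) \<cdot> clrev a"
    by (simp add: clrev_mult cl_simps clmul_assoc)
  moreover have "p \<cdot> clrev s = clone + r \<cdot> clrev q" using G(7) by (simp add: algebra_simps)
  moreover have "isvec (a \<cdot> (r \<cdot> clrev q) \<cdot> clrev b + b \<cdot> (q \<cdot> clrev r) \<cdot> clrev a)"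
  proof (cases "b = 0")
    case False
    then obtain w where w: "isvec w" "a = b \<cdot> w"
      using vec_quotient_left[OF ab(3)] ab(2) by blast
    have "isvec (w \<cdot> (r \<cdot> clrev q) + (q \<cdot> clrev r) \<cdot> w)"
    proof (cases "p = 0")
      \<comment> \<open>The quotient of q by p does not exist here, but the determinant forces
        \<open>r \<cdot> clrev q\<close> = -1 and the sum is -2 w.\<close>
      case True
      then have "r \<cdot> clrev q = - clone" using G(7) by (simp add: minus_equation_iff)
      moreover have "q \<cdot> clrev r = - clone"
        using arg_cong[OF \<open>r \<cdot> clrev q = - clone\<close>, of clrev] by (simp add: clrev_mult)
      ultimately have "w \<cdot> (r \<cdot> clrev q) + (q \<cdot> clrev r) \<cdot> w = (- w) + (- w)"
        by (simp add: cl_simps)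
      then show ?thesis using w by (metis isvec_closed(2) isvec_minus_iff)
    next
      case p: False
      obtain z where z: "isvec z" "q = z \<cdot> p"
        using vec_quotient_right[OF isvec_clrev_swap'[OF G(9)]] p G(1) by blast
      let ?v = "p \<cdot> clrev r"
      have v: "isvec ?v" by (rule G)
      have v': "r \<cdot> clrev p = ?v" using clrev_vec[OF v] by (simp add: clrev_mult)
      have "r \<cdot> clrev q = (r \<cdot> clrev p) \<cdot> z" "q \<cdot> clrev r = z \<cdot> ?v"
        by (simp_all add: z clrev_mult clrev_vec clmul_assoc)
      then have "w \<cdot> (r \<cdot> clrev q) + (q \<cdot> clrev r) \<cdot> w = w \<cdot> ?v \<cdot> z + z \<cdot> ?v \<cdot> w"
        by (simp only: v' clmul_assoc)
      then show ?thesis using isvec_triple_polar[OF v w(1) z(1)] by simp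
    qed
    from isvec_sandwich[OF ab(2) this] show ?thesis
      by (simp add: w clrev_mult clrev_vec cl_simps clmul_assoc)
  qed simp
  ultimately show ?thesis
    using isvec_sandwich[OF ab(1) G(5)] isvec_sandwich[OF ab(2) G(6)] ab(3)
    by (simp add: cl_simps add.assoc)
qed

lemma mmul_simp [simp]:
  "mmul (a, b, c, d) (p, q, r, s) = (a \<cdot> p + b \<cdot> r, a \<cdot> q + b \<cdot> s, c \<cdot> p + d \<cdot> r, c \<cdot> q + d \<cdot> s)"
  by (simp add: mmul_def)

lemma mmul_assoc: "mmul (mmul x y) z = mmul x (mmul y z)"
  by (cases x; cases y; cases z) (simp add: cl_simps clmul_assoc)

lemma mmul_midm [simp]: "mmul midm x = x" "mmul x midm = x"
  by (cases x; simp add: midm_def)+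

lemma Gt_mmul:
  assumes "g \<in> Gt" "h \<in> Gt" shows "mmul g h \<in> Gt"
proof -
  obtain a b c d where g: "g = (a, b, c, d)" by (cases g)
  obtain p r q s where h: "h = (p, r, q, s)" by (cases h)
  note G = GtD[OF assms(1)[unfolded g]] and H = GtD[OF assms(2)[unfolded h]]
  have 1: "p \<cdot> clrev r = r \<cdot> clrev p" "q \<cdot> clrev s = s \<cdot> clrev q"
    using clrev_vec[OF H(5)] clrev_vec[OF H(6)] by (simp_all add: clrev_mult)
  have 2: "p \<cdot> clrev s = clone + r \<cdot> clrev q" using H(7) by (simp add: algebra_simps)
  have 3: "s \<cdot> clrev p = clone + q \<cdot> clrev r"
    using arg_cong[OF 2, of clrev] by (simp add: clrev_mult)
  have "(a \<cdot> p + b \<cdot> q) \<cdot> clrev (c \<cdot> r + d \<cdot> s) - (a \<cdot> r + b \<cdot> s) \<cdot> clrev (c \<cdot> p + d \<cdot> q)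
    = a \<cdot> (p \<cdot> clrev r) \<cdot> clrev c + a \<cdot> (p \<cdot> clrev s) \<cdot> clrev d + b \<cdot> (q \<cdot> clrev r) \<cdot> clrev c + b \<cdot> (q \<cdot> clrev s) \<cdot> clrev d
      - (a \<cdot> (r \<cdot> clrev p) \<cdot> clrev c + a \<cdot> (r \<cdot> clrev q) \<cdot> clrev d + b \<cdot> (s \<cdot> clrev p) \<cdot> clrev c + b \<cdot> (s \<cdot> clrev q) \<cdot> clrev d)"
    by (simp add: clrev_mult cl_simps clmul_assoc)
  also have "\<dots> = a \<cdot> clrev d - b \<cdot> clrev c"
    unfolding 1 2 3 by (simp add: cl_simps)
  finally have det: "(a \<cdot> p + b \<cdot> q) \<cdot> clrev (c \<cdot> r + d \<cdot> s) - (a \<cdot> r + b \<cdot> s) \<cdot> clrev (c \<cdot> p + d \<cdot> q) = clone"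
    using G(7) by simp
  show ?thesis unfolding g h mmul_simp
    by (intro GtI det clgamma0_row_column isvec_row G H isvec_clrev_swap'[OF H(8)] isvec_clrev_swap'[OF H(9)] assms(2)[unfolded h])
qed

section \<open>Inverse, maximal compact subgroup and Iwasawa decomposition\<close>

text \<open>The adjugate with reversed entries. The row and column relations of \<open>GtD\<close>
  make it a two-sided inverse.\<close>

definition cinv :: "'n::{finite,linorder} mat2 \<Rightarrow> 'n mat2" where
  "cinv g = (case g of (a, b, c, d) \<Rightarrow> (clrev d, - clrev b, - clrev c, clrev a))"

lemma cinv_Gt:
  assumes "g \<in> Gt"
  shows "cinv g \<in> Gt" "mmul g (cinv g) = midm" "mmul (cinv g) g = midm"
proof -
  obtain a b c d where g: "g = (a, b, c, d)" by (cases g)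
  note G = GtD[OF assms[unfolded g]]
  have sym: "b \<cdot> clrev a = a \<cdot> clrev b" "d \<cdot> clrev c = c \<cdot> clrev d"
    "clrev b \<cdot> d = clrev d \<cdot> b" "clrev a \<cdot> c = clrev c \<cdot> a"
    using clrev_vec[OF G(5)] clrev_vec[OF G(6)] clrev_vec[OF G(8)] clrev_vec[OF G(9)]
    by (simp_all add: clrev_mult)
  have det: "d \<cdot> clrev a - c \<cdot> clrev b = clone" "clrev a \<cdot> d - clrev c \<cdot> b = clone"
    using arg_cong[OF G(7), of clrev] arg_cong[OF G(10), of clrev] by (simp_all add: clrev_mult)
  show "cinv g \<in> Gt" unfolding g cinv_def prod.case
    by (intro GtI clgamma0_closed G) (use G sym in \<open>simp_all add: cl_simps\<close>)
  show "mmul g (cinv g) = midm" "mmul (cinv g) g = midm"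
    using G(7,10) sym det by (simp_all add: g cinv_def midm_def cl_simps algebra_simps)
qed

lemma ginv_eq_cinv:
  assumes "g \<in> Gt" shows "ginv g = cinv g"
  unfolding ginv_def
proof (rule the_equality)
  fix h assume "h \<in> Gt \<and> mmul g h = midm"
  then have "mmul (cinv g) (mmul g h) = cinv g" by simp
  then show "h = cinv g" using cinv_Gt[OF assms] by (simp flip: mmul_assoc)
qed (use cinv_Gt[OF assms] in simp)

definition mcol :: "'n::{finite,linorder} mat2 \<Rightarrow> 'n cl \<times> 'n cl" where
  "mcol g = (fst g, fst (snd (snd g)))"

definition mact :: "'n::{finite,linorder} mat2 \<Rightarrow> 'n cl \<times> 'n cl \<Rightarrow> 'n cl \<times> 'n cl" where
  "mact g z = (fst g \<cdot> fst z + fst (snd g) \<cdot> snd z, fst (snd (snd g)) \<cdot> fst z + snd (snd (snd g)) \<cdot> snd z)"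

text \<open>On \<open>Kt\<close> the second column is a function of the first, so a compact element
  can be recovered from its first column.\<close>

definition kmat :: "'n::{finite,linorder} cl \<times> 'n cl \<Rightarrow> 'n mat2" where
  "kmat z = (fst z, - clprin (snd z), snd z, clprin (fst z))"

lemma mcol_simp [simp]: "mcol (a, b, c, d) = (a, c)"
  by (simp add: mcol_def)

lemma mact_simp [simp]: "mact (a, b, c, d) (x, y) = (a \<cdot> x + b \<cdot> y, c \<cdot> x + d \<cdot> y)"
  by (simp add: mact_def)

lemma mcol_mmul: "mcol (mmul g h) = mact g (mcol h)"
  by (cases g; cases h) simp

lemma mcol_kmat [simp]: "mcol (kmat z) = z"
  by (simp add: mcol_def kmat_def)

lemma mact_mmul: "mact (mmul g h) z = mact g (mact h z)"
  by (cases g; cases h; cases z) (simp add: cl_simps clmul_assoc)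

section \<open>The maximal compact subgroup\<close>

lemma KtD:
  assumes "(a, b, c, d) \<in> Kt"
  shows "a \<in> clgamma0" "b \<in> clgamma0" "c = - clprin b" "d = clprin a" "(norm a)\<^sup>2 + (norm b)\<^sup>2 = 1"
    "isvec (a \<cdot> clrev b)"
  using assms GtD[of a b c d] by (auto simp: Kt_def)

lemma KtI:
  assumes "a \<in> clgamma0" "b \<in> clgamma0" "(norm a)\<^sup>2 + (norm b)\<^sup>2 = 1" "isvec (a \<cdot> clrev b)"
  shows "(a, b, - clprin b, clprin a) \<in> Kt"
proof -
  have "isvec (clprin b \<cdot> clbar a)"
    using isvec_clrev_swap[OF assms(4)] by (metis clbar_def clprin_mult isvec_closed(5))
  then have "(a, b, - clprin b, clprin a) \<in> Gt"
    using assms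
    by (intro GtI clgamma0_closed)
       (simp_all add: cl_simps clbar_clrev clrev_clprin clbar_def[symmetric] clgamma_clbar scaleR_left_distrib[symmetric])
  then show ?thesis using assms by (simp add: Kt_def)
qed

lemma Kt_Gt: "k \<in> Kt \<Longrightarrow> k \<in> Gt"
  by (simp add: Kt_def)

lemma kmat_mcol: assumes "k \<in> Kt" shows "kmat (mcol k) = k"
proof -
  obtain a b c d where k: "k = (a, b, c, d)" by (cases k)
  show ?thesis using KtD(3,4)[OF assms[unfolded k]] by (simp add: k kmat_def)
qed

lemma norm_mcol_Kt: assumes "k \<in> Kt" shows "norm (mcol k) = 1"
proof -
  obtain a b c d where k: "k = (a, b, c, d)" by (cases k)
  show ?thesis using KtD(3,5)[OF assms[unfolded k]] by (simp add: k norm_Pair)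
qed

text \<open>The shape of the second row survives because the principal automorphism is
  multiplicative; for this shape the pseudo-determinant condition is the norm condition.\<close>

lemma Kt_mmul:
  fixes k l :: "'n::{finite,linorder} mat2"
  assumes "k \<in> Kt" "l \<in> Kt" shows "mmul k l \<in> Kt"
proof -
  obtain a b c d where k: "k = (a, b, c, d)" by (cases k)
  obtain p q r s where l: "l = (p, q, r, s)" by (cases l)
  note K = KtD[OF assms(1)[unfolded k]] and L = KtD[OF assms(2)[unfolded l]]
  let ?A = "a \<cdot> p + b \<cdot> r" and ?B = "a \<cdot> q + b \<cdot> s"
  have e: "mmul k l = (?A, ?B, - clprin ?B, clprin ?A)"
    by (simp add: k l K L cl_simps clprin_mult)
  have "mmul k l \<in> Gt" using assms by (intro Gt_mmul Kt_Gt)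
  then have G: "(?A, ?B, - clprin ?B, clprin ?A) \<in> Gt" by (simp only: e)
  have "?A \<cdot> clbar ?A + ?B \<cdot> clbar ?B = clone"
    using GtD(7)[OF G] by (simp only: clrev_linear clbar_def clrev_clprin cl_simps diff_minus_eq_add)
  then have "((norm ?A)\<^sup>2 + (norm ?B)\<^sup>2) *\<^sub>R clone = 1 *\<^sub>R (clone :: 'n cl)"
    unfolding clgamma_clbar(1)[OF GtD(1)[OF G]] clgamma_clbar(1)[OF GtD(2)[OF G]]
    by (simp add: scaleR_left_distrib)
  then have "(norm ?A)\<^sup>2 + (norm ?B)\<^sup>2 = 1"
    unfolding scaleR_cancel_right by simp
  then show ?thesis
    unfolding e by (intro KtI GtD[OF G])
qed

text \<open>The mixed terms of the two rows cancel since \<open>clbar a \<cdot> b\<close> is a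
  vector, hence fixed by the reversion. The isometry concerns all pairs of algebra elements, which
  later allows tangent directions as arguments.\<close>

lemma inner_mact_Kt:
  assumes "k \<in> Kt" shows "inner (mact k z) (mact k z') = inner z z'"
proof -
  obtain a b c d where k: "k = (a, b, c, d)" by (cases k)
  note K = KtD[OF assms[unfolded k]] and G = GtD[OF Kt_Gt[OF assms, unfolded k]]
  have v: "isvec (clbar a \<cdot> b)"
  proof (cases "a = 0")
    case False
    then obtain v where "isvec v" "b = a \<cdot> v"
      using vec_quotient_left[OF isvec_clrev_swap[OF K(6)]] K(1) by blast
    then show ?thesis by (simp add: clmul_assoc[symmetric] clgamma_clbar[OF K(1)] cl_simps)
  qed simp
  have e: "clrev b \<cdot> clprin a = clbar a \<cdot> b"
    using clrev_vec[OF v] by (simp add: clrev_mult clbar_clrev)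
  have 1: "inner (a \<cdot> x) (b \<cdot> y) = inner (clprin b \<cdot> x) (clprin a \<cdot> y)" for x y
    unfolding inner_clmul_left clbar_clrev clmul_assoc[symmetric] e ..
  have 2: "inner (b \<cdot> y) (a \<cdot> x) = inner (clprin a \<cdot> y) (clprin b \<cdot> x)" for x y
    using 1[of x y] by (simp only: inner_commute)
  obtain x y where z: "z = (x, y)" by (cases z)
  obtain x' y' where z': "z' = (x', y')" by (cases z')
  have "inner (mact k z) (mact k z') = ((norm a)\<^sup>2 + (norm b)\<^sup>2) * inner x x' + ((norm a)\<^sup>2 + (norm b)\<^sup>2) * inner y y'"
    unfolding k z z' mact_simp inner_Pair K(3,4)
    by (simp add: cl_simps inner_add_left inner_add_right 1 2 inner_clgamma_left[OF K(1)] inner_clgamma_left[OF K(2)]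
        inner_clgamma_left[OF clgamma0_closed(1)[OF K(1)]] inner_clgamma_left[OF clgamma0_closed(1)[OF K(2)]] algebra_simps)
  then show ?thesis by (simp add: K(5) z z')
qed

lemma Mt_iff: "g \<in> Mt \<longleftrightarrow> (\<exists>m. m \<in> clgamma \<and> norm m = 1 \<and> g = (m, 0, 0, clprin m))"
proof
  assume "g \<in> Mt"
  then obtain m d where m: "g = (m, 0, 0, d)" "m \<in> clgamma" "norm m = 1" "d \<cdot> clrev m = clone"
    by (auto simp: Mt_def)
  have "d = d \<cdot> (clrev m \<cdot> clprin m)" using m by (simp add: clgamma_clrev_clprin)
  also have "\<dots> = clprin m" by (simp add: m flip: clmul_assoc)
  finally show "\<exists>m. m \<in> clgamma \<and> norm m = 1 \<and> g = (m, 0, 0, clprin m)" using m by auto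
qed (auto simp: Mt_def clgamma_clrev_clprin)

lemma Mt_Kt: "m \<in> Mt \<Longrightarrow> m \<in> Kt"
  unfolding Mt_iff using KtI[of _ 0] by fastforce

lemma ucurve_Kt:
  assumes "isvec v" "norm v = 1" shows "ucurve v t \<in> Kt"
proof -
  have "ucurve v t = (cos t *\<^sub>R clone, sin t *\<^sub>R v, - clprin (sin t *\<^sub>R v), clprin (cos t *\<^sub>R clone))"
    by (simp add: ucurve_def)
  also have "\<dots> \<in> Kt"
    using assms by (intro KtI clgamma0_closed vec_clgamma0) (simp_all add: power_mult_distrib clrev_vec cl_simps)
  finally show ?thesis .
qed

section \<open>The Iwasawa decomposition\<close>

lemma iwasawa_simp: "mmul (aA t) (nN v) = (t *\<^sub>R clone, t *\<^sub>R v, 0, (1 / t) *\<^sub>R clone)"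
  by (simp add: aA_def nN_def cl_simps)

lemma norm_mcol_Gt: assumes "h \<in> Gt" shows "norm (mcol h) > 0"
proof -
  obtain a b c d where h: "h = (a, b, c, d)" by (cases h)
  have "(a, c) \<noteq> 0" using GtD(7)[of a b c d] assms by (auto simp: h zero_prod_def)
  then show ?thesis by (simp add: h)
qed

text \<open>Normalising the first column of h gives k. Then k^-1 h has first column (t, 0), and the
  determinant and row conditions force its second column to be that of a_t times an element of
  N.\<close>

lemma iwasawa:
  assumes "h \<in> Gt"
  defines "t \<equiv> norm (mcol h)"
  shows "kmat ((1 / t) *\<^sub>R mcol h) \<in> Kt"
    "\<exists>w. isvec w \<and> h = mmul (kmat ((1 / t) *\<^sub>R mcol h)) (mmul (aA t) (nN w))"
proof -
  obtain a b c d where h: "h = (a, b, c, d)" by (cases h)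
  note G = GtD[OF assms(1)[unfolded h]]
  have t: "t > 0" unfolding t_def by (rule norm_mcol_Gt[OF assms(1)])
  have t2: "(norm a)\<^sup>2 + (norm c)\<^sup>2 = t\<^sup>2" by (simp add: t_def h norm_Pair)
  let ?p = "(1 / t) *\<^sub>R a" and ?q = "- ((1 / t) *\<^sub>R clprin c)"
  have k: "kmat ((1 / t) *\<^sub>R mcol h) = (?p, ?q, - clprin ?q, clprin ?p)"
    by (simp add: kmat_def h)
  have v: "isvec (a \<cdot> clbar c)"
  proof (cases "c = 0")
    case False
    then obtain v where "isvec v" "a = v \<cdot> c"
      using vec_quotient_right[OF G(9)] G(3) by blast
    then show ?thesis by (simp add: clmul_assoc clgamma_clbar[OF G(3)] cl_simps)
  qed simp
  have "(norm ?p)\<^sup>2 + (norm ?q)\<^sup>2 = ((norm a)\<^sup>2 + (norm c)\<^sup>2) / t\<^sup>2"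
    using t by (simp add: power_divide add_divide_distrib)
  then have n: "(norm ?p)\<^sup>2 + (norm ?q)\<^sup>2 = 1" using t by (simp add: t2)
  show K: "kmat ((1 / t) *\<^sub>R mcol h) \<in> Kt" unfolding k
    using v n by (intro KtI clgamma0_closed G) (simp_all add: cl_simps clrev_clprin clbar_def[symmetric])
  let ?k = "kmat ((1 / t) *\<^sub>R mcol h)"
  let ?X = "mmul (cinv ?k) h"
  note Ki = cinv_Gt[OF Kt_Gt[OF K]]
  have X: "?X \<in> Gt" using Ki(1) assms(1) by (rule Gt_mmul)
  have hX: "h = mmul ?k ?X" using Ki by (simp flip: mmul_assoc)
  obtain x y z w where x: "?X = (x, y, z, w)" by (cases ?X)
  have sym: "clrev a \<cdot> c = clrev c \<cdot> a"
    using clrev_vec[OF G(9)] by (simp add: clrev_mult)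
  have "mcol ?X = (t *\<^sub>R clone, 0)"
  proof -
    have "mcol ?X = ((1 / t) *\<^sub>R (clbar a \<cdot> a + clbar c \<cdot> c), (1 / t) *\<^sub>R (clrev a \<cdot> c - clrev c \<cdot> a))"
      unfolding k cinv_def prod.case unfolding h
      by (simp add: cl_simps clrev_clprin clbar_def[symmetric] scaleR_right_distrib scaleR_right_diff_distrib)
    also have "\<dots> = (t *\<^sub>R clone, 0)" using t
      by (simp add: sym clgamma_clbar[OF G(1)] clgamma_clbar[OF G(3)] scaleR_left_distrib[symmetric] t2) (simp add: power2_eq_square)
    finally show ?thesis .
  qed
  then have xz: "x = t *\<^sub>R clone" "z = 0" by (simp_all add: x)
  note XG = GtD[OF X[unfolded x]]
  have "t *\<^sub>R clrev w = clone" using XG(7) by (simp add: xz cl_simps)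
  then have "clrev (t *\<^sub>R clrev w) = clrev clone" by simp
  then have "t *\<^sub>R w = clone" by (simp only: clrev_linear)
  then have "(1 / t) *\<^sub>R (t *\<^sub>R w) = (1 / t) *\<^sub>R clone" by simp
  then have w: "w = (1 / t) *\<^sub>R clone" using t by simp
  have "isvec (t *\<^sub>R clrev y)" using XG(5) by (simp add: xz cl_simps)
  then have "isvec (clrev y)" using t by (simp add: isvec_scaleR_iff)
  then have y: "isvec y" using isvec_clrev[of "clrev y"] by simp
  have "?X = mmul (aA t) (nN ((1 / t) *\<^sub>R y))"
    using t by (simp add: x xz w iwasawa_simp)
  then show "\<exists>w. isvec w \<and> h = mmul ?k (mmul (aA t) (nN w))"
    using hX y by (intro exI[of _ "(1 / t) *\<^sub>R y"]) simp
qed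

text \<open>The choice in \<open>ind_ext\<close> is unambiguous: the first column of k a_t nu is t
  times that of k, so t is its norm and \<open>kmat\<close> recovers k.\<close>

lemma ind_ext_eq:
  assumes "h \<in> Gt"
  defines "t \<equiv> norm (mcol h)"
  shows "ind_ext lam phi (h :: 'n::{finite,linorder} mat2)
     = (complex_of_real t powr (- 2 * lam - of_nat (CARD('n) + 1))) *s phi (kmat ((1 / t) *\<^sub>R mcol h))"
  unfolding ind_ext_def
proof (rule some_equality)
  show "\<exists>k t' v. k \<in> Kt \<and> t' > 0 \<and> isvec v \<and> h = mmul k (mmul (aA t') (nN v)) \<and>
      (complex_of_real t powr (- 2 * lam - of_nat (CARD('n) + 1))) *s phi (kmat ((1 / t) *\<^sub>R mcol h))
      = (complex_of_real t' powr (- 2 * lam - of_nat (CARD('n) + 1))) *s phi k"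
    using iwasawa[OF assms(1)] norm_mcol_Gt[OF assms(1)] unfolding t_def by blast
next
  fix z assume "\<exists>k t' v. k \<in> Kt \<and> t' > 0 \<and> isvec v \<and> h = mmul k (mmul (aA t') (nN v)) \<and>
      z = (complex_of_real t' powr (- 2 * lam - of_nat (CARD('n) + 1))) *s phi k"
  then obtain k t' v where k: "k \<in> Kt" "t' > 0" "isvec v" "h = mmul k (mmul (aA t') (nN v))"
    and z: "z = (complex_of_real t' powr (- 2 * lam - of_nat (CARD('n) + 1))) *s phi k" by blast
  have c: "mcol h = t' *\<^sub>R mcol k"
    unfolding k(4) by (cases k) (simp add: iwasawa_simp cl_simps)
  then have "t = t'" using norm_mcol_Kt[OF k(1)] k(2) by (simp add: t_def)
  moreover have "kmat ((1 / t') *\<^sub>R mcol h) = k"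
    using k(2) by (simp add: c kmat_mcol[OF k(1)])
  ultimately show "z = (complex_of_real t powr (- 2 * lam - of_nat (CARD('n) + 1))) *s phi (kmat ((1 / t) *\<^sub>R mcol h))"
    using z by simp
qed

section \<open>The spinor module\<close>

lemma matrix_scaleR_left: "(r *\<^sub>R A) ** B = r *\<^sub>R (A ** B)" for A B :: "complex^'d^'d"
  by (simp add: vec_eq_iff matrix_matrix_mult_def scaleR_sum_right)

lemma matrix_scaleR_right: "A ** (r *\<^sub>R B) = r *\<^sub>R (A ** B)" for A B :: "complex^'d^'d"
  by (simp add: vec_eq_iff matrix_matrix_mult_def scaleR_sum_right)

lemma matrix_add_left: "(A + B) ** C = A ** C + B ** C" for A B C :: "complex^'d^'d"
  by (simp add: vec_eq_iff matrix_matrix_mult_def sum.distrib algebra_simps)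

lemma matrix_add_right: "A ** (B + C) = A ** B + A ** C" for A B C :: "complex^'d^'d"
  by (simp add: vec_eq_iff matrix_matrix_mult_def sum.distrib algebra_simps)

lemma matrix_minus_left: "(- A) ** B = - (A ** B)" for A B :: "complex^'d^'d"
  using matrix_scaleR_left[of "-1" A B] by simp

lemma matrix_minus_right: "A ** (- B) = - (A ** B)" for A B :: "complex^'d^'d"
  using matrix_scaleR_right[of A "-1" B] by simp

lemma matrix_zero: "0 ** A = 0" "A ** 0 = 0" for A :: "complex^'d^'d"
  by (simp_all add: vec_eq_iff matrix_matrix_mult_def)

lemma matrix_diff_left: "(A - B) ** C = A ** C - B ** C" for A B C :: "complex^'d^'d"
  by (simp add: vec_eq_iff matrix_matrix_mult_def sum_subtractf algebra_simps)

lemma matrix_diff_right: "A ** (B - C) = A ** B - A ** C" for A B C :: "complex^'d^'d"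
  by (simp add: vec_eq_iff matrix_matrix_mult_def sum_subtractf algebra_simps)

lemmas mat_simps = matrix_scaleR_left matrix_scaleR_right matrix_diff_left matrix_diff_right matrix_add_left matrix_add_right
  matrix_minus_left matrix_minus_right matrix_zero

lemma matrix_sum_left: "(\<Sum>a\<in>S. f a) ** B = (\<Sum>a\<in>S. f a ** B)" for B :: "complex^'d^'d" and f :: "'i \<Rightarrow> complex^'d^'d"
  by (induction S rule: infinite_finite_induct) (simp_all add: mat_simps)

lemma matrix_sum_right: "B ** (\<Sum>a\<in>S. f a) = (\<Sum>a\<in>S. B ** f a)" for B :: "complex^'d^'d" and f :: "'i \<Rightarrow> complex^'d^'d"
  by (induction S rule: infinite_finite_induct) (simp_all add: mat_simps)

lemma matrix_inv_eqI:
  fixes A B :: "complex^'d^'d"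
  assumes "A ** B = mat 1" "B ** A = mat 1" shows "matrix_inv A = B"
proof -
  have "A ** matrix_inv A = mat 1 \<and> matrix_inv A ** A = mat 1"
    unfolding matrix_inv_def using assms by (intro someI[of "\<lambda>X. A ** X = mat 1 \<and> X ** A = mat 1" B]) simp
  then show ?thesis
    by (metis assms(2) matrix_mul_assoc matrix_mul_lid matrix_mul_rid)
qed

lemma cl_sgn_one:
  assumes "\<And>b. b \<in> B \<Longrightarrow> j < b" shows "cl_sgn {j} B = 1"
proof -
  have "order_sgn j b = 1" if "b \<in> B" for b
    using assms[OF that] by (simp add: order_sgn_def not_le)
  then show ?thesis by (simp add: cl_sgn_eq_prod)
qed

section \<open>Clifford multiplication and the representation tau\<close>

locale spinor =
  fixes E1 :: "complex^'d^'d" and E :: "'n::{finite,linorder} \<Rightarrow> complex^'d^'d"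
  assumes module: "spinor_module E1 E"
begin

lemma E1_sq: "E1 ** E1 = - mat 1"
  and E1_E: "E1 ** E j = - (E j ** E1)"
  and E_E: "E i ** E j + E j ** E i = (if i = j then - 2 *\<^sub>R mat 1 else 0)"
  using module by (simp_all add: spinor_module_def eq_neg_iff_add_eq_0)

fun EE :: "'n option \<Rightarrow> complex^'d^'d" where
  "EE None = E1"
| "EE (Some j) = E j"

lemma EE_anticommute: "EE a ** EE b + EE b ** EE a = (- 2 * inner (frame a) (frame b :: 'n cl)) *\<^sub>R mat 1"
proof (cases a; cases b)
  fix i j assume "a = Some i" "b = Some j"
  then show ?thesis using E_E[of i j] inner_frame[of a b] by simp
next
  assume "a = None" "b = None"
  then show ?thesis using inner_frame[of a b] by (simp add: E1_sq scaleR_2)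
next
  fix j assume "a = Some j" "b = None"
  then show ?thesis using inner_frame[of a b] by (simp add: E1_E)
next
  fix j assume "a = None" "b = Some j"
  then show ?thesis using inner_frame[of a b] by (simp add: E1_E)
qed

text \<open>Clifford multiplication by the orthogonal projection of v to E^n, which gives a linear
  map on the whole algebra.\<close>

definition cliff :: "'n cl \<Rightarrow> complex^'d^'d" where
  "cliff v = (\<Sum>a\<in>UNIV. inner v (frame a) *\<^sub>R EE a)"

lemma linear_cliff: "linear cliff"
  by (rule linearI) (simp_all add: cliff_def inner_add_left scaleR_left_distrib sum.distrib scaleR_sum_right)

lemma cliff_frame [simp]: "cliff (frame a) = EE a"
proof -
  have "cliff (frame a) = (\<Sum>b\<in>UNIV. if b = a then EE a else 0)"
    unfolding cliff_def by (rule sum.cong[OF refl]) (auto simp: inner_frame)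
  then show ?thesis by simp
qed

lemma cliff_clone [simp]: "cliff clone = E1" and cliff_clvec [simp]: "cliff (clvec j) = E j"
  using cliff_frame[of None] cliff_frame[of "Some j"] by simp_all

lemma cliff_anticommute:
  "cliff v ** cliff w + cliff w ** cliff v = (- 2 * (\<Sum>a\<in>UNIV. inner v (frame a) * inner w (frame a))) *\<^sub>R mat 1"
proof -
  have e: "cliff x ** cliff y = (\<Sum>a\<in>UNIV. \<Sum>b\<in>UNIV. (inner x (frame a) * inner y (frame b)) *\<^sub>R (EE a ** EE b))" for x y
    unfolding cliff_def matrix_sum_left
    by (rule sum.cong[OF refl]) (simp add: matrix_sum_right mat_simps scaleR_sum_right mult.commute)
  have "cliff w ** cliff v = (\<Sum>a\<in>UNIV. \<Sum>b\<in>UNIV. (inner v (frame a) * inner w (frame b)) *\<^sub>R (EE b ** EE a))"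
    unfolding e by (subst sum.swap) (simp add: mult.commute)
  then have "cliff v ** cliff w + cliff w ** cliff v
    = (\<Sum>a\<in>UNIV. \<Sum>b\<in>UNIV. (inner v (frame a) * inner w (frame b)) *\<^sub>R (EE a ** EE b + EE b ** EE a))"
    by (simp add: e[of v w] scaleR_right_distrib sum.distrib)
  also have "\<dots> = (\<Sum>a\<in>UNIV. \<Sum>b\<in>UNIV. if b = a then (- 2 * (inner v (frame a) * inner w (frame a))) *\<^sub>R mat 1 else 0)"
    by (intro sum.cong refl) (simp add: EE_anticommute inner_frame)
  also have "\<dots> = (- 2 * (\<Sum>a\<in>UNIV. inner v (frame a) * inner w (frame a))) *\<^sub>R mat 1"
    by (simp add: scaleR_sum_left sum_distrib_left)
  finally show ?thesis .
qed

lemma inner_vec_expand: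
  assumes "isvec v" shows "inner v w = (\<Sum>a\<in>UNIV. inner v (frame a) * inner w (frame a))"
proof -
  have "inner v w = inner (\<Sum>a\<in>UNIV. inner v (frame a) *\<^sub>R frame a) w"
    using isvec_expand[OF assms] by simp
  then show ?thesis by (simp add: inner_sum_left inner_commute[of "frame _" w])
qed

lemma cliff_vec:
  assumes "isvec v"
  shows "cliff v ** cliff w + cliff w ** cliff v = (- 2 * inner v w) *\<^sub>R mat 1"
  unfolding cliff_anticommute inner_vec_expand[OF assms, of w] ..

lemma cliff_sq: "isvec v \<Longrightarrow> cliff v ** cliff v = - ((norm v)\<^sup>2 *\<^sub>R mat 1)"
proof -
  assume v: "isvec v"
  have "2 *\<^sub>R (cliff v ** cliff v) = 2 *\<^sub>R (- ((norm v)\<^sup>2 *\<^sub>R mat 1))"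
    using cliff_vec[OF v, of v] by (simp add: power2_norm_eq_inner scaleR_2)
  then show ?thesis by (rule scaleR_cancelD) simp
qed

abbreviation "tb \<equiv> tau_blade E1 E"

lemma tau_blade_insert_min:
  assumes "\<And>b. b \<in> B \<Longrightarrow> j < b"
  shows "tb (insert j B) = (E1 ** E j) ** tb B"
proof -
  have j: "j \<notin> B" using assms by blast
  have "Min (insert j B) = j" using assms by (intro Min_eqI) (auto intro: less_imp_le)
  then have "sorted_list_of_set (insert j B) = j # sorted_list_of_set B"
    using sorted_list_of_set_nonempty[of "insert j B"] j by simp
  then show ?thesis by (simp add: tau_blade_def)
qed

lemma tau_blade_empty [simp]: "tb {} = mat 1"
  by (simp add: tau_blade_def)

text \<open>The matrices E_1 E_j satisfy the relations of the generators e_j; together with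
  \<open>F_anticommute\<close> this is the source of the multiplicativity of
  \<open>tau\<close>.\<close>

lemma F_sq: "(E1 ** E i) ** (E1 ** E i) = - mat 1"
proof -
  have "E i ** E i = - mat 1"
    using E_E[of i i] by (simp flip: scaleR_2 add: scaleR_minus_right[symmetric] del: scaleR_minus_right)
  have "(E1 ** E i) ** (E1 ** E i) = E1 ** (E i ** E1) ** E i" by (simp add: matrix_mul_assoc)
  also have "E i ** E1 = - (E1 ** E i)" by (simp add: E1_E)
  also have "E1 ** (- (E1 ** E i)) ** E i = - ((E1 ** E1) ** (E i ** E i))"
    by (simp add: mat_simps matrix_mul_assoc)
  finally show ?thesis using \<open>E i ** E i = - mat 1\<close> by (simp add: E1_sq mat_simps)
qed

lemma F_anticommute: assumes "i \<noteq> j" shows "(E1 ** E i) ** (E1 ** E j) = - ((E1 ** E j) ** (E1 ** E i))"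
proof -
  have e: "E i ** E j = - (E j ** E i)" using E_E[of i j] assms by (simp add: eq_neg_iff_add_eq_0)
  have r: "(E1 ** E i) ** (E1 ** E j) = E i ** E j" for i j
  proof -
    have "(E1 ** E i) ** (E1 ** E j) = - ((E i ** E1) ** (E1 ** E j))"
      by (simp add: E1_E mat_simps)
    also have "\<dots> = - (E i ** (E1 ** E1) ** E j)" by (simp add: matrix_mul_assoc)
    finally show ?thesis by (simp add: E1_sq mat_simps)
  qed
  show ?thesis unfolding r e by simp
qed

text \<open>Comparison of j with the least element of B: j is prepended, or contracted, or moved
  past that element at the cost of a sign, where the induction hypothesis applies to the
  rest.\<close>

lemma tau_blade_generator: "(E1 ** E j) ** tb B = cl_sgn {j} B *\<^sub>R tb (sdiff {j} B)"
proof (induction "card B" arbitrary: B rule: less_induct)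
  case less
  show ?case
  proof (cases "B = {}")
    case True
    then show ?thesis using tau_blade_insert_min[of "{}" j] by simp
  next
    case False
    define m where "m = Min B"
    define B' where "B' = B - {m}"
    have m: "m \<in> B" unfolding m_def using False by simp
    have B: "B = insert m B'" "m \<notin> B'" using m by (auto simp: B'_def)
    have lt: "m < b" if "b \<in> B'" for b
      using that Min_le[of B b] by (auto simp: B'_def m_def order.strict_iff_order)
    have tB: "tb B = (E1 ** E m) ** tb B'" unfolding B(1) by (rule tau_blade_insert_min[OF lt])
    have sgn: "cl_sgn {j} B = order_sgn j m * cl_sgn {j} B'" using B by (simp add: cl_sgn_eq_prod)
    consider "j < m" | "j = m" | "m < j" by fastforce
    then show ?thesis
    proof cases
      case 1
      have lt': "j < b" if "b \<in> B" for b using that 1 lt B by (metis insertE less_trans)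
      have "sdiff {j} B = insert j B" using lt' by auto
      moreover have "cl_sgn {j} B = 1" by (rule cl_sgn_one[OF lt'])
      ultimately show ?thesis using tau_blade_insert_min[OF lt'] by simp
    next
      case 2
      have "cl_sgn {j} B' = 1" using lt 2 by (intro cl_sgn_one) simp
      moreover have "sdiff {j} B = B'" using 2 B by auto
      ultimately show ?thesis
        using sgn 2 F_sq[of m] by (simp add: tB matrix_mul_assoc mat_simps order_sgn_def)
    next
      case 3
      have "sdiff {j} B = insert m (sdiff {j} B')" using B 3 by auto
      moreover have "m < b" if "b \<in> sdiff {j} B'" for b using that lt 3 by auto
      ultimately have s: "tb (sdiff {j} B) = (E1 ** E m) ** tb (sdiff {j} B')"
        using tau_blade_insert_min[of "sdiff {j} B'" m] by simp
      have "card B' < card B" using B by simp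
      then have IH: "(E1 ** E j) ** tb B' = cl_sgn {j} B' *\<^sub>R tb (sdiff {j} B')" by (rule less)
      have "(E1 ** E j) ** tb B = - ((E1 ** E m) ** ((E1 ** E j) ** tb B'))"
        using 3 F_anticommute[of j m] by (simp add: tB matrix_mul_assoc mat_simps)
      then show ?thesis using sgn 3 by (simp add: IH s mat_simps order_sgn_def)
    qed
  qed
qed

lemma tau_blade_mult: "tb A ** tb B = cl_sgn A B *\<^sub>R tb (sdiff A B)"
proof (induction "card A" arbitrary: A rule: less_induct)
  case less
  show ?case
  proof (cases "A = {}")
    case False
    define m where "m = Min A"
    define A' where "A' = A - {m}"
    have m: "m \<in> A" unfolding m_def using False by simp
    have A: "A = insert m A'" "m \<notin> A'" using m by (auto simp: A'_def)
    have lt: "m < b" if "b \<in> A'" for b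
      using that Min_le[of A b] by (auto simp: A'_def m_def order.strict_iff_order)
    have s: "cl_sgn {m} A' = 1" by (rule cl_sgn_one[OF lt])
    have tA: "tb A = (E1 ** E m) ** tb A'" unfolding A(1) by (rule tau_blade_insert_min[OF lt])
    have Am: "A = sdiff {m} A'" using A by auto
    have "card A' < card A" using A by simp
    then have "tb A' ** tb B = cl_sgn A' B *\<^sub>R tb (sdiff A' B)" by (rule less)
    moreover have "tb A ** tb B = (E1 ** E m) ** (tb A' ** tb B)" by (simp only: tA matrix_mul_assoc)
    ultimately have "tb A ** tb B = (cl_sgn A' B * cl_sgn {m} (sdiff A' B)) *\<^sub>R tb (sdiff {m} (sdiff A' B))"
      by (simp add: mat_simps tau_blade_generator)
    also have "sdiff {m} (sdiff A' B) = sdiff A B" unfolding Am by auto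
    also have "cl_sgn A' B * cl_sgn {m} (sdiff A' B) = cl_sgn A B"
      unfolding Am cl_sgn_sdiff_left cl_sgn_sdiff_right[of "{m}" A' B] s by simp
    finally show ?thesis .
  qed simp
qed

abbreviation "\<tau> \<equiv> tau E1 E"

lemma linear_tau: "linear \<tau>"
  by (rule linearI) (simp_all add: tau_def scaleR_left_distrib sum.distrib scaleR_sum_right)

lemma tau_axis: "\<tau> (axis A 1) = tb A"
proof -
  have "\<tau> (axis A 1) = (\<Sum>B\<in>UNIV. if B = A then tb A else 0)"
    unfolding tau_def by (rule sum.cong[OF refl]) (auto simp: axis_def)
  then show ?thesis by simp
qed

lemma tau_clone [simp]: "\<tau> clone = mat 1"
  by (simp add: clone_axis tau_axis)

lemma cl_expand: "x = (\<Sum>A\<in>UNIV. x $ A *\<^sub>R axis A (1::real))"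
  using basis_expansion[of x] by (simp add: scalar_mult_eq_scaleR)

lemma tau_mult: "\<tau> (x \<cdot> y) = \<tau> x ** \<tau> y"
proof -
  have "\<tau> (x \<cdot> y) = \<tau> ((\<Sum>A\<in>UNIV. x $ A *\<^sub>R axis A 1) \<cdot> (\<Sum>B\<in>UNIV. y $ B *\<^sub>R axis B 1))"
    by (simp only: cl_expand[symmetric])
  also have "\<dots> = (\<Sum>A\<in>UNIV. \<Sum>B\<in>UNIV. (x $ A * y $ B) *\<^sub>R \<tau> (axis A 1 \<cdot> axis B 1))"
    by (simp add: bounded_bilinear.sum_left[OF bounded_bilinear_clmul] bounded_bilinear.sum_right[OF bounded_bilinear_clmul]
        cl_simps linear_sum[OF linear_tau] linear_scale[OF linear_tau] scaleR_sum_right)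
      (subst sum.swap, simp add: mult.commute)
  also have "\<dots> = (\<Sum>A\<in>UNIV. \<Sum>B\<in>UNIV. (x $ A * y $ B) *\<^sub>R (tb A ** tb B))"
    by (simp only: axis_mult linear_scale[OF linear_tau] tau_axis tau_blade_mult)
  also have "\<dots> = \<tau> x ** \<tau> y"
    by (simp add: tau_def matrix_sum_left matrix_sum_right mat_simps scaleR_sum_right)
      (subst sum.swap, simp add: mult.commute)
  finally show ?thesis .
qed

text \<open>The values tau(1) = 1 = -E_1 E_1 and tau(e_j) = E_1 E_j = -E_j E_1 are one formula that
  is linear in v.\<close>

lemma tau_vec: assumes "isvec v" shows "\<tau> v = - (cliff v ** E1)"
proof (rule isvec_linear_eqI[OF linear_tau _ _ assms])
  show "linear (\<lambda>v. - (cliff v ** E1))"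
    by (rule linearI) (simp_all add: linear_add[OF linear_cliff] linear_scale[OF linear_cliff] mat_simps)
  show "\<tau> (frame a) = - (cliff (frame a) ** E1)" for a
  proof (cases a)
    case (Some j)
    then show ?thesis using tau_blade_insert_min[of "{}" j]
      by (simp add: clvec_axis[of j] tau_axis) (simp add: E1_E clvec_axis[symmetric])
  qed (simp add: E1_sq)
qed

lemma tau_clprin_vec: assumes "isvec v" shows "\<tau> (clprin v) = - (E1 ** cliff v)"
proof -
  have "clprin v = (2 * inner v clone) *\<^sub>R clone - v"
    using vec_polar[OF assms isvec_clone] by (simp add: algebra_simps)
  then have "\<tau> (clprin v) = (2 * inner v clone) *\<^sub>R mat 1 + cliff v ** E1"
    by (simp add: linear_diff[OF linear_tau] linear_scale[OF linear_tau] tau_vec[OF assms])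
  also have "\<dots> = - (E1 ** cliff v)"
    using cliff_vec[OF assms, of clone] by (simp add: eq_neg_iff_add_eq_0 algebra_simps)
  finally show ?thesis .
qed

text \<open>The inner factors contract by E_1 E_1 = -1, so that e_1 loses its special role.
  Equivariance is differentiated along M~ in this form.\<close>

lemma tau_vec_clprin:
  assumes "isvec v" "isvec w" shows "\<tau> (v \<cdot> clprin w) = - (cliff v ** cliff w)"
proof -
  have "\<tau> (v \<cdot> clprin w) = cliff v ** (E1 ** E1) ** cliff w"
    by (simp add: tau_mult tau_vec[OF assms(1)] tau_clprin_vec[OF assms(2)] mat_simps matrix_mul_assoc)
  then show ?thesis by (simp add: E1_sq mat_simps)
qed

text \<open>The reflection formula for w v w, repeated with matrices. The sign arises because c(w)^2
  = -|w|^2 while w w' = |w|^2.\<close>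

lemma cliff_triple:
  assumes v: "isvec v" and w: "isvec w"
  shows "cliff w ** cliff (clprin v) ** cliff w = - cliff (w \<cdot> v \<cdot> w)"
proof -
  have "cliff w ** cliff (clprin v) ** cliff w
    = (- 2 * inner w (clprin v)) *\<^sub>R cliff w - cliff (clprin v) ** (cliff w ** cliff w)"
  proof -
    have "cliff w ** cliff (clprin v) = (- 2 * inner w (clprin v)) *\<^sub>R mat 1 - cliff (clprin v) ** cliff w"
      using cliff_vec[OF w, of "clprin v"] by (simp add: algebra_simps)
    then have "cliff w ** cliff (clprin v) ** cliff w = ((- 2 * inner w (clprin v)) *\<^sub>R mat 1 - cliff (clprin v) ** cliff w) ** cliff w"
      by simp
    then show ?thesis
      by (simp add: mat_simps matrix_mul_assoc)
  qed
  also have "\<dots> = - ((2 * inner w (clprin v)) *\<^sub>R cliff w - (norm w)\<^sup>2 *\<^sub>R cliff (clprin v))"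
    by (simp add: cliff_sq[OF w] mat_simps)
  also have "\<dots> = - cliff (w \<cdot> v \<cdot> w)"
  proof -
    have "v \<cdot> w = (2 * inner w (clprin v)) *\<^sub>R clone - clprin w \<cdot> clprin v"
      using vec_polar'[of "w" "clprin v"] assms by (simp add: algebra_simps)
    then have "w \<cdot> v \<cdot> w = (2 * inner w (clprin v)) *\<^sub>R w - (w \<cdot> clprin w) \<cdot> clprin v"
      by (simp add: clmul_assoc cl_simps)
    then show ?thesis
      by (simp add: vec_clprin[OF w] cl_simps linear_diff[OF linear_cliff] linear_scale[OF linear_cliff])
  qed
  finally show ?thesis .
qed

lemma E1_cliff_E1: "isvec v \<Longrightarrow> E1 ** cliff v ** E1 = - cliff (clprin v)"
  using cliff_triple[of "clprin v" clone] by simp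

lemma tau_equivariant_vec:
  assumes w: "isvec w" and v: "isvec v"
  shows "\<tau> w ** cliff v ** \<tau> (clbar w) = cliff (w \<cdot> v \<cdot> w)"
proof -
  have "\<tau> (clbar w) = - (E1 ** cliff w)"
    using w by (simp only: clbar_vec tau_clprin_vec)
  then have "\<tau> w ** cliff v ** \<tau> (clbar w) = cliff w ** (E1 ** cliff v ** E1) ** cliff w"
    by (simp add: tau_vec[OF w] mat_simps matrix_mul_assoc)
  also have "\<dots> = cliff (w \<cdot> v \<cdot> w)"
    unfolding E1_cliff_E1[OF v] using cliff_triple[OF v w] by (simp add: mat_simps)
  finally show ?thesis .
qed

text \<open>Clifford multiplication intertwines tau with v -> m v \<open>clrev m\<close>, which for
  |m| = 1 is the isotropy action on the tangent space. This is why the Dirac operator preserves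
  sections.\<close>

lemma tau_equivariant:
  assumes "m \<in> clgamma" "isvec v"
  shows "\<tau> m ** cliff v ** \<tau> (clbar m) = cliff (m \<cdot> v \<cdot> clrev m)"
  using assms
proof (induction arbitrary: v)
  case (base w)
  then show ?case by (simp add: tau_equivariant_vec clrev_vec)
next
  case (step x w)
  have "\<tau> (x \<cdot> w) ** cliff v ** \<tau> (clbar (x \<cdot> w)) = \<tau> x ** (\<tau> w ** cliff v ** \<tau> (clbar w)) ** \<tau> (clbar x)"
    by (simp add: tau_mult clbar_mult matrix_mul_assoc)
  also have "\<dots> = cliff (x \<cdot> (w \<cdot> v \<cdot> w) \<cdot> clrev x)"
    unfolding tau_equivariant_vec[OF step(2) step(5)] using step by (intro step.IH isvec_triple)
  finally show ?case using step by (simp add: clrev_mult clrev_vec clmul_assoc)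
qed

lemma tau_inv:
  assumes "m \<in> clgamma" "norm m = 1" shows "matrix_inv (\<tau> m) = \<tau> (clbar m)"
proof (rule matrix_inv_eqI)
  have m: "m \<in> clgamma0" using assms by simp
  show "\<tau> m ** \<tau> (clbar m) = mat 1" "\<tau> (clbar m) ** \<tau> m = mat 1"
    using clgamma_clbar[OF m] assms(2) by (simp_all only: tau_mult[symmetric] power_one scaleR_one tau_clone)
qed

end

section \<open>Calculus of smooth maps\<close>

lemma Ck_has_derivative:
  assumes "open U" "Ck (Suc k) f U" "x \<in> U"
  shows "(f has_derivative frechet_derivative f (at x)) (at x)"
  using assms by (auto simp: differentiable_on_eq_differentiable_at frechet_derivative_works[symmetric])

lemma Ck_cong:
  assumes U: "open U" and "\<And>x. x \<in> U \<Longrightarrow> f x = g x" "Ck k f U" shows "Ck k g U"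
  using assms(2,3)
proof (induction k arbitrary: f g)
  case 0
  then show ?case by (simp cong: continuous_on_cong)
next
  case (Suc k)
  have d: "(g has_derivative frechet_derivative f (at x)) (at x)" if "x \<in> U" for x
    using Ck_has_derivative[OF U Suc.prems(2) that]
    by (rule has_derivative_transform_within_open[OF _ U that]) (simp add: Suc.prems)
  then have e: "frechet_derivative f (at x) = frechet_derivative g (at x)" if "x \<in> U" for x
    using frechet_derivative_at that by blast
  have "g differentiable_on U"
    using d U by (auto simp: differentiable_on_eq_differentiable_at differentiable_def)
  moreover have "Ck k (\<lambda>x. frechet_derivative g (at x) v) U" for v
    by (rule Suc.IH[of "\<lambda>x. frechet_derivative f (at x) v"]) (use Suc.prems(2) e in auto)
  ultimately show ?case by simp
qed

lemma Ck_Suc_intro: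
  assumes U: "open U" and d: "\<And>x. x \<in> U \<Longrightarrow> (f has_derivative f' x) (at x)" and C: "\<And>v. Ck k (\<lambda>x. f' x v) U"
  shows "Ck (Suc k) f U"
proof -
  have "frechet_derivative f (at x) = f' x" if "x \<in> U" for x
    using frechet_derivative_at[OF d[OF that]] by simp
  then have "Ck k (\<lambda>x. frechet_derivative f (at x) v) U" for v
    by (intro Ck_cong[OF U _ C[of v]]) simp
  moreover have "f differentiable_on U"
    using U d by (auto simp: differentiable_on_eq_differentiable_at differentiable_def)
  ultimately show ?thesis by simp
qed

lemma Ck_Suc_continuous: "Ck (Suc k) f U \<Longrightarrow> continuous_on U f"
  by (auto intro: differentiable_imp_continuous_on)

lemma Ck_continuous: "Ck k f U \<Longrightarrow> continuous_on U f"
  by (cases k) (auto intro: differentiable_imp_continuous_on)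

lemma Ck_pred: "Ck (Suc k) f U \<Longrightarrow> Ck k f U"
proof (induction k arbitrary: f)
  case 0
  then show ?case using Ck_Suc_continuous[OF 0] by simp
next
  case (Suc k)
  then have "Ck k (\<lambda>x. frechet_derivative f (at x) v) U" for v
    using Suc.IH by simp
  then show ?case using Suc.prems by simp
qed

lemma Ck_subset:
  assumes "open U" "open V" "V \<subseteq> U" "Ck k f U" shows "Ck k f V"
  using assms(4)
proof (induction k arbitrary: f)
  case 0
  then show ?case using assms(3) by (auto intro: continuous_on_subset)
next
  case (Suc k)
  then show ?case using assms(1-3) by (auto simp: differentiable_on_eq_differentiable_at)
qed

lemma Ck_const: "open U \<Longrightarrow> Ck k (\<lambda>x. c) U"
proof (induction k arbitrary: c)
  case (Suc k)
  show ?case by (rule Ck_Suc_intro[OF Suc.prems has_derivative_const]) (rule Suc.IH[OF Suc.prems])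
qed simp

lemma Ck_bounded_linear:
  assumes "bounded_linear L" "open U" shows "Ck k L U"
proof (cases k)
  case 0
  then show ?thesis using assms by (simp add: linear_continuous_on)
next
  case (Suc m)
  show ?thesis unfolding Suc
    by (rule Ck_Suc_intro[OF assms(2) bounded_linear_imp_has_derivative[OF assms(1)]]) (rule Ck_const[OF assms(2)])
qed

lemma Ck_linear_comp:
  assumes "bounded_linear L" "open U" "Ck k f U" shows "Ck k (\<lambda>x. L (f x)) U"
  using assms(3)
proof (induction k arbitrary: f)
  case 0
  then show ?case using bounded_linear.continuous_on[OF assms(1)] by simp
next
  case (Suc k)
  show ?case
    by (rule Ck_Suc_intro[OF assms(2) bounded_linear.has_derivative[OF assms(1) Ck_has_derivative[OF assms(2) Suc.prems]]])
       (use Suc in auto)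
qed

lemma Ck_add:
  assumes "open U" "Ck k f U" "Ck k g U" shows "Ck k (\<lambda>x. f x + g x) U"
  using assms(2,3)
proof (induction k arbitrary: f g)
  case (Suc k)
  show ?case
    by (rule Ck_Suc_intro[OF assms(1) has_derivative_add[OF Ck_has_derivative[OF assms(1) Suc.prems(1)] Ck_has_derivative[OF assms(1) Suc.prems(2)]]])
       (use Suc in auto)
qed (auto intro: continuous_on_add)

lemma Ck_sum:
  assumes "open U" "\<And>i. i \<in> I \<Longrightarrow> Ck k (f i) U" shows "Ck k (\<lambda>x. \<Sum>i\<in>I. f i x) U"
  using assms(2) by (induction I rule: infinite_finite_induct) (auto intro: Ck_const[OF assms(1)] Ck_add[OF assms(1)])

lemma Ck_bilinear:
  fixes f :: "'a::euclidean_space \<Rightarrow> 'b::euclidean_space" and g :: "'a \<Rightarrow> 'c::euclidean_space"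
    and pr :: "'b \<Rightarrow> 'c \<Rightarrow> 'e::euclidean_space"
  assumes B: "bounded_bilinear pr" and U: "open U" and "Ck k f U" "Ck k g U"
  shows "Ck k (\<lambda>x. pr (f x) (g x)) U"
  using assms(3,4)
proof (induction k arbitrary: f g)
  case (Suc k)
  show ?case
    by (rule Ck_Suc_intro[OF U bounded_bilinear.FDERIV[OF B Ck_has_derivative[OF U Suc.prems(1)] Ck_has_derivative[OF U Suc.prems(2)]]])
       (assumption, assumption, intro Ck_add[OF U] Suc.IH Ck_pred[OF Suc.prems(1)] Ck_pred[OF Suc.prems(2)], use Suc.prems in auto)
qed (auto intro: bounded_bilinear.continuous_on[OF B])

lemma linear_basis_expand:
  fixes L :: "'a::euclidean_space \<Rightarrow> 'b::real_vector"
  assumes "linear L" shows "L x = (\<Sum>b\<in>Basis. (x \<bullet> b) *\<^sub>R L b)"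
  by (subst euclidean_representation[symmetric, of x]) (simp only: linear_sum[OF assms] linear_scale[OF assms])

text \<open>\<open>Ck\<close> speaks of derivatives in fixed directions, so the chain rule is
  expanded over \<open>Basis\<close>: each term is a coordinate of the derivative of g times a fixed
  directional derivative of f composed with g, to which the induction hypothesis applies.\<close>

lemma Ck_compose:
  fixes g :: "'a::euclidean_space \<Rightarrow> 'b::euclidean_space" and f :: "'b \<Rightarrow> 'c::euclidean_space"
  assumes U: "open U" and V: "open V" and "Ck k f V" "Ck k g U" and sub: "g ` U \<subseteq> V"
  shows "Ck k (\<lambda>x. f (g x)) U"
  using assms(3,4)
proof (induction k arbitrary: f)
  case 0
  then show ?case using sub by (auto intro: continuous_on_compose2)
next
  case (Suc k)
  have g: "Ck k g U" using Suc.prems(2) by (rule Ck_pred)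
  have df: "(f has_derivative frechet_derivative f (at y)) (at y)" if "y \<in> V" for y
    by (rule Ck_has_derivative[OF V Suc.prems(1) that])
  have dg: "(g has_derivative frechet_derivative g (at x)) (at x)" if "x \<in> U" for x
    by (rule Ck_has_derivative[OF U Suc.prems(2) that])
  show ?case
  proof (rule Ck_Suc_intro[OF U])
    show "((\<lambda>x. f (g x)) has_derivative (\<lambda>v. \<Sum>b\<in>Basis. (frechet_derivative g (at x) v \<bullet> b) *\<^sub>R frechet_derivative f (at (g x)) b)) (at x)"
      if "x \<in> U" for x
    proof -
      have gx: "g x \<in> V" using sub that by auto
      have "linear (frechet_derivative f (at (g x)))"
        using has_derivative_linear[OF df[OF gx]] .
      then have "(\<lambda>v. frechet_derivative f (at (g x)) (frechet_derivative g (at x) v))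
         = (\<lambda>v. \<Sum>b\<in>Basis. (frechet_derivative g (at x) v \<bullet> b) *\<^sub>R frechet_derivative f (at (g x)) b)"
        using linear_basis_expand by blast
      then show ?thesis
        using diff_chain_at[OF dg[OF that] df[OF gx]] by (simp add: o_def)
    qed
    show "Ck k (\<lambda>x. \<Sum>b\<in>Basis. (frechet_derivative g (at x) v \<bullet> b) *\<^sub>R frechet_derivative f (at (g x)) b) U" for v
    proof (intro Ck_sum[OF U] Ck_bilinear[OF bounded_bilinear_scaleR U])
      show "Ck k (\<lambda>x. frechet_derivative g (at x) v \<bullet> b) U" for b
        by (rule Ck_linear_comp[OF bounded_linear_inner_left U]) (use Suc.prems in simp)
      show "Ck k (\<lambda>x. frechet_derivative f (at (g x)) b) U" for b
        by (rule Suc.IH[OF _ g]) (use Suc.prems in simp)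
    qed
  qed
qed

lemma Ck_powr: "Ck k (\<lambda>x::real. x powr p) {0<..}"
proof (induction k arbitrary: p)
  case 0
  show ?case by (auto intro!: continuous_intros)
next
  case (Suc k)
  show ?case
  proof (rule Ck_Suc_intro)
    show "((\<lambda>x. x powr p) has_derivative (\<lambda>v. (v * p) * (x powr (p - 1)))) (at x)" if "x \<in> {0<..}" for x
    proof -
      have "(\<lambda>v. (v * p) * (x powr (p - 1))) = (*) (p * x powr (p - 1))" by (auto simp: mult_ac)
      then show ?thesis
        using has_real_derivative_powr[of x p] that by (simp add: has_field_derivative_def)
    qed
    show "Ck k (\<lambda>x. (v * p) * (x powr (p - 1))) {0<..}" for v
      by (rule Ck_linear_comp[OF bounded_linear_mult_right[of "v * p"] _ Suc.IH]) simp
  qed simp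
qed

section \<open>Symmetry of second derivatives\<close>

lemma second_difference:
  fixes f :: "'a::real_normed_vector \<Rightarrow> real"
  assumes f: "\<And>y. y \<in> ball x e \<Longrightarrow> (f has_derivative f' y) (at y)"
    and f': "\<And>y. y \<in> ball x e \<Longrightarrow> ((\<lambda>z. f' z u) has_derivative f'' y) (at y)"
    and s: "s > 0" "s * (norm u + norm v) < e"
  shows "\<exists>y. dist x y \<le> s * (norm u + norm v) \<and>
    f (x + s *\<^sub>R u + s *\<^sub>R v) - f (x + s *\<^sub>R u) - f (x + s *\<^sub>R v) + f x = s * s * f'' y v"
proof -
  have n: "norm (r *\<^sub>R u + t *\<^sub>R v) \<le> s * (norm u + norm v)" if "0 \<le> r" "r \<le> s" "0 \<le> t" "t \<le> s" for r t
  proof -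
    have "norm (r *\<^sub>R u + t *\<^sub>R v) \<le> r * norm u + t * norm v"
      using norm_triangle_ineq[of "r *\<^sub>R u" "t *\<^sub>R v"] that by simp
    also have "\<dots> \<le> s * norm u + s * norm v"
      using that by (intro add_mono mult_right_mono) auto
    finally show ?thesis by (simp add: distrib_left)
  qed
  have b: "x + r *\<^sub>R u + t *\<^sub>R v \<in> ball x e" if "0 \<le> r" "r \<le> s" "0 \<le> t" "t \<le> s" for r t
    using n[OF that] s by (simp add: dist_norm add.assoc)
       (metis add_uminus_conv_diff minus_add_distrib norm_minus_cancel order_le_less_trans)
  \<comment> \<open>The mean value theorem is applied in r to the increment of f along v, and then
    in t to the derivative of f along u.\<close>
  define h where "h r = f (x + r *\<^sub>R u + s *\<^sub>R v) - f (x + r *\<^sub>R u)" for r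
  have dh: "(h has_derivative (\<lambda>d. d * (f' (x + r *\<^sub>R u + s *\<^sub>R v) u - f' (x + r *\<^sub>R u) u))) (at r)"
    if "0 \<le> r" "r \<le> s" for r
  proof -
    have 1: "((\<lambda>r. f (x + r *\<^sub>R u + s *\<^sub>R v)) has_derivative (\<lambda>d. f' (x + r *\<^sub>R u + s *\<^sub>R v) (d *\<^sub>R u))) (at r)"
      by (rule has_derivative_compose[OF _ f]) (use b[of r s] that s in \<open>auto intro!: derivative_eq_intros\<close>)
    have 2: "((\<lambda>r. f (x + r *\<^sub>R u)) has_derivative (\<lambda>d. f' (x + r *\<^sub>R u) (d *\<^sub>R u))) (at r)"
      by (rule has_derivative_compose[OF _ f]) (use b[of r 0] that s in \<open>auto intro!: derivative_eq_intros\<close>)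
    have "linear (f' (x + r *\<^sub>R u + s *\<^sub>R v))" "linear (f' (x + r *\<^sub>R u))"
      using f[OF b[of r s]] f[OF b[of r 0]] that s by (auto intro: has_derivative_linear)
    then show ?thesis
      using has_derivative_diff[OF 1 2] by (simp add: h_def[abs_def] linear_scale right_diff_distrib)
  qed
  have "\<exists>\<xi>\<in>{0<..<s}. h s - h 0 = s * (f' (x + \<xi> *\<^sub>R u + s *\<^sub>R v) u - f' (x + \<xi> *\<^sub>R u) u)"
    using mvt_simple[OF s(1), of h "\<lambda>r d. d * (f' (x + r *\<^sub>R u + s *\<^sub>R v) u - f' (x + r *\<^sub>R u) u)", OF has_derivative_at_withinI[OF dh]]
    by simp
  then obtain \<xi> where \<xi>: "0 < \<xi>" "\<xi> < s"
    and h: "h s - h 0 = s * (f' (x + \<xi> *\<^sub>R u + s *\<^sub>R v) u - f' (x + \<xi> *\<^sub>R u) u)"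
    by auto
  define q where "q t = f' (x + \<xi> *\<^sub>R u + t *\<^sub>R v) u" for t
  have dq: "(q has_derivative (\<lambda>d. d * f'' (x + \<xi> *\<^sub>R u + t *\<^sub>R v) v)) (at t)" if "0 \<le> t" "t \<le> s" for t
  proof -
    have bt: "x + \<xi> *\<^sub>R u + t *\<^sub>R v \<in> ball x e" using b[of \<xi> t] \<xi> that by simp
    have 1: "((\<lambda>t. f' (x + \<xi> *\<^sub>R u + t *\<^sub>R v) u) has_derivative (\<lambda>d. f'' (x + \<xi> *\<^sub>R u + t *\<^sub>R v) (d *\<^sub>R v))) (at t)"
      by (rule has_derivative_compose[OF _ f']) (use bt in \<open>auto intro!: derivative_eq_intros\<close>)
    have "linear (f'' (x + \<xi> *\<^sub>R u + t *\<^sub>R v))" using f'[OF bt] by (rule has_derivative_linear)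
    then show ?thesis using 1 by (simp add: q_def[abs_def] linear_scale)
  qed
  have "\<exists>\<eta>\<in>{0<..<s}. q s - q 0 = s * f'' (x + \<xi> *\<^sub>R u + \<eta> *\<^sub>R v) v"
    using mvt_simple[OF s(1), of q "\<lambda>t d. d * f'' (x + \<xi> *\<^sub>R u + t *\<^sub>R v) v", OF has_derivative_at_withinI[OF dq]]
    by simp
  then obtain \<eta> where \<eta>: "0 < \<eta>" "\<eta> < s" and q: "q s - q 0 = s * f'' (x + \<xi> *\<^sub>R u + \<eta> *\<^sub>R v) v"
    by auto
  have "h s - h 0 = s * s * f'' (x + \<xi> *\<^sub>R u + \<eta> *\<^sub>R v) v"
    using h q by (simp add: q_def)
  moreover have "dist x (x + \<xi> *\<^sub>R u + \<eta> *\<^sub>R v) \<le> s * (norm u + norm v)"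
    using n[of \<xi> \<eta>] \<xi> \<eta> by (simp add: dist_norm add.assoc)
      (metis add_uminus_conv_diff minus_add_distrib norm_minus_cancel)
  ultimately show ?thesis
    by (intro exI[of _ "x + \<xi> *\<^sub>R u + \<eta> *\<^sub>R v"]) (simp add: h_def)
qed

text \<open>The second difference is symmetric in u and v, and \<open>second_difference\<close>
  evaluates it by either mixed derivative at a point near x. By continuity a gap between the two
  values at x would persist at small scale.\<close>

lemma mixed_derivatives_real:
  fixes f :: "'a::real_normed_vector \<Rightarrow> real"
  assumes "open U" "x \<in> U"
    and f: "\<And>y. y \<in> U \<Longrightarrow> (f has_derivative f' y) (at y)"
    and fu: "\<And>y. y \<in> U \<Longrightarrow> ((\<lambda>z. f' z u) has_derivative fu y) (at y)"
    and fv: "\<And>y. y \<in> U \<Longrightarrow> ((\<lambda>z. f' z v) has_derivative fv y) (at y)"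
    and cu: "continuous_on U (\<lambda>y. fu y v)" and cv: "continuous_on U (\<lambda>y. fv y u)"
  shows "fu x v = fv x u"
proof (rule ccontr)
  assume ne: "fu x v \<noteq> fv x u"
  define d where "d = \<bar>fu x v - fv x u\<bar> / 2"
  have d: "d > 0" using ne by (simp add: d_def)
  obtain e0 where e0: "e0 > 0" "ball x e0 \<subseteq> U" using assms(1,2) open_contains_ball by blast
  obtain e1 where e1: "e1 > 0" "\<And>y. y \<in> U \<Longrightarrow> dist y x < e1 \<Longrightarrow> dist (fu y v) (fu x v) < d"
    using cu assms(2) d unfolding continuous_on_iff by blast
  obtain e2 where e2: "e2 > 0" "\<And>y. y \<in> U \<Longrightarrow> dist y x < e2 \<Longrightarrow> dist (fv y u) (fv x u) < d"
    using cv assms(2) d unfolding continuous_on_iff by blast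
  define e where "e = min e0 (min e1 e2)"
  have e: "e > 0" "ball x e \<subseteq> U" using e0 e1 e2 by (auto simp: e_def)
  \<comment> \<open>The factor 1/2 keeps both intermediate points inside the ball; the summand 1
    avoids a division by zero when u and v vanish.\<close>
  define s where "s = e / (2 * (norm u + norm v + 1))"
  have pos: "norm u + norm v + 1 > 0" using norm_ge_zero[of u] norm_ge_zero[of v] by linarith
  have s: "s > 0" using e pos by (simp add: s_def)
  have "s * (norm u + norm v) \<le> s * (norm u + norm v + 1)" using s by simp
  also have "\<dots> = e / 2" using pos by (simp add: s_def divide_simps del: mult_2 distrib_left_numeral)
  finally have se: "s * (norm u + norm v) < e" using e by simp
  have "s * (norm v + norm u) < e" using se by (simp add: add.commute)
  obtain y where y: "dist x y \<le> s * (norm u + norm v)"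
    and 1: "f (x + s *\<^sub>R u + s *\<^sub>R v) - f (x + s *\<^sub>R u) - f (x + s *\<^sub>R v) + f x = s * s * fu y v"
    using second_difference[of x e f f' u fu s v] f fu s se e(2) by blast
  obtain z where z: "dist x z \<le> s * (norm v + norm u)"
    and 2: "f (x + s *\<^sub>R v + s *\<^sub>R u) - f (x + s *\<^sub>R v) - f (x + s *\<^sub>R u) + f x = s * s * fv z u"
    using second_difference[of x e f f' v fv s u] f fv s \<open>s * (norm v + norm u) < e\<close> e(2) by blast
  have xuv: "x + s *\<^sub>R v + s *\<^sub>R u = x + s *\<^sub>R u + s *\<^sub>R v" by (simp add: algebra_simps)
  have "s * s * fu y v = s * s * fv z u" using 1 2 unfolding xuv by linarith
  then have eq: "fu y v = fv z u" using s by simp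
  have "dist y x < e" "dist z x < e" using y z se by (simp_all add: dist_commute add.commute)
  then have "dist (fu y v) (fu x v) < d" "dist (fv z u) (fv x u) < d"
    using e1(2)[of y] e2(2)[of z] e(2) by (auto simp: e_def dist_commute)
  then have "\<bar>fu x v - fv x u\<bar> < 2 * d" unfolding eq dist_real_def by linarith
  then show False by (simp add: d_def)
qed

lemma mixed_derivatives:
  fixes f :: "'a::euclidean_space \<Rightarrow> 'b::euclidean_space"
  assumes U: "open U" "x \<in> U" and f: "\<And>k. Ck k f U"
  shows "frechet_derivative (\<lambda>y. frechet_derivative f (at y) u) (at x) v
       = frechet_derivative (\<lambda>y. frechet_derivative f (at y) v) (at x) u"
proof (rule euclidean_eqI)
  fix b :: 'b
  let ?D = "\<lambda>u y. frechet_derivative f (at y) u"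
  have D: "Ck k (?D u) U" for k u using f[of "Suc k"] by simp
  have DD: "continuous_on U (\<lambda>y. frechet_derivative (?D u) (at y) v \<bullet> b)" for u v
    using D[of "Suc 0" u] by (intro continuous_intros) simp
  show "frechet_derivative (?D u) (at x) v \<bullet> b = frechet_derivative (?D v) (at x) u \<bullet> b"
  proof (rule mixed_derivatives_real[OF U, where f = "\<lambda>y. f y \<bullet> b" and f' = "\<lambda>y u. frechet_derivative f (at y) u \<bullet> b"
        and fu = "\<lambda>y v. frechet_derivative (?D u) (at y) v \<bullet> b" and fv = "\<lambda>y u. frechet_derivative (?D v) (at y) u \<bullet> b", OF _ _ _ DD DD])
    fix y assume y: "y \<in> U"
    show "((\<lambda>y. f y \<bullet> b) has_derivative (\<lambda>u. frechet_derivative f (at y) u \<bullet> b)) (at y)"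
      by (rule has_derivative_inner_left[OF Ck_has_derivative[OF U(1) f y]])
    show "((\<lambda>y. ?D u y \<bullet> b) has_derivative (\<lambda>v. frechet_derivative (?D u) (at y) v \<bullet> b)) (at y)"
      by (rule has_derivative_inner_left[OF Ck_has_derivative[OF U(1) D y]])
    show "((\<lambda>y. ?D v y \<bullet> b) has_derivative (\<lambda>u. frechet_derivative (?D v) (at y) u \<bullet> b)) (at y)"
      by (rule has_derivative_inner_left[OF Ck_has_derivative[OF U(1) D y]])
  qed
qed

section \<open>The operator identity\<close>

(* p_m(D) for p_m(X) = prod_(j = -m..m) (X - j) *)
fun shifted_power :: "('v::real_vector \<Rightarrow> 'v) \<Rightarrow> nat \<Rightarrow> 'v \<Rightarrow> 'v" where
  "shifted_power D 0 x = D x"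
| "shifted_power D (Suc j) x = D (D (shifted_power D j x)) - (real (Suc j))\<^sup>2 *\<^sub>R shifted_power D j x"

text \<open>M is multiplication by u. The last three assumptions are the relations for c = [D, u],
  written out in D and M alone; in \<open>cubic\<close> the right side 2 (u - \<alpha>) D + c
  appears as D u + u D - 2 \<alpha> D. The carrier S reflects that differentiation is linear on
  smooth functions only.\<close>

locale covariance_algebra =
  fixes S :: "'v::real_vector set" and D M :: "'v \<Rightarrow> 'v" and \<alpha> :: real
  assumes add_S [simp]: "x \<in> S \<Longrightarrow> y \<in> S \<Longrightarrow> x + y \<in> S"
    and scale_S [simp]: "x \<in> S \<Longrightarrow> r *\<^sub>R x \<in> S"
    and D_S [simp]: "x \<in> S \<Longrightarrow> D x \<in> S" and M_S [simp]: "x \<in> S \<Longrightarrow> M x \<in> S"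
    and D_add: "x \<in> S \<Longrightarrow> y \<in> S \<Longrightarrow> D (x + y) = D x + D y"
    and D_scale: "x \<in> S \<Longrightarrow> D (r *\<^sub>R x) = r *\<^sub>R D x"
    and M_add: "x \<in> S \<Longrightarrow> y \<in> S \<Longrightarrow> M (x + y) = M x + M y"
    and M_scale: "x \<in> S \<Longrightarrow> M (r *\<^sub>R x) = r *\<^sub>R M x"
    and comm: "x \<in> S \<Longrightarrow> M (D (M x) - M (D x)) = D (M (M x)) - M (D (M x))"
    and square: "x \<in> S \<Longrightarrow> D (M (D (M x) - M (D x))) - M (D (D (M x) - M (D x)))
        = M (M x) - (2 * \<alpha>) *\<^sub>R M x + x"
    and cubic: "x \<in> S \<Longrightarrow> D (D (D (M x))) - D (D (M (D x))) - D (M (D (D x))) + M (D (D (D x)))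
        = D (M x) + M (D x) - (2 * \<alpha>) *\<^sub>R D x"
begin

lemma diff_S [simp]: "x \<in> S \<Longrightarrow> y \<in> S \<Longrightarrow> x - y \<in> S"
  using add_S[of x "(-1) *\<^sub>R y"] scale_S[of y "-1"] by simp

lemma D_diff: "x \<in> S \<Longrightarrow> y \<in> S \<Longrightarrow> D (x - y) = D x - D y"
  using D_add[of x "(-1) *\<^sub>R y"] D_scale[of y "-1"] scale_S[of y "-1"] by simp

lemma M_diff: "x \<in> S \<Longrightarrow> y \<in> S \<Longrightarrow> M (x - y) = M x - M y"
  using M_add[of x "(-1) *\<^sub>R y"] M_scale[of y "-1"] scale_S[of y "-1"] by simp

lemmas lin = D_add D_scale D_diff M_add M_scale M_diff

lemma shifted_power_S [simp]: "x \<in> S \<Longrightarrow> shifted_power D m x \<in> S"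
  by (induction m) simp_all

text \<open>This operator arises in two ways: u passes through p_s(D) by p_s(D) u = R_s p_(s-1)(D),
  and (u D)^2 - s^2 after u^s is u^(s+1) R_s. Matching the two is the induction step of the operator
  identity.\<close>

definition R :: "real \<Rightarrow> 'v \<Rightarrow> 'v" where
  "R s q = D (M (D q)) + s *\<^sub>R (D (D (M q)) - M (D (D q))) + (s\<^sup>2) *\<^sub>R M q - (2 * \<alpha> * s\<^sup>2) *\<^sub>R q"

lemma R_S [simp]: "q \<in> S \<Longrightarrow> R s q \<in> S"
  by (simp add: R_def)

text \<open>Composing \<open>cubic\<close> with D on the left and on the right eliminates the
  extreme words D^4 u and u D^4; the remaining words agree.\<close>

lemma R_step:
  assumes q: "q \<in> S"
  shows "D (D (R s q)) - (s + 1)\<^sup>2 *\<^sub>R R s q = R (s + 1) (D (D q) - s\<^sup>2 *\<^sub>R q)"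
proof -
  have c1: "D (D (D (D (M q)))) - D (D (D (M (D q)))) - D (D (M (D (D q)))) + D (M (D (D (D q))))
      = D (D (M q)) + D (M (D q)) - (2 * \<alpha>) *\<^sub>R D (D q)"
    using arg_cong[OF cubic[OF q], of D] q by (simp add: lin)
  have c2: "D (D (D (M (D q)))) - D (D (M (D (D q)))) - D (M (D (D (D q)))) + M (D (D (D (D q))))
      = D (M (D q)) + M (D (D q)) - (2 * \<alpha>) *\<^sub>R D (D q)"
    using cubic[of "D q"] q by simp
  have c1': "D (D (D (D (M q)))) = D (D (D (M (D q)))) + D (D (M (D (D q)))) - D (M (D (D (D q))))
      + D (D (M q)) + D (M (D q)) - (2 * \<alpha>) *\<^sub>R D (D q)"
    using c1 by (simp add: algebra_simps)
  have c2': "M (D (D (D (D q)))) = - D (D (D (M (D q)))) + D (D (M (D (D q)))) + D (M (D (D (D q))))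
      + D (M (D q)) + M (D (D q)) - (2 * \<alpha>) *\<^sub>R D (D q)"
    using c2 by (simp add: algebra_simps)
  have four: "r * 4 = r + r + r + r" "4 * r = r + r + r + r" for r :: real by simp_all
  show ?thesis
    unfolding R_def using q
    by (simp add: lin c1' c2' power2_eq_square algebra_simps)
      (simp only: mult_2 mult_2_right four distrib_left distrib_right scaleR_left_distrib add_ac)
qed

text \<open>The base case, s = 1, is \<open>cubic\<close> itself. Then \<open>R_step\<close> trades
  the new factor D^2 - (s + 1)^2 on the left for D^2 - s^2 on the right.\<close>

lemma R_shifted_power:
  assumes "x \<in> S"
  shows "shifted_power D (Suc m) (M x) = R (real (Suc m)) (shifted_power D m x)"
proof (induction m)
  case 0
  have "D (D (D (M x))) = D (D (M (D x))) + D (M (D (D x))) - M (D (D (D x)))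
        + D (M x) + M (D x) - (2 * \<alpha>) *\<^sub>R D x"
    using cubic[OF assms] by (simp add: algebra_simps)
  then show ?case by (simp add: R_def algebra_simps)
next
  case (Suc m)
  let ?s = "real (Suc m)"
  have "shifted_power D (Suc (Suc m)) (M x) = D (D (R ?s (shifted_power D m x))) - (?s + 1)\<^sup>2 *\<^sub>R R ?s (shifted_power D m x)"
    using Suc by simp
  also have "\<dots> = R (?s + 1) (D (D (shifted_power D m x)) - ?s\<^sup>2 *\<^sub>R shifted_power D m x)"
    by (rule R_step) (use assms in simp)
  finally show ?case by simp
qed

definition C :: "'v \<Rightarrow> 'v" where "C x = D (M x) - M (D x)"

lemma C_S [simp]: "x \<in> S \<Longrightarrow> C x \<in> S" by (simp add: C_def)

lemma Mpow_S [simp]: "x \<in> S \<Longrightarrow> (M ^^ k) x \<in> S" by (induction k) auto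

lemma Mpow_add: "x \<in> S \<Longrightarrow> y \<in> S \<Longrightarrow> (M ^^ k) (x + y) = (M ^^ k) x + (M ^^ k) y"
  by (induction k) (auto simp: lin)

lemma Mpow_scale: "x \<in> S \<Longrightarrow> (M ^^ k) (r *\<^sub>R x) = r *\<^sub>R (M ^^ k) x"
  by (induction k) (auto simp: lin)

lemma C_M: "x \<in> S \<Longrightarrow> C (M x) = M (C x)"
  unfolding C_def by (rule comm[symmetric])

lemma C_Mpow: "x \<in> S \<Longrightarrow> C ((M ^^ k) x) = (M ^^ k) (C x)"
  by (induction k) (auto simp: C_M)

text \<open>As c commutes with u, [D, u^k] = k u^(k-1) c. The additional M in front avoids the
  exponent k - 1, which would be wrong at k = 0.\<close>

lemma MD_Mpow:
  assumes y: "y \<in> S"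
  shows "M (D ((M ^^ k) y)) = (M ^^ k) (M (D y) + real k *\<^sub>R C y)"
proof (induction k)
  case (Suc k)
  let ?z = "(M ^^ k) y"
  have "M (D (M ?z)) = M (M (D ?z)) + M (C ?z)"
    using y by (simp add: C_def lin)
  also have "\<dots> = M ((M ^^ k) (M (D y) + real k *\<^sub>R C y) + (M ^^ k) (C y))"
    using y by (simp add: Suc C_Mpow lin)
  also have "\<dots> = M ((M ^^ k) (M (D y) + real (Suc k) *\<^sub>R C y))"
    using y by (simp add: Mpow_add Mpow_scale scaleR_left_distrib add_ac)
  finally show ?case by simp
qed simp

text \<open>Using \<open>MD_Mpow\<close> twice, the left side is u^k ((u D + k c)^2 - k^2). The
  constant 1 in the relation for c^2 cancels -k^2, and every other term has a left factor u.\<close>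

lemma MD_square_Mpow:
  assumes y: "y \<in> S"
  shows "M (D (M (D ((M ^^ k) y)))) - (real k)\<^sup>2 *\<^sub>R (M ^^ k) y = (M ^^ Suc k) (R (real k) y)"
proof -
  let ?s = "real k"
  let ?w = "M (D y) + ?s *\<^sub>R C y"
  have w: "?w \<in> S" using y by simp
  have CC: "C (C y) = M (M y) - (2 * \<alpha>) *\<^sub>R M y + y"
    using square[OF y] by (simp add: C_def)
  have "M (D (M (D ((M ^^ k) y)))) - ?s\<^sup>2 *\<^sub>R (M ^^ k) y = (M ^^ k) (M (D ?w) + ?s *\<^sub>R C ?w) + (- ?s\<^sup>2) *\<^sub>R (M ^^ k) y"
    unfolding MD_Mpow[OF y] MD_Mpow[OF w] by simp
  also have "\<dots> = (M ^^ k) (M (D ?w) + ?s *\<^sub>R C ?w + (- ?s\<^sup>2) *\<^sub>R y)"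
    using y w by (simp only: Mpow_add Mpow_scale add_S scale_S M_S D_S C_S)
  also have "M (D ?w) + ?s *\<^sub>R C ?w + (- ?s\<^sup>2) *\<^sub>R y = M (R ?s y)"
  proof -
    have Cw: "C ?w = M (C (D y)) + ?s *\<^sub>R C (C y)"
      using y C_M[of "D y"] by (simp add: C_def lin scaleR_right_diff_distrib)
    show ?thesis
      unfolding Cw CC using y by (simp add: C_def R_def lin power2_eq_square algebra_simps)
  qed
  finally show ?thesis by (simp add: funpow_swap1)
qed

lemma shifted_power_conjugate:
  assumes "x \<in> S"
  shows "shifted_power (\<lambda>x. M (D x)) m x = (M ^^ Suc m) (shifted_power D m ((M ^^ m) x))"
proof (induction m)
  case (Suc m)
  let ?z = "(M ^^ m) x"
  have z: "?z \<in> S" using assms by simp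
  have "shifted_power (\<lambda>x. M (D x)) (Suc m) x = (M ^^ Suc (Suc m)) (R (real (Suc m)) (shifted_power D m ?z))"
    using MD_square_Mpow[of "shifted_power D m ?z" "Suc m"] z Suc by simp
  also have "R (real (Suc m)) (shifted_power D m ?z) = shifted_power D (Suc m) (M ?z)"
    using R_shifted_power[OF z] by simp
  finally show ?case by simp
qed simp

end

section \<open>Left-invariant derivatives\<close>

lemma Ck_frechet: "Ck (Suc k) f U \<Longrightarrow> Ck k (\<lambda>x. frechet_derivative f (at x) v) U"
  by simp

lemma smooth_onE:
  assumes "smooth_on S f"
  obtains U g where "open U" "S \<subseteq> U" "\<And>k. Ck k g U" "\<And>x. x \<in> S \<Longrightarrow> g x = f x"
  using assms unfolding smooth_on_def by blast

lemma smooth_onI: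
  assumes "open U" "S \<subseteq> U" "\<And>k. Ck k g U" "\<And>x. x \<in> S \<Longrightarrow> g x = f x"
  shows "smooth_on S f"
  using assms unfolding smooth_on_def by blast

lemma smooth_on_cong:
  assumes "smooth_on S f" "\<And>x. x \<in> S \<Longrightarrow> f x = g x" shows "smooth_on S g"
  using assms unfolding smooth_on_def by metis

lemma smooth_on_bounded_linear: "bounded_linear L \<Longrightarrow> smooth_on S L"
  by (rule smooth_onI[OF open_UNIV]) (auto intro: Ck_bounded_linear)

lemma smooth_on_const: "smooth_on S (\<lambda>x. c)"
  by (rule smooth_onI[OF open_UNIV]) (auto intro: Ck_const)

lemma smooth_on_bilinear:
  fixes f :: "'a::euclidean_space \<Rightarrow> 'b::euclidean_space" and g :: "'a \<Rightarrow> 'c::euclidean_space"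
    and pr :: "'b \<Rightarrow> 'c \<Rightarrow> 'e::euclidean_space"
  assumes B: "bounded_bilinear pr" and f: "smooth_on S f" and g: "smooth_on S g"
  shows "smooth_on S (\<lambda>x. pr (f x) (g x))"
proof -
  obtain U F where F: "open U" "S \<subseteq> U" "\<And>k. Ck k F U" "\<And>x. x \<in> S \<Longrightarrow> F x = f x"
    using smooth_onE[OF f] by metis
  obtain V G where G: "open V" "S \<subseteq> V" "\<And>k. Ck k G V" "\<And>x. x \<in> S \<Longrightarrow> G x = g x"
    using smooth_onE[OF g] by metis
  have UV: "open (U \<inter> V)" using F G by auto
  show ?thesis
  proof (rule smooth_onI[OF UV])
    show "Ck k (\<lambda>x. pr (F x) (G x)) (U \<inter> V)" for k
      by (rule Ck_bilinear[OF B UV Ck_subset[OF F(1) UV _ F(3)] Ck_subset[OF G(1) UV _ G(3)]]) auto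
  qed (use F G in auto)
qed

lemma smooth_on_add:
  assumes f: "smooth_on S f" and g: "smooth_on S g"
  shows "smooth_on S (\<lambda>x. f x + g x)"
proof -
  obtain U F where F: "open U" "S \<subseteq> U" "\<And>k. Ck k F U" "\<And>x. x \<in> S \<Longrightarrow> F x = f x"
    using smooth_onE[OF f] by metis
  obtain V G where G: "open V" "S \<subseteq> V" "\<And>k. Ck k G V" "\<And>x. x \<in> S \<Longrightarrow> G x = g x"
    using smooth_onE[OF g] by metis
  have UV: "open (U \<inter> V)" using F G by auto
  show ?thesis
  proof (rule smooth_onI[OF UV])
    show "Ck k (\<lambda>x. F x + G x) (U \<inter> V)" for k
      by (rule Ck_add[OF UV Ck_subset[OF F(1) UV _ F(3)] Ck_subset[OF G(1) UV _ G(3)]]) auto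
  qed (use F G in auto)
qed

lemma smooth_on_sum:
  assumes "\<And>i. i \<in> I \<Longrightarrow> smooth_on S (f i)" shows "smooth_on S (\<lambda>x. \<Sum>i\<in>I. f i x)"
  using assms by (induction I rule: infinite_finite_induct) (auto intro: smooth_on_const smooth_on_add)

lemma smooth_on_compose:
  fixes g :: "'a::euclidean_space \<Rightarrow> 'b::euclidean_space" and f :: "'b \<Rightarrow> 'c::euclidean_space"
  assumes f: "smooth_on T f" and g: "smooth_on S g" and sub: "g ` S \<subseteq> T"
  shows "smooth_on S (\<lambda>x. f (g x))"
proof -
  obtain U G where G: "open U" "S \<subseteq> U" "\<And>k. Ck k G U" "\<And>x. x \<in> S \<Longrightarrow> G x = g x"
    using smooth_onE[OF g] by metis
  obtain V F where F: "open V" "T \<subseteq> V" "\<And>k. Ck k F V" "\<And>x. x \<in> T \<Longrightarrow> F x = f x"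
    using smooth_onE[OF f] by metis
  \<comment> \<open>Away from S the extension of g may leave the domain of the extension of f, so it
    is cut down to the open set where the composite makes sense.\<close>
  define W where "W = U \<inter> G -` V"
  have W: "open W" unfolding W_def
    by (rule continuous_open_preimage[OF _ G(1) F(1)]) (rule Ck_continuous[OF G(3)[of 0]])
  show ?thesis
  proof (rule smooth_onI[OF W])
    show "S \<subseteq> W" using G F sub by (force simp: W_def)
    show "Ck k (\<lambda>x. F (G x)) W" for k
      by (rule Ck_compose[OF W F(1) F(3) Ck_subset[OF G(1) W _ G(3)]]) (auto simp: W_def)
    show "F (G x) = f (g x)" if "x \<in> S" for x
      using G(4)[OF that] F(4)[of "g x"] sub that by auto
  qed
qed

lemma smooth_on_linear_comp:
  fixes L :: "'b::euclidean_space \<Rightarrow> 'c::euclidean_space"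
  assumes "bounded_linear L" "smooth_on S f"
  shows "smooth_on S (\<lambda>x. L (f x))"
  by (rule smooth_on_compose[OF smooth_on_bounded_linear[OF assms(1), of UNIV] assms(2)]) auto

lemma smooth_on_powr: "smooth_on {0<..} (\<lambda>x::real. x powr p)"
  by (rule smooth_onI[OF open_greaterThan subset_refl Ck_powr refl])

lemma bounded_bilinear_mmul: "bounded_bilinear mmul"
proof -
  have "bilinear mmul"
    unfolding bilinear_def linear_iff mmul_def
    by (auto simp: case_prod_unfold prod_eq_iff cl_simps algebra_simps)
  then show ?thesis by (simp add: bilinear_conv_bounded_bilinear)
qed

lemma bounded_bilinear_mact: "bounded_bilinear mact"
proof -
  have "bilinear mact"
    unfolding bilinear_def linear_iff mact_def
    by (auto simp: prod_eq_iff cl_simps algebra_simps)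
  then show ?thesis by (simp add: bilinear_conv_bounded_bilinear)
qed

lemmas bounded_linear_mmul_left = bounded_bilinear.bounded_linear_left[OF bounded_bilinear_mmul]
lemmas bounded_linear_mmul_right = bounded_bilinear.bounded_linear_right[OF bounded_bilinear_mmul]
lemmas bounded_linear_mact_left = bounded_bilinear.bounded_linear_left[OF bounded_bilinear_mact]
lemmas bounded_linear_mact_right = bounded_bilinear.bounded_linear_right[OF bounded_bilinear_mact]

lemma bounded_linear_mcol: "bounded_linear mcol"
proof -
  have "linear mcol" by (auto simp: linear_iff mcol_def)
  then show ?thesis by (simp add: linear_conv_bounded_linear)
qed

lemma bounded_linear_kmat: "bounded_linear kmat"
proof -
  have "linear kmat" by (auto simp: linear_iff kmat_def)
  then show ?thesis by (simp add: linear_conv_bounded_linear)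
qed

section \<open>Left-invariant fields on the compact group\<close>

definition tangent :: "'n::{finite,linorder} cl \<Rightarrow> 'n mat2" where
  "tangent v = (0, v, - clprin v, 0)"

lemma linear_tangent: "linear tangent"
  by (auto simp: linear_iff tangent_def)

lemma ucurve_0 [simp]: "ucurve v 0 = midm"
  by (simp add: ucurve_def midm_def zero_prod_def)

lemma ucurve_has_vector_derivative: "(ucurve v has_vector_derivative tangent v) (at 0)"
proof -
  have c: "((\<lambda>t. cos t *\<^sub>R x) has_vector_derivative 0) (at 0)" for x :: "'a cl"
    by (auto intro!: derivative_eq_intros)
  have s: "((\<lambda>t. sin t *\<^sub>R x) has_vector_derivative x) (at 0)" for x :: "'a cl"
    by (auto intro!: derivative_eq_intros)
  show ?thesis
    unfolding ucurve_def[abs_def] tangent_def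
    by (intro has_vector_derivative_Pair c s has_vector_derivative_minus)
qed

lemma mmul_ucurve_has_vector_derivative:
  "((\<lambda>t. mmul k (ucurve v t)) has_vector_derivative mmul k (tangent v)) (at 0)"
  by (rule bounded_linear.has_vector_derivative[OF
      bounded_linear_mmul_right ucurve_has_vector_derivative])

lemma norm_frame [simp]: "norm (frame a) = 1"
  by (simp add: norm_eq_sqrt_inner inner_frame)

lemma Kt_ucurve: "k \<in> Kt \<Longrightarrow> isvec v \<Longrightarrow> norm v = 1 \<Longrightarrow> mmul k (ucurve v t) \<in> Kt"
  by (intro Kt_mmul ucurve_Kt)

text \<open>A smooth extension to the ambient space has a linear derivative, so the derivative along
  a curve inside \<open>Kt\<close> depends on the velocity only.\<close>

lemma Kt_curve_derivative:
  assumes F: "open U" "Kt \<subseteq> U" "Ck (Suc 0) F U" "\<And>x. x \<in> Kt \<Longrightarrow> F x = phi x"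
    and c: "\<And>t. c t \<in> Kt" "(c has_vector_derivative Z) (at 0)"
  shows "((\<lambda>t. phi (c t)) has_vector_derivative frechet_derivative F (at (c 0)) Z) (at 0)"
proof -
  have "(F has_derivative frechet_derivative F (at (c 0))) (at (c 0))"
    using F(2) c(1) by (intro Ck_has_derivative[OF F(1,3)]) auto
  then have "((\<lambda>t. F (c t)) has_vector_derivative frechet_derivative F (at (c 0)) Z) (at 0)"
    using vector_derivative_diff_chain_within[of c Z 0 UNIV F] c(2) by (auto simp: o_def intro: has_derivative_at_withinI)
  then show ?thesis using F(4) c(1) by simp
qed

lemma lie_deriv_eq_frechet:
  assumes F: "open U" "Kt \<subseteq> U" "Ck (Suc 0) F U" "\<And>x. x \<in> Kt \<Longrightarrow> F x = phi x"
    and k: "k \<in> Kt" "isvec v" "norm v = 1"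
  shows "((\<lambda>t. phi (mmul k (ucurve v t))) has_vector_derivative frechet_derivative F (at k) (mmul k (tangent v))) (at 0)"
    "lie_deriv v phi k = frechet_derivative F (at k) (mmul k (tangent v))"
proof -
  show 1: "((\<lambda>t. phi (mmul k (ucurve v t))) has_vector_derivative frechet_derivative F (at k) (mmul k (tangent v))) (at 0)"
    using Kt_curve_derivative[OF F Kt_ucurve[OF k] mmul_ucurve_has_vector_derivative] by simp
  show "lie_deriv v phi k = frechet_derivative F (at k) (mmul k (tangent v))"
    unfolding lie_deriv_def by (rule vector_derivative_at[OF 1])
qed

lemma has_lie_deriv:
  assumes "smooth_on Kt phi" "k \<in> Kt" "isvec v" "norm v = 1"
  shows "((\<lambda>t. phi (mmul k (ucurve v t))) has_vector_derivative lie_deriv v phi k) (at 0)"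
proof -
  obtain U F where F: "open U" "Kt \<subseteq> U" "\<And>k. Ck k F U" "\<And>x. x \<in> Kt \<Longrightarrow> F x = phi x"
    using smooth_onE[OF assms(1)] by metis
  show ?thesis using lie_deriv_eq_frechet[OF F(1,2,3,4) assms(2-4)] by simp
qed

lemma lie_deriv_cong:
  assumes "\<And>k. k \<in> Kt \<Longrightarrow> phi k = psi k" "k \<in> Kt" "isvec v" "norm v = 1"
  shows "lie_deriv v phi k = lie_deriv v psi k"
  unfolding lie_deriv_def using assms(1)[OF Kt_ucurve[OF assms(2-4)]] by simp

text \<open>\<open>lie_deriv\<close> is defined through a curve, which stays in \<open>Kt\<close>
  only for unit vectors. Linearity comes from the ambient derivative, which sees just the
  velocity.\<close>

lemma lie_deriv_linear:
  assumes "smooth_on Kt phi" "k \<in> Kt" "isvec v" "norm v = 1"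
  shows "lie_deriv v phi k = (\<Sum>a\<in>UNIV. inner v (frame a) *\<^sub>R lie_deriv (frame a) phi k)"
proof -
  obtain U F where F: "open U" "Kt \<subseteq> U" "\<And>k. Ck k F U" "\<And>x. x \<in> Kt \<Longrightarrow> F x = phi x"
    using smooth_onE[OF assms(1)] by metis
  have "(F has_derivative frechet_derivative F (at k)) (at k)"
    by (rule Ck_has_derivative[OF F(1) F(3)]) (use F(2) assms(2) in auto)
  then have lin: "linear (frechet_derivative F (at k))" by (rule has_derivative_linear)
  have "linear (\<lambda>v. frechet_derivative F (at k) (mmul k (tangent v)))"
    using linear_compose[OF linear_compose[OF linear_tangent bounded_linear.linear[OF bounded_linear_mmul_right[of k]]] lin]
    by (simp add: o_def)
  note L = linear_sum[OF this] linear_scale[OF this]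
  have "lie_deriv v phi k = frechet_derivative F (at k) (mmul k (tangent (\<Sum>a\<in>UNIV. inner v (frame a) *\<^sub>R frame a)))"
    using lie_deriv_eq_frechet(2)[OF F(1,2,3,4) assms(2-4)] isvec_expand[OF assms(3)] by simp
  also have "\<dots> = (\<Sum>a\<in>UNIV. inner v (frame a) *\<^sub>R frechet_derivative F (at k) (mmul k (tangent (frame a))))"
    by (simp only: L)
  also have "\<dots> = (\<Sum>a\<in>UNIV. inner v (frame a) *\<^sub>R lie_deriv (frame a) phi k)"
    using lie_deriv_eq_frechet(2)[OF F(1,2,3,4) assms(2) isvec_frame norm_frame] by simp
  finally show ?thesis .
qed

lemma smooth_lie_field:
  fixes F :: "'n::{finite,linorder} mat2 \<Rightarrow> 'b::euclidean_space"
  assumes U: "open U" and F: "\<And>k. Ck k F U"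
  shows "Ck k (\<lambda>x. frechet_derivative F (at x) (mmul x A)) U"
proof -
  have D: "Ck k (\<lambda>x. \<Sum>b\<in>Basis. (mmul x A \<bullet> b) *\<^sub>R frechet_derivative F (at x) b) U"
  proof (intro Ck_sum[OF U] Ck_bilinear[OF bounded_bilinear_scaleR U])
    show "Ck k (\<lambda>x. mmul x A \<bullet> b) U" for b
      by (rule Ck_bounded_linear[OF bounded_linear_compose[OF bounded_linear_inner_left
          bounded_linear_mmul_left] U])
    show "Ck k (\<lambda>x. frechet_derivative F (at x) b) U" for b
      by (rule Ck_frechet[OF F])
  qed
  show ?thesis
  proof (rule Ck_cong[OF U _ D])
    fix x assume "x \<in> U"
    then have "linear (frechet_derivative F (at x))"
      using Ck_has_derivative[OF U F] has_derivative_linear by blast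
    then show "(\<Sum>b\<in>Basis. (mmul x A \<bullet> b) *\<^sub>R frechet_derivative F (at x) b) = frechet_derivative F (at x) (mmul x A)"
      by (rule linear_basis_expand[symmetric])
  qed
qed

lemma smooth_on_lie_deriv:
  assumes "smooth_on Kt phi" "isvec v" "norm v = 1"
  shows "smooth_on Kt (lie_deriv v phi)"
proof -
  obtain U F where F: "open U" "Kt \<subseteq> U" "\<And>k. Ck k F U" "\<And>x. x \<in> Kt \<Longrightarrow> F x = phi x"
    using smooth_onE[OF assms(1)] by metis
  show ?thesis
    by (rule smooth_onI[OF F(1,2) smooth_lie_field[OF F(1,3)]])
       (rule lie_deriv_eq_frechet(2)[OF F(1,2,3,4) _ assms(2,3), symmetric])
qed

text \<open>The second derivatives of F cancel by symmetry. What remains is the derivative of the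
  linear coefficients x A and x B, that is, the matrix commutator.\<close>

lemma bracket_linear_fields:
  fixes F :: "'n::{finite,linorder} mat2 \<Rightarrow> 'b::euclidean_space"
  assumes U: "open U" "x \<in> U" and F: "\<And>k. Ck k F U"
  shows "frechet_derivative (\<lambda>x. frechet_derivative F (at x) (mmul x A)) (at x) (mmul x B)
    - frechet_derivative (\<lambda>x. frechet_derivative F (at x) (mmul x B)) (at x) (mmul x A)
    = frechet_derivative F (at x) (mmul x (mmul B A - mmul A B))"
proof -
  let ?D = "\<lambda>b x. frechet_derivative F (at x) b"
  let ?S = "\<lambda>a b. frechet_derivative (?D a) (at x) b"
  have D: "(?D b has_derivative ?S b) (at x)" for b
    by (rule Ck_has_derivative[OF U(1) Ck_frechet[OF F, of "Suc 0"] U(2)])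
  have lin: "linear (frechet_derivative F (at y))" if "y \<in> U" for y
    using Ck_has_derivative[OF U(1) F that] by (rule has_derivative_linear)
  have lin_S: "linear (?S b)" for b using D by (rule has_derivative_linear)
  have deriv: "frechet_derivative (\<lambda>x. frechet_derivative F (at x) (mmul x A)) (at x)
      = (\<lambda>h. frechet_derivative F (at x) (mmul h A) + (\<Sum>b\<in>Basis. (mmul x A \<bullet> b) *\<^sub>R ?S b h))" for A
  proof (rule frechet_derivative_at[symmetric])
    have b: "((\<lambda>y. mmul y A \<bullet> b) has_derivative (\<lambda>h. mmul h A \<bullet> b)) (at x)" for b
      by (rule bounded_linear_imp_has_derivative[OF bounded_linear_compose[OF bounded_linear_inner_left
          bounded_linear_mmul_left]])
    have "((\<lambda>y. \<Sum>b\<in>Basis. (mmul y A \<bullet> b) *\<^sub>R ?D b y) has_derivative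
       (\<lambda>h. \<Sum>b\<in>Basis. (mmul x A \<bullet> b) *\<^sub>R ?S b h + (mmul h A \<bullet> b) *\<^sub>R ?D b x)) (at x)"
      by (intro has_derivative_sum has_derivative_scaleR b D)
    then have "((\<lambda>y. frechet_derivative F (at y) (mmul y A)) has_derivative
       (\<lambda>h. \<Sum>b\<in>Basis. (mmul x A \<bullet> b) *\<^sub>R ?S b h + (mmul h A \<bullet> b) *\<^sub>R ?D b x)) (at x)"
      by (rule has_derivative_transform_within_open[OF _ U]) (rule linear_basis_expand[OF lin, symmetric])
    moreover have "(\<lambda>h. \<Sum>b\<in>Basis. (mmul x A \<bullet> b) *\<^sub>R ?S b h + (mmul h A \<bullet> b) *\<^sub>R ?D b x)
       = (\<lambda>h. frechet_derivative F (at x) (mmul h A) + (\<Sum>b\<in>Basis. (mmul x A \<bullet> b) *\<^sub>R ?S b h))"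
      by (simp add: sum.distrib linear_basis_expand[OF lin[OF U(2)], symmetric] add.commute)
    ultimately show "((\<lambda>y. frechet_derivative F (at y) (mmul y A)) has_derivative
       (\<lambda>h. frechet_derivative F (at x) (mmul h A) + (\<Sum>b\<in>Basis. (mmul x A \<bullet> b) *\<^sub>R ?S b h))) (at x)"
      by simp
  qed
  have sym: "(\<Sum>b\<in>Basis. (p \<bullet> b) *\<^sub>R ?S b q) = (\<Sum>b\<in>Basis. (q \<bullet> b) *\<^sub>R ?S b p)" for p q
  proof -
    have "(\<Sum>b\<in>Basis. (p \<bullet> b) *\<^sub>R ?S b q) = (\<Sum>b\<in>Basis. (p \<bullet> b) *\<^sub>R ?S q b)"
      using mixed_derivatives[OF U F] by simp
    also have "\<dots> = ?S q p" by (rule linear_basis_expand[OF lin_S, symmetric])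
    also have "\<dots> = ?S p q" by (rule mixed_derivatives[OF U F])
    also have "\<dots> = (\<Sum>b\<in>Basis. (q \<bullet> b) *\<^sub>R ?S p b)" by (rule linear_basis_expand[OF lin_S])
    also have "\<dots> = (\<Sum>b\<in>Basis. (q \<bullet> b) *\<^sub>R ?S b p)"
      using mixed_derivatives[OF U F] by simp
    finally show ?thesis .
  qed
  show ?thesis
    unfolding deriv sym[of "mmul x A" "mmul x B"]
    by (simp add: mmul_assoc bounded_bilinear.diff_right[OF bounded_bilinear_mmul] linear_diff[OF lin[OF U(2)]])
qed

text \<open>The commutator of two tangent directions lies in the Lie algebra of \<open>Mt\<close>,
  which the frame does not span. The bracket is therefore evaluated on an arbitrary curve in
  \<open>Kt\<close> with the right velocity.\<close>

lemma lie_deriv_commutator: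
  assumes phi: "smooth_on Kt phi" and k: "k \<in> Kt"
    and v: "isvec v" "norm v = 1" and w: "isvec w" "norm w = 1"
    and c: "\<And>t. c t \<in> Kt" "c 0 = k" "(c has_vector_derivative mmul k (mmul (tangent w) (tangent v) - mmul (tangent v) (tangent w))) (at 0)"
  shows "((\<lambda>t. phi (c t)) has_vector_derivative lie_deriv w (lie_deriv v phi) k - lie_deriv v (lie_deriv w phi) k) (at 0)"
proof -
  obtain U F where F: "open U" "Kt \<subseteq> U" "\<And>k. Ck k F U" "\<And>x. x \<in> Kt \<Longrightarrow> F x = phi x"
    using smooth_onE[OF phi] by metis
  have kU: "k \<in> U" using k F(2) by auto
  have 1: "lie_deriv w (lie_deriv v phi) k
      = frechet_derivative (\<lambda>x. frechet_derivative F (at x) (mmul x (tangent v))) (at k) (mmul k (tangent w))"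
    if "isvec v" "norm v = 1" "isvec w" "norm w = 1" for v w
    by (rule lie_deriv_eq_frechet(2)[OF F(1,2) smooth_lie_field[OF F(1,3)] _ k that(3,4)])
       (rule lie_deriv_eq_frechet(2)[OF F(1,2,3,4) _ that(1,2), symmetric])
  have "lie_deriv w (lie_deriv v phi) k - lie_deriv v (lie_deriv w phi) k
     = frechet_derivative F (at k) (mmul k (mmul (tangent w) (tangent v) - mmul (tangent v) (tangent w)))"
    unfolding 1[OF v w] 1[OF w v] by (rule bracket_linear_fields[OF F(1) kU F(3)])
  then show ?thesis
    using Kt_curve_derivative[OF F(1,2,3,4) c(1,3)] by (simp add: c(2))
qed

section \<open>The Dirac operator on sections\<close>

lemma bounded_bilinear_matrix_vector:
  "bounded_bilinear ((*v) :: complex^'d^'d \<Rightarrow> complex^'d \<Rightarrow> complex^'d)"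
proof -
  have "bilinear ((*v) :: complex^'d^'d \<Rightarrow> complex^'d \<Rightarrow> complex^'d)"
    unfolding bilinear_def linear_iff
    by (auto simp: vec_eq_iff matrix_vector_mult_def sum.distrib algebra_simps scaleR_sum_right)
  then show ?thesis by (simp add: bilinear_conv_bounded_bilinear)
qed

lemmas mv_simps =
  bounded_bilinear.add_left[OF bounded_bilinear_matrix_vector]
  bounded_bilinear.add_right[OF bounded_bilinear_matrix_vector]
  bounded_bilinear.diff_left[OF bounded_bilinear_matrix_vector]
  bounded_bilinear.diff_right[OF bounded_bilinear_matrix_vector]
  bounded_bilinear.minus_left[OF bounded_bilinear_matrix_vector]
  bounded_bilinear.minus_right[OF bounded_bilinear_matrix_vector]
  bounded_bilinear.scaleR_left[OF bounded_bilinear_matrix_vector]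
  bounded_bilinear.scaleR_right[OF bounded_bilinear_matrix_vector]

lemmas bounded_linear_mv_right = bounded_bilinear.bounded_linear_right[OF bounded_bilinear_matrix_vector]
lemmas mv_sum_left = bounded_bilinear.sum_left[OF bounded_bilinear_matrix_vector]
lemmas mv_sum_right = bounded_bilinear.sum_right[OF bounded_bilinear_matrix_vector]

lemma mv_assoc: "A *v (B *v x) = (A ** B) *v x" for A B :: "complex^'d^'d"
  by (rule matrix_vector_mul_assoc)

lemma inner_clprin [simp]: "inner (clprin x) (clprin y) = inner x y"
proof -
  have "norm (clprin x + clprin y) = norm (x + y)"
    by (metis clprin_linear(1) norm_clprin)
  then show ?thesis by (simp add: dot_norm)
qed

definition diag :: "'n::{finite,linorder} cl \<Rightarrow> 'n mat2" where
  "diag m = (m, 0, 0, clprin m)"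

lemma diag_Kt: "m \<in> clgamma \<Longrightarrow> norm m = 1 \<Longrightarrow> diag m \<in> Kt"
  by (rule Mt_Kt) (auto simp: Mt_iff diag_def)

lemma bounded_linear_diag: "bounded_linear diag"
proof -
  have "linear diag" by (auto simp: linear_iff diag_def)
  then show ?thesis by (simp add: linear_conv_bounded_linear)
qed

lemma diag_clone [simp]: "diag clone = midm"
  by (simp add: diag_def midm_def)

lemma frame_orthogonal: "a \<noteq> b \<Longrightarrow> frame b \<cdot> clprin (frame a) = - (frame a \<cdot> clprin (frame b))"
  using frame_anticommute[of a b] by (simp add: inner_frame eq_neg_iff_add_eq_0 add.commute)

lemma frame_orthogonal': "a \<noteq> b \<Longrightarrow> clprin (frame b) \<cdot> frame a = - (clprin (frame a) \<cdot> frame b)"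
  using arg_cong[OF frame_orthogonal[of a b], of clprin] by (simp add: clprin_mult)

lemma frame_clprin: "frame a \<cdot> clprin (frame a) = clone" "clprin (frame a) \<cdot> frame a = clone"
  by (simp_all add: vec_clprin)

lemma ucurve_diag:
  assumes "m \<in> clgamma" "norm m = 1"
  shows "mmul (diag m) (ucurve v t) = mmul (ucurve (m \<cdot> v \<cdot> clrev m) t) (diag m)"
proof -
  have m: "clrev m \<cdot> clprin m = clone" "clbar m \<cdot> m = clone"
    using clgamma_clrev_clprin[of m] clgamma_clbar[of m] assms by simp_all
  show ?thesis
    by (simp add: diag_def ucurve_def cl_simps clprin_mult clrev_clprin clmul_assoc m clbar_def[symmetric])
qed

lemma norm_sandwich:
  assumes "m \<in> clgamma" "norm m = 1" "isvec v" "norm v = 1"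
  shows "norm (m \<cdot> v \<cdot> clrev m) = 1"
proof -
  have m: "m \<in> clgamma0" using assms by simp
  show ?thesis
    unfolding clmul_assoc norm_clgamma_left[OF m] norm_clgamma_left[OF vec_clgamma0[OF assms(3)]]
    using assms by simp
qed

lemma sum_rotate:
  "(\<Sum>a\<in>A. \<Sum>c\<in>C. \<Sum>b\<in>B. f a c b) = (\<Sum>c\<in>C. \<Sum>b\<in>B. \<Sum>a\<in>A. f a c b)"
proof -
  have "(\<Sum>a\<in>A. \<Sum>c\<in>C. \<Sum>b\<in>B. f a c b) = (\<Sum>c\<in>C. \<Sum>a\<in>A. \<Sum>b\<in>B. f a c b)" by (rule sum.swap)
  also have "\<dots> = (\<Sum>c\<in>C. \<Sum>b\<in>B. \<Sum>a\<in>A. f a c b)" by (rule sum.cong[OF refl], rule sum.swap)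
  finally show ?thesis .
qed

context spinor
begin

abbreviation Dir :: "('n mat2 \<Rightarrow> complex^'d) \<Rightarrow> 'n mat2 \<Rightarrow> complex^'d" where
  "Dir \<equiv> dirac E1 E"

lemma dirac_sum: "Dir phi k = (1/2::real) *\<^sub>R (\<Sum>a\<in>UNIV. EE a *v lie_deriv (frame a) phi k)"
  by (simp add: dirac_def sum_option)

lemma dirac_eqI:
  assumes "\<And>a. ((\<lambda>t. phi (mmul k (ucurve (frame a) t))) has_vector_derivative y a) (at 0)"
  shows "Dir phi k = (1/2::real) *\<^sub>R (\<Sum>a\<in>UNIV. EE a *v y a)"
  unfolding dirac_sum lie_deriv_def using vector_derivative_at[OF assms] by simp

lemma dirac_cong:
  assumes "\<And>k. k \<in> Kt \<Longrightarrow> phi k = psi k" "k \<in> Kt" shows "Dir phi k = Dir psi k"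
  unfolding dirac_sum using lie_deriv_cong[OF assms isvec_frame norm_frame] by simp

lemma smooth_on_mv: "smooth_on S f \<Longrightarrow> smooth_on S (\<lambda>x. (A :: complex^'d^'d) *v f x)"
  by (rule smooth_on_linear_comp[OF bounded_linear_mv_right])

lemma smooth_on_dirac: "smooth_on Kt phi \<Longrightarrow> smooth_on Kt (Dir phi)"
  unfolding dirac_sum[abs_def]
  by (intro smooth_on_linear_comp[OF bounded_linear_scaleR_right] smooth_on_sum smooth_on_mv smooth_on_lie_deriv) auto

lemma is_section_iff:
  "is_section E1 E phi \<longleftrightarrow> (\<forall>k\<in>Kt. \<forall>m. m \<in> clgamma \<and> norm m = 1 \<longrightarrow> phi (mmul k (diag m)) = \<tau> (clbar m) *v phi k)"
proof -
  have M: "(\<forall>g\<in>Mt. P g) \<longleftrightarrow> (\<forall>m. m \<in> clgamma \<and> norm m = 1 \<longrightarrow> P (diag m))" for P :: "'n mat2 \<Rightarrow> bool"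
    by (auto simp: Mt_iff diag_def)
  have f: "fst (diag m) = m" for m :: "'n cl" by (simp add: diag_def)
  show ?thesis unfolding is_section_def M f by (simp add: tau_inv cong: imp_cong)
qed

lemma lie_deriv_section:
  assumes phi: "smooth_on Kt phi" "is_section E1 E phi" and k: "k \<in> Kt"
    and m: "m \<in> clgamma" "norm m = 1" and v: "isvec v" "norm v = 1"
  shows "lie_deriv v phi (mmul k (diag m)) = \<tau> (clbar m) *v lie_deriv (m \<cdot> v \<cdot> clrev m) phi k"
proof -
  let ?w = "m \<cdot> v \<cdot> clrev m"
  have w: "isvec ?w" using m v by (intro isvec_sandwich) auto
  have nw: "norm ?w = 1" by (rule norm_sandwich[OF m v])
  have "phi (mmul (mmul k (diag m)) (ucurve v t)) = \<tau> (clbar m) *v phi (mmul k (ucurve ?w t))" for t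
  proof -
    have "mmul (mmul k (diag m)) (ucurve v t) = mmul (mmul k (ucurve ?w t)) (diag m)"
      by (simp only: mmul_assoc ucurve_diag[OF m])
    then show ?thesis using phi(2) Kt_ucurve[OF k w nw] m by (simp add: is_section_iff)
  qed
  moreover have "((\<lambda>t. \<tau> (clbar m) *v phi (mmul k (ucurve ?w t))) has_vector_derivative \<tau> (clbar m) *v lie_deriv ?w phi k) (at 0)"
    by (rule bounded_linear.has_vector_derivative[OF bounded_linear_mv_right has_lie_deriv[OF phi(1) k w nw]])
  ultimately show ?thesis unfolding lie_deriv_def by (simp add: vector_derivative_at)
qed

text \<open>Equivariance rotates the frame to the orthonormal basis m e_a \<open>clrev m\<close>,
  both in the derivative and, by \<open>tau_equivariant\<close>, in the Clifford factor. The sum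
  over an orthonormal basis does not depend on the basis.\<close>

lemma is_section_dirac:
  assumes phi: "smooth_on Kt phi" "is_section E1 E phi"
  shows "is_section E1 E (Dir phi)"
  unfolding is_section_iff
proof (intro ballI allI impI)
  fix k :: "'n mat2" and m :: "'n cl" assume k: "k \<in> Kt" and m: "m \<in> clgamma \<and> norm m = 1"
  then have m: "m \<in> clgamma" "norm m = 1" by auto
  let ?w = "\<lambda>a. m \<cdot> frame a \<cdot> clrev m"
  let ?g = "\<lambda>b. clbar m \<cdot> frame b \<cdot> clprin m"
  let ?L = "\<lambda>b. lie_deriv (frame b) phi k"
  have m0: "m \<in> clgamma0" using m by simp
  have mm: "\<tau> m ** \<tau> (clbar m) = mat 1" "\<tau> (clbar m) ** \<tau> m = mat 1"
    using clgamma_clbar[OF m0] m by (simp_all flip: tau_mult)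
  have w: "isvec (?w a)" for a using m by (intro isvec_sandwich) auto
  have g: "isvec (?g b)" for b
    using isvec_sandwich[OF clgamma0_closed(3)[OF m0] isvec_frame[of b]] by (simp add: clbar_clrev)
  have wg: "inner (?w a) (frame b) = inner (?g b) (frame a)" for a b
  proof -
    have "inner (?w a) (frame b) = inner (m \<cdot> frame a) (frame b \<cdot> clprin m)"
      by (simp only: inner_clmul_right[of _ "clrev m"] clbar_clrev)
    also have "\<dots> = inner (frame a) (clbar m \<cdot> (frame b \<cdot> clprin m))"
      by (rule inner_clmul_left)
    also have "\<dots> = inner (?g b) (frame a)" by (simp only: clmul_assoc inner_commute)
    finally show ?thesis .
  qed
  \<comment> \<open>Columns of an orthogonal matrix are orthonormal when its rows are: the sum over
    a is the inner product of e_b and e_c after the inverse rotation.\<close>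
  have orth: "(\<Sum>a\<in>UNIV. inner (?w a) (frame b) * inner (?w a) (frame c)) = (if b = c then 1 else 0)" for b c
  proof -
    have "(\<Sum>a\<in>UNIV. inner (?w a) (frame b) * inner (?w a) (frame c)) = inner (?g b) (?g c)"
      unfolding wg by (rule inner_vec_expand[OF g, symmetric])
    also have "\<dots> = inner (frame b) (frame c)"
      using inner_clgamma_left[OF clgamma0_closed(3)[OF m0]] inner_clgamma_right[OF clgamma0_closed(1)[OF m0]] m
      by (simp add: clmul_assoc)
    finally show ?thesis by (simp add: inner_frame)
  qed
  have E: "EE a ** \<tau> (clbar m) = \<tau> (clbar m) ** (\<Sum>c\<in>UNIV. inner (?w a) (frame c) *\<^sub>R EE c)" for a
  proof -
    have "cliff (?w a) = \<tau> m ** EE a ** \<tau> (clbar m)"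
      using tau_equivariant[OF m(1), of "frame a"] by simp
    then have "\<tau> (clbar m) ** cliff (?w a) = EE a ** \<tau> (clbar m)"
      using mm(2) by (simp add: matrix_mul_assoc)
    then show ?thesis by (simp add: cliff_def)
  qed
  have n: "norm (frame a :: 'n cl) = 1" for a by simp
  have nw: "norm (?w a) = 1" for a by (rule norm_sandwich[OF m isvec_frame norm_frame])
  have "Dir phi (mmul k (diag m)) = (1/2::real) *\<^sub>R (\<Sum>a\<in>UNIV. EE a *v (\<tau> (clbar m) *v lie_deriv (?w a) phi k))"
    unfolding dirac_sum lie_deriv_section[OF phi k m isvec_frame n] ..
  also have "(\<Sum>a\<in>UNIV. EE a *v (\<tau> (clbar m) *v lie_deriv (?w a) phi k))
     = (\<Sum>a\<in>UNIV. \<tau> (clbar m) *v (\<Sum>c\<in>UNIV. \<Sum>b\<in>UNIV. (inner (?w a) (frame b) * inner (?w a) (frame c)) *\<^sub>R (EE c *v ?L b)))"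
  proof (rule sum.cong[OF refl])
    fix a
    have "EE a *v (\<tau> (clbar m) *v lie_deriv (?w a) phi k)
       = \<tau> (clbar m) *v ((\<Sum>c\<in>UNIV. inner (?w a) (frame c) *\<^sub>R EE c) *v lie_deriv (?w a) phi k)"
      by (simp only: mv_assoc E)
    also have "(\<Sum>c\<in>UNIV. inner (?w a) (frame c) *\<^sub>R EE c) *v lie_deriv (?w a) phi k
        = (\<Sum>c\<in>UNIV. \<Sum>b\<in>UNIV. (inner (?w a) (frame b) * inner (?w a) (frame c)) *\<^sub>R (EE c *v ?L b))"
      unfolding lie_deriv_linear[OF phi(1) k w nw] mv_sum_left
      by (rule sum.cong[OF refl]) (simp add: mv_sum_right mv_simps scaleR_sum_right mult.commute)
    finally show "EE a *v (\<tau> (clbar m) *v lie_deriv (?w a) phi k)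
      = \<tau> (clbar m) *v (\<Sum>c\<in>UNIV. \<Sum>b\<in>UNIV. (inner (?w a) (frame b) * inner (?w a) (frame c)) *\<^sub>R (EE c *v ?L b))" .
  qed
  also have "\<dots> = \<tau> (clbar m) *v (\<Sum>c\<in>UNIV. \<Sum>b\<in>UNIV. \<Sum>a\<in>UNIV. (inner (?w a) (frame b) * inner (?w a) (frame c)) *\<^sub>R (EE c *v ?L b))"
    unfolding mv_sum_right[symmetric] by (rule arg_cong[where f = "(*v) (\<tau> (clbar m))"], rule sum_rotate)
  also have "\<dots> = \<tau> (clbar m) *v (\<Sum>c\<in>UNIV. \<Sum>b\<in>UNIV. if b = c then EE c *v ?L c else 0)"
    unfolding scaleR_sum_left[symmetric] orth by (intro arg_cong[where f = "(*v) (\<tau> (clbar m))"] sum.cong refl) simp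
  also have "\<dots> = \<tau> (clbar m) *v (\<Sum>c\<in>UNIV. EE c *v ?L c)"
    by simp
  finally show "Dir phi (mmul k (diag m)) = \<tau> (clbar m) *v Dir phi k"
    by (simp add: dirac_sum mv_simps)
qed

lemma lie_bracket_section:
  assumes phi: "smooth_on Kt phi" "is_section E1 E phi" and k: "k \<in> Kt" and ab: "a \<noteq> b"
  shows "lie_deriv (frame b) (lie_deriv (frame a) phi) k - lie_deriv (frame a) (lie_deriv (frame b) phi) k
    = 2 *\<^sub>R ((EE a ** EE b) *v phi k)"
proof -
  (* The bracket of the two left-invariant fields is tangent to the curve k diag(mu t) in k M~,
     along which equivariance determines phi. *)
  define \<mu> where "\<mu> t = cos (2 * t) *\<^sub>R clone - sin (2 * t) *\<^sub>R (frame b \<cdot> clprin (frame a :: 'n cl))" for t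
  \<comment> \<open>As a product of two unit vectors the curve lies in the Clifford group and has
    norm one. Its angle 2 t matches the factor -2 in the matrix commutator.\<close>
  have mu: "\<mu> t = frame b \<cdot> (cos (2 * t) *\<^sub>R clprin (frame b) - sin (2 * t) *\<^sub>R clprin (frame a))" for t
    by (simp add: \<mu>_def cl_simps frame_clprin)
  have v: "isvec (cos (2 * t) *\<^sub>R clprin (frame b) - sin (2 * t) *\<^sub>R clprin (frame a :: 'n cl))" (is "isvec (?v t)") for t
    by simp
  have "inner (?v t) (?v t) = (cos (2 * t))\<^sup>2 + (sin (2 * t))\<^sup>2" for t
    using ab by (simp add: inner_diff_left inner_diff_right inner_frame power2_eq_square)
  then have nv: "norm (?v t) = 1" for t by (simp add: norm_eq_sqrt_inner)
  have "?v t \<noteq> 0" for t using nv[of t] by (metis norm_zero zero_neq_one)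
  moreover have "frame b \<noteq> (0::'n cl)" by (metis norm_frame norm_zero zero_neq_one)
  ultimately have mg: "\<mu> t \<in> clgamma" for t
    unfolding mu using v by (intro clgamma.step clgamma.base) auto
  have nm: "norm (\<mu> t) = 1" for t
    unfolding mu using norm_clgamma_left[OF vec_clgamma0[OF isvec_frame[of b]]] nv[of t] by simp
  have bar: "clbar (\<mu> t) = cos (2 * t) *\<^sub>R clone - sin (2 * t) *\<^sub>R (frame a \<cdot> clprin (frame b))" for t
    by (simp add: \<mu>_def clbar_mult clbar_clrev clbar_vec clrev_vec)
  have d: "(\<mu> has_vector_derivative (- 2) *\<^sub>R (frame b \<cdot> clprin (frame a))) (at 0)"
    unfolding \<mu>_def[abs_def] by (auto intro!: derivative_eq_intros)
  have "mmul (tangent (frame b)) (tangent (frame a)) - mmul (tangent (frame a)) (tangent (frame b))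
     = diag ((- 2) *\<^sub>R (frame b \<cdot> clprin (frame a :: 'n cl)))"
    using frame_orthogonal[OF ab] frame_orthogonal'[OF ab]
    by (simp add: tangent_def diag_def cl_simps clprin_mult scaleR_2)
      (simp only: mult_2 clprin_linear clprin_mult)
  then have dk: "((\<lambda>t. mmul k (diag (\<mu> t))) has_vector_derivative
      mmul k (mmul (tangent (frame b)) (tangent (frame a)) - mmul (tangent (frame a)) (tangent (frame b)))) (at 0)"
    using bounded_linear.has_vector_derivative[OF bounded_linear_mmul_right
        bounded_linear.has_vector_derivative[OF bounded_linear_diag d]] by simp
  have m0: "\<mu> 0 = clone" by (simp add: \<mu>_def)
  have "((\<lambda>t. phi (mmul k (diag (\<mu> t)))) has_vector_derivative
     lie_deriv (frame b) (lie_deriv (frame a) phi) k - lie_deriv (frame a) (lie_deriv (frame b) phi) k) (at 0)"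
    by (rule lie_deriv_commutator[OF phi(1) k isvec_frame norm_frame isvec_frame norm_frame _ _ dk])
       (use Kt_mmul[OF k diag_Kt[OF mg nm]] m0 in auto)
  moreover have "phi (mmul k (diag (\<mu> t))) = cos (2 * t) *\<^sub>R phi k + sin (2 * t) *\<^sub>R ((EE a ** EE b) *v phi k)" for t
  proof -
    have "phi (mmul k (diag (\<mu> t))) = \<tau> (clbar (\<mu> t)) *v phi k"
      using phi(2) k mg nm by (simp add: is_section_iff)
    also have "\<tau> (clbar (\<mu> t)) = cos (2 * t) *\<^sub>R mat 1 + sin (2 * t) *\<^sub>R (EE a ** EE b)"
      unfolding bar by (simp add: linear_diff[OF linear_tau] linear_scale[OF linear_tau] tau_vec_clprin)
    finally show ?thesis by (simp add: mv_simps)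
  qed
  moreover have "((\<lambda>t. cos (2 * t) *\<^sub>R phi k + sin (2 * t) *\<^sub>R ((EE a ** EE b) *v phi k)) has_vector_derivative
     2 *\<^sub>R ((EE a ** EE b) *v phi k)) (at 0)"
    by (auto intro!: derivative_eq_intros)
  ultimately show ?thesis
    using vector_derivative_unique_at by (metis (no_types, lifting) ext)
qed

lemma dirac_scaleR:
  assumes "smooth_on Kt phi" "k \<in> Kt"
    and f: "\<And>a. ((\<lambda>t. f (mmul k (ucurve (frame a) t))) has_vector_derivative f' a) (at 0)"
  shows "Dir (\<lambda>k. f k *\<^sub>R phi k) k = f k *\<^sub>R Dir phi k + (1/2::real) *\<^sub>R (\<Sum>a\<in>UNIV. f' a *\<^sub>R (EE a *v phi k))"
proof -
  have "((\<lambda>t. f (mmul k (ucurve (frame a) t)) *\<^sub>R phi (mmul k (ucurve (frame a) t))) has_vector_derivative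
     f k *\<^sub>R lie_deriv (frame a) phi k + f' a *\<^sub>R phi k) (at 0)" for a
    using bounded_bilinear.has_vector_derivative[OF bounded_bilinear_scaleR f has_lie_deriv[OF assms(1,2) isvec_frame norm_frame]]
    by simp
  then have "Dir (\<lambda>k. f k *\<^sub>R phi k) k = (1/2::real) *\<^sub>R (\<Sum>a\<in>UNIV. EE a *v (f k *\<^sub>R lie_deriv (frame a) phi k + f' a *\<^sub>R phi k))"
    by (rule dirac_eqI)
  then show ?thesis
    by (simp add: dirac_sum mv_simps sum.distrib scaleR_sum_right scaleR_right_distrib mult.commute)
qed

end

section \<open>The conformal factor\<close>

lemma Gt_Kt_mmul: "g \<in> Gt \<Longrightarrow> k \<in> Kt \<Longrightarrow> mmul g k \<in> Gt"
  by (rule Gt_mmul[OF _ Kt_Gt])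

lemma mcol_mact: "mcol h = mact h (clone, 0)"
  by (cases h) simp

lemma inner_mact_first:
  assumes "h \<in> Gt"
  shows "inner (mact h (x, 0)) (mact h (y, 0)) = (norm (mcol h))\<^sup>2 * inner x y"
proof -
  obtain a b c d where h: "h = (a, b, c, d)" by (cases h)
  show ?thesis
    using inner_clgamma_left[OF GtD(1)[OF assms[unfolded h]]] inner_clgamma_left[OF GtD(3)[OF assms[unfolded h]]]
    by (simp add: h norm_Pair algebra_simps)
qed

lemma inner_mact_second:
  assumes "h \<in> Gt"
  shows "inner (mact h (0, x)) (mact h (0, y)) = (norm (mact h (0, clone)))\<^sup>2 * inner x y"
proof -
  obtain a b c d where h: "h = (a, b, c, d)" by (cases h)
  show ?thesis
    using inner_clgamma_left[OF GtD(2)[OF assms[unfolded h]]] inner_clgamma_left[OF GtD(4)[OF assms[unfolded h]]]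
    by (simp add: h norm_Pair algebra_simps)
qed

text \<open>The mixed terms cancel because \<open>p \<cdot> clrev q\<close> is a vector.
  Consequently the total squared norm of both columns of \<open>mmul \<gamma> k\<close> does not
  depend on k.\<close>

lemma row_norm_Kt:
  assumes ab: "a \<in> clgamma0" "b \<in> clgamma0" and k: "(p, q, r, s) \<in> Kt"
  shows "(norm (a \<cdot> p + b \<cdot> r))\<^sup>2 + (norm (a \<cdot> q + b \<cdot> s))\<^sup>2 = (norm a)\<^sup>2 + (norm b)\<^sup>2"
proof -
  note K = KtD[OF k]
  have "q \<cdot> clrev p = p \<cdot> clrev q" using clrev_vec[OF K(6)] by (simp add: clrev_mult)
  from arg_cong[OF this, of clprin] have "clprin q \<cdot> clbar p = clprin p \<cdot> clbar q"
    by (simp add: clprin_mult clbar_def)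
  then have c: "inner (a \<cdot> p) (b \<cdot> clprin q) = inner (a \<cdot> q) (b \<cdot> clprin p)"
    by (simp add: inner_clmul_right[of a] clmul_assoc)
  have c': "inner (b \<cdot> clprin q) (a \<cdot> p) = inner (b \<cdot> clprin p) (a \<cdot> q)"
    using c by (simp add: inner_commute)
  note n = inner_clgamma_left[OF ab(1)] inner_clgamma_left[OF ab(2)]
  have "(norm (a \<cdot> p + b \<cdot> r))\<^sup>2 + (norm (a \<cdot> q + b \<cdot> s))\<^sup>2
      = (norm a)\<^sup>2 * ((norm p)\<^sup>2 + (norm q)\<^sup>2) + (norm b)\<^sup>2 * ((norm p)\<^sup>2 + (norm q)\<^sup>2)"
    unfolding K(3,4) power2_norm_eq_inner
    by (simp add: cl_simps inner_add_left inner_add_right inner_diff_left inner_diff_right c c' n algebra_simps)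
       (simp add: power2_norm_eq_inner algebra_simps)
  then show ?thesis by (simp add: K(5))
qed

text \<open>The function u, for \<gamma> = g^-1.\<close>

definition conf :: "'n::{finite,linorder} mat2 \<Rightarrow> 'n mat2 \<Rightarrow> real" where
  "conf \<gamma> k = inner (mcol (mmul \<gamma> k)) (mcol (mmul \<gamma> k))"

text \<open>The derivative of \<open>conf\<close> along the orthonormal field X_a / 2: the factor 2
  from differentiating the square cancels the 1/2.\<close>

definition dconf :: "'n::{finite,linorder} mat2 \<Rightarrow> 'n option \<Rightarrow> 'n mat2 \<Rightarrow> real" where
  "dconf \<gamma> a k = inner (mcol (mmul \<gamma> k)) (mact (mmul \<gamma> k) (0, - clprin (frame a)))"

text \<open>The constant \<alpha>, half of the total squared norm of both columns. Thus u - \<alpha>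
  is half the difference of the squared column norms of \<open>mmul \<gamma> k\<close>.\<close>

definition mean_conf :: "'n::{finite,linorder} mat2 \<Rightarrow> real" where
  "mean_conf \<gamma> = (norm \<gamma>)\<^sup>2 / 2"

lemma conf_norm: "conf \<gamma> k = (norm (mcol (mmul \<gamma> k)))\<^sup>2"
  by (simp add: conf_def power2_norm_eq_inner)

lemma conf_pos: "\<gamma> \<in> Gt \<Longrightarrow> k \<in> Kt \<Longrightarrow> conf \<gamma> k > 0"
  using norm_mcol_Gt[OF Gt_Kt_mmul] by (simp add: conf_norm)

lemma conf_complement:
  assumes "\<gamma> \<in> Gt" "k \<in> Kt"
  shows "(norm (mact (mmul \<gamma> k) (0, clone)))\<^sup>2 = 2 * mean_conf \<gamma> - conf \<gamma> k"
proof -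
  obtain a b c d where g: "\<gamma> = (a, b, c, d)" by (cases \<gamma>)
  obtain p q r s where k: "k = (p, q, r, s)" by (cases k)
  note G = GtD[OF assms(1)[unfolded g]]
  have "2 * mean_conf \<gamma> = (norm a)\<^sup>2 + (norm b)\<^sup>2 + (norm c)\<^sup>2 + (norm d)\<^sup>2"
    by (simp add: mean_conf_def g norm_Pair)
  moreover have "conf \<gamma> k = (norm (a \<cdot> p + b \<cdot> r))\<^sup>2 + (norm (c \<cdot> p + d \<cdot> r))\<^sup>2"
    "(norm (mact (mmul \<gamma> k) (0, clone)))\<^sup>2 = (norm (a \<cdot> q + b \<cdot> s))\<^sup>2 + (norm (c \<cdot> q + d \<cdot> s))\<^sup>2"
    by (simp_all add: conf_norm g k norm_Pair)
  ultimately show ?thesis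
    using row_norm_Kt[OF G(1,2) assms(2)[unfolded k]] row_norm_Kt[OF G(3,4) assms(2)[unfolded k]]
    by linarith
qed

text \<open>In the decomposition k' a_t n_w of \<open>mmul \<gamma> k\<close> the columns are the
  images under the isometry k' of (t, 0) and (t w, 1/t). Hence u = t^2, the gradient has components
  -t^2 (w, e_a), and 2 \<alpha> - u = t^2 |w|^2 + 1/t^2; the constant 1 is the product of t^2 and
  1/t^2.\<close>

lemma sum_dconf_sq:
  assumes "\<gamma> \<in> Gt" "k \<in> Kt"
  shows "(\<Sum>a\<in>UNIV. (dconf \<gamma> a k)\<^sup>2) = conf \<gamma> k * (2 * mean_conf \<gamma> - conf \<gamma> k) - 1"
proof -
  let ?h = "mmul \<gamma> k"
  define t where "t = norm (mcol ?h)"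
  have h: "?h \<in> Gt" using assms by (simp add: Gt_Kt_mmul)
  have t: "t > 0" unfolding t_def by (rule norm_mcol_Gt[OF h])
  define k' where "k' = kmat ((1 / t) *\<^sub>R mcol ?h)"
  obtain w where k': "k' \<in> Kt" and w: "isvec w" and e: "?h = mmul k' (mmul (aA t) (nN w))"
    using iwasawa[OF h] unfolding k'_def t_def by blast
  have act: "mact ?h (x, y) = mact k' (t *\<^sub>R x + t *\<^sub>R (w \<cdot> y), (1 / t) *\<^sub>R y)" for x y
    unfolding e mact_mmul[of k'] by (simp add: iwasawa_simp cl_simps)
  have "dconf \<gamma> a k = - (t\<^sup>2 * inner w (frame a))" for a
  proof -
    have "inner clone (w \<cdot> clprin (frame a)) = inner w (frame a)"
      using clbar_vec[OF isvec_frame[of a]] by (simp add: inner_clmul_clbar[of w] inner_commute[of clone] inner_clmul_clbar[of _ clone])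
    then show ?thesis
      unfolding dconf_def mcol_mact act inner_mact_Kt[OF k'] by (simp add: cl_simps power2_eq_square)
  qed
  then have "(\<Sum>a\<in>UNIV. (dconf \<gamma> a k)\<^sup>2) = t ^ 4 * (\<Sum>a\<in>UNIV. inner w (frame a) * inner w (frame a))"
    by (simp add: sum_distrib_left power2_eq_square power4_eq_xxxx mult_ac)
  also have "(\<Sum>a\<in>UNIV. inner w (frame a) * inner w (frame a)) = (norm w)\<^sup>2"
    using arg_cong[OF isvec_expand[OF w], of "inner w"] by (simp add: inner_sum_right power2_norm_eq_inner)
  also have "t ^ 4 * (norm w)\<^sup>2 = conf \<gamma> k * (2 * mean_conf \<gamma> - conf \<gamma> k) - 1"
  proof -
    have "2 * mean_conf \<gamma> - conf \<gamma> k = (t * norm w)\<^sup>2 + (1 / t)\<^sup>2"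
      unfolding conf_complement[OF assms, symmetric] power2_norm_eq_inner act inner_mact_Kt[OF k']
      by (simp add: power2_eq_square) (simp add: power2_norm_eq_inner[symmetric] power2_eq_square)
    moreover have "conf \<gamma> k = t\<^sup>2" by (simp add: conf_norm t_def)
    ultimately show ?thesis using t by (simp add: power2_eq_square power4_eq_xxxx field_simps)
  qed
  finally show ?thesis .
qed

lemma mcol_tangent: "mcol (mmul h (tangent v)) = mact h (0, - clprin v)"
  by (simp add: mcol_mmul tangent_def)

lemma mcol_ucurve_derivative:
  "((\<lambda>t. mcol (mmul \<gamma> (mmul k (ucurve v t)))) has_vector_derivative mact (mmul \<gamma> k) (0, - clprin v)) (at 0)"
  using bounded_linear.has_vector_derivative[OF bounded_linear_mcol mmul_ucurve_has_vector_derivative[of "mmul \<gamma> k" v]]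
  by (simp add: mmul_assoc mcol_tangent[symmetric])

lemma mact_ucurve_derivative:
  "((\<lambda>t. mact (mmul \<gamma> (mmul k (ucurve v t))) z) has_vector_derivative mact (mmul \<gamma> k) (mact (tangent v) z)) (at 0)"
  using bounded_linear.has_vector_derivative[OF bounded_linear_mact_left
      mmul_ucurve_has_vector_derivative[of "mmul \<gamma> k" v], of z]
  by (simp add: mmul_assoc mact_mmul)

lemma conf_derivative:
  "((\<lambda>t. conf \<gamma> (mmul k (ucurve (frame a) t))) has_vector_derivative 2 * dconf \<gamma> a k) (at 0)"
  using bounded_bilinear.has_vector_derivative[OF bounded_bilinear_inner
      mcol_ucurve_derivative[of \<gamma> k "frame a"] mcol_ucurve_derivative[of \<gamma> k "frame a"]]
  unfolding conf_def dconf_def by (simp add: inner_commute)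

text \<open>The Hessian of u is a multiple of the metric, the mark of a first spherical harmonic.
  The product of the two first derivatives contributes 2 \<alpha> - u, the second derivative of the
  column -u, and both are diagonal.\<close>

lemma dconf_derivative:
  assumes "\<gamma> \<in> Gt" "k \<in> Kt"
  shows "((\<lambda>t. dconf \<gamma> a (mmul k (ucurve (frame b) t))) has_vector_derivative
    (if a = b then 2 * (mean_conf \<gamma> - conf \<gamma> k) else 0)) (at 0)"
proof -
  let ?h = "mmul \<gamma> k"
  have h: "?h \<in> Gt" using assms by (simp add: Gt_Kt_mmul)
  have "mact (tangent (frame b)) (0, - clprin (frame a)) = (- (frame b \<cdot> clprin (frame a)), 0)"
    by (simp add: tangent_def cl_simps)
  then have 1: "inner (mcol ?h) (mact ?h (mact (tangent (frame b)) (0, - clprin (frame a)))) = - (conf \<gamma> k * inner (frame b) (frame a))"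
    unfolding mcol_mact using inner_mact_first[OF h, of clone "- (frame b \<cdot> clprin (frame a))"] clbar_vec[OF isvec_frame[of a]]
    by (simp add: conf_norm inner_clmul_clbar[of "frame b"] inner_commute[of clone] inner_clmul_clbar[of _ clone])
  have 2: "inner (mact ?h (0, - clprin (frame b))) (mact ?h (0, - clprin (frame a))) = (2 * mean_conf \<gamma> - conf \<gamma> k) * inner (frame b) (frame a)"
    unfolding inner_mact_second[OF h] conf_complement[OF assms] by simp
  show ?thesis
    using bounded_bilinear.has_vector_derivative[OF bounded_bilinear_inner mcol_ucurve_derivative[of \<gamma> k "frame b"]
        mact_ucurve_derivative[of \<gamma> k "frame b" "(0, - clprin (frame a))"]]
    unfolding dconf_def[abs_def] by (simp add: 1 2 inner_frame split: if_splits)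
qed

lemma bounded_linear_column: "bounded_linear (\<lambda>k. mcol (mmul \<gamma> k))" "bounded_linear (\<lambda>k. mact (mmul \<gamma> k) z)"
  by (rule bounded_linear_compose[OF bounded_linear_mcol bounded_linear_mmul_right],
      rule bounded_linear_compose[OF bounded_linear_mact_left bounded_linear_mmul_right])

lemma smooth_on_conf: "smooth_on S (conf \<gamma>)"
  unfolding conf_def[abs_def]
  by (intro smooth_on_bilinear[OF bounded_bilinear_inner] smooth_on_bounded_linear bounded_linear_column)

lemma conf_diag:
  assumes "m \<in> clgamma" "norm m = 1" "\<gamma> \<in> Gt" "k \<in> Kt"
  shows "conf \<gamma> (mmul k (diag m)) = conf \<gamma> k"
proof -
  have h: "mmul \<gamma> k \<in> Gt" using assms by (simp add: Gt_Kt_mmul)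
  have "mcol (mmul \<gamma> (mmul k (diag m))) = mact (mmul \<gamma> k) (m, 0)"
    by (simp add: mcol_mmul diag_def mact_mmul)
  then show ?thesis
    using inner_mact_first[OF h, of m m] assms(2) by (simp add: conf_def power2_norm_eq_inner) (metis norm_eq_sqrt_inner power2_norm_eq_inner power_one mult.right_neutral)
qed

text \<open>A power of the inner product, in place of a quotient by the norm, makes smoothness away
  from 0 an instance of the rules for \<open>powr\<close> and for bilinear maps.\<close>

definition unit_mat :: "'n::{finite,linorder} cl \<times> 'n cl \<Rightarrow> 'n mat2" where
  "unit_mat z = kmat ((inner z z powr (- 1/2)) *\<^sub>R z)"

definition cols :: "('n::{finite,linorder} cl \<times> 'n cl) set" where
  "cols = {z. z \<noteq> 0 \<and> unit_mat z \<in> Kt}"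

(* With n = CARD('n) + 1 the weight |z|^(1 - n) is the one of pi_lambda for lambda = -1/2. *)
definition colext :: "('n::{finite,linorder} mat2 \<Rightarrow> 'b::real_vector) \<Rightarrow> 'n cl \<times> 'n cl \<Rightarrow> 'b" where
  "colext phi z = (inner z z powr (- real CARD('n) / 2)) *\<^sub>R phi (unit_mat z)"

lemma inner_powr_half: "z \<noteq> 0 \<Longrightarrow> inner z z powr (- 1/2) = 1 / norm z" for z :: "'a::real_inner"
  by (simp add: power2_norm_eq_inner[symmetric] powr_minus powr_half_sqrt[symmetric] field_simps powr_half_sqrt)

lemma unit_mat_scale:
  assumes "k \<in> Kt" "r > 0"
  shows "unit_mat (r *\<^sub>R mcol k) = k" "r *\<^sub>R mcol k \<in> cols"
    "colext phi (r *\<^sub>R mcol k :: 'n::{finite,linorder} cl \<times> 'n cl) = (r powr (- real CARD('n))) *\<^sub>R phi k"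
proof -
  have n: "norm (r *\<^sub>R mcol k) = r" using norm_mcol_Kt[OF assms(1)] assms(2) by simp
  then have z: "r *\<^sub>R mcol k \<noteq> 0" using assms(2) by auto
  show u: "unit_mat (r *\<^sub>R mcol k) = k"
    unfolding unit_mat_def inner_powr_half[OF z] n using kmat_mcol[OF assms(1)] assms(2) by simp
  show "r *\<^sub>R mcol k \<in> cols" unfolding cols_def using z u assms(1) by simp
  have "inner (r *\<^sub>R mcol k) (r *\<^sub>R mcol k) = r powr 2"
    using n assms(2) by (simp add: power2_norm_eq_inner[symmetric] del: norm_scaleR)
  then show "colext phi (r *\<^sub>R mcol k) = (r powr (- real CARD('n))) *\<^sub>R phi k"
    unfolding colext_def u by (simp only: powr_powr) simp
qed

lemma Gt_column:
  assumes "h \<in> Gt"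
  shows "unit_mat (mcol h) \<in> Kt" "mcol h \<in> cols" "mcol h = norm (mcol h) *\<^sub>R mcol (unit_mat (mcol h))"
    "\<exists>w. isvec w \<and> h = mmul (unit_mat (mcol h)) (mmul (aA (norm (mcol h))) (nN w))"
proof -
  have p: "norm (mcol h) > 0" by (rule norm_mcol_Gt[OF assms])
  then have z: "mcol h \<noteq> 0" by auto
  have u: "unit_mat (mcol h) = kmat ((1 / norm (mcol h)) *\<^sub>R mcol h)"
    unfolding unit_mat_def inner_powr_half[OF z] ..
  show k: "unit_mat (mcol h) \<in> Kt" unfolding u by (rule iwasawa(1)[OF assms])
  show "\<exists>w. isvec w \<and> h = mmul (unit_mat (mcol h)) (mmul (aA (norm (mcol h))) (nN w))"
    unfolding u by (rule iwasawa(2)[OF assms])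
  show "mcol h \<in> cols" using k z by (simp add: cols_def)
  show "mcol h = norm (mcol h) *\<^sub>R mcol (unit_mat (mcol h))"
    unfolding u using p by simp
qed

lemma smooth_on_colext:
  assumes "smooth_on Kt phi" shows "smooth_on cols (colext phi)"
proof -
  have i: "smooth_on cols (\<lambda>z. inner z z)"
    by (intro smooth_on_bilinear[OF bounded_bilinear_inner] smooth_on_bounded_linear bounded_linear_ident)
  have p: "smooth_on cols (\<lambda>z. inner z z powr q)" for q
    by (rule smooth_on_compose[OF smooth_on_powr i]) (rule image_subsetI, simp add: cols_def)
  have "smooth_on cols unit_mat" unfolding unit_mat_def[abs_def]
    by (intro smooth_on_linear_comp[OF bounded_linear_kmat] smooth_on_bilinear[OF bounded_bilinear_scaleR] p
        smooth_on_bounded_linear bounded_linear_ident)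
  then have "smooth_on cols (\<lambda>z. phi (unit_mat z))"
    by (rule smooth_on_compose[OF assms]) (rule image_subsetI, simp add: cols_def)
  then show ?thesis unfolding colext_def[abs_def]
    by (intro smooth_on_bilinear[OF bounded_bilinear_scaleR] p)
qed

text \<open>In the compact picture this is the action of \<gamma>^-1 at lambda = -1/2, the operator
  U when \<gamma> = g^-1.\<close>

definition twist :: "'n::{finite,linorder} mat2 \<Rightarrow> ('n mat2 \<Rightarrow> 'b::real_vector) \<Rightarrow> 'n mat2 \<Rightarrow> 'b" where
  "twist \<gamma> phi k = colext phi (mcol (mmul \<gamma> k))"

lemma smooth_on_twist:
  assumes "smooth_on Kt phi" "\<gamma> \<in> Gt" shows "smooth_on Kt (twist \<gamma> phi)"
  unfolding twist_def[abs_def]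
  by (rule smooth_on_compose[OF smooth_on_colext[OF assms(1)] smooth_on_bounded_linear[OF bounded_linear_column(1)]])
     (rule image_subsetI, rule Gt_column(2)[OF Gt_Kt_mmul[OF assms(2)]])

context spinor
begin

lemma is_section_twist:
  assumes phi: "is_section E1 E phi" and g: "\<gamma> \<in> Gt" shows "is_section E1 E (twist \<gamma> phi)"
  unfolding is_section_iff
proof (intro ballI allI impI)
  fix k :: "'n mat2" and m :: "'n cl" assume k: "k \<in> Kt" and m: "m \<in> clgamma \<and> norm m = 1"
  let ?z = "mcol (mmul \<gamma> k)"
  let ?k = "unit_mat ?z"
  have h: "mmul \<gamma> k \<in> Gt" using g k by (simp add: Gt_Kt_mmul)
  have K: "?k \<in> Kt" by (rule Gt_column(1)[OF h])
  have D: "mmul ?k (diag m) \<in> Kt" using K m by (intro Kt_mmul diag_Kt) auto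
  have r: "norm ?z > 0" by (rule norm_mcol_Gt[OF h])
  have R: "mcol (mmul h (diag m)) = (fst (mcol h) \<cdot> m, snd (mcol h) \<cdot> m)" for h
    by (cases h) (simp add: diag_def)
  have "mcol (mmul \<gamma> (mmul k (diag m))) = norm ?z *\<^sub>R mcol (mmul ?k (diag m))"
    unfolding mmul_assoc[symmetric] R by (subst (1 2) Gt_column(3)[OF h]) (simp add: cl_simps)
  then have "twist \<gamma> phi (mmul k (diag m)) = (norm ?z powr (- real CARD('n))) *\<^sub>R phi (mmul ?k (diag m))"
    unfolding twist_def by (simp only: unit_mat_scale(3)[OF D r])
  also have "phi (mmul ?k (diag m)) = \<tau> (clbar m) *v phi ?k"
    using phi K m by (simp add: is_section_iff)
  also have "(norm ?z powr (- real CARD('n))) *\<^sub>R (\<tau> (clbar m) *v phi ?k) = \<tau> (clbar m) *v twist \<gamma> phi k"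
    unfolding twist_def by (subst (2) Gt_column(3)[OF h]) (simp only: unit_mat_scale(3)[OF K r] mv_simps)
  finally show "twist \<gamma> phi (mmul k (diag m)) = \<tau> (clbar m) *v twist \<gamma> phi k" .
qed

end

section \<open>Covariance of the Dirac operator\<close>

lemma has_vector_derivative_rescale:
  assumes "(g has_vector_derivative g') (at 0)"
  shows "((\<lambda>t. g (c * t)) has_vector_derivative c *\<^sub>R g') (at 0)"
proof -
  have "((\<lambda>t. c * t) has_vector_derivative c) (at 0)"
    by (auto intro!: derivative_eq_intros)
  then show ?thesis
    using vector_diff_chain_at[of "\<lambda>t. c * t" c 0 g g'] assms by (simp add: o_def)
qed

lemma inner_clone_clprin: "isvec v \<Longrightarrow> inner clone (w \<cdot> clprin v) = inner w v"
  by (simp add: clbar_vec[symmetric] inner_clmul_clbar[of w] inner_commute[of clone] inner_clmul_clbar[of _ clone])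

context spinor
begin

text \<open>The column moves inside the orbit of k under M~ A, where equivariance and homogeneity
  give the value in closed form. The factor 1 - t w v' is the product (v - t w) v' of vectors; its
  norm yields the scalar term of the derivative, and tau of its conjugate the Clifford term.\<close>

lemma colext_diag_derivative:
  fixes w v :: "'n cl" and phi :: "'n mat2 \<Rightarrow> complex^'d"
  assumes phi: "is_section E1 E phi" and k: "k \<in> Kt" and r: "r > 0"
    and w: "isvec w" and v: "isvec v" "norm v = 1"
    and F: "\<And>z. z \<in> cols \<Longrightarrow> F z = colext phi z"
  shows "((\<lambda>t. F (mact k (r *\<^sub>R (clone - t *\<^sub>R (w \<cdot> clprin v)), 0))) has_vector_derivative
    (r powr (- real CARD('n))) *\<^sub>R ((real (CARD('n) + 1) * inner w v) *\<^sub>R phi k + (cliff v ** cliff w) *v phi k)) (at 0)"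
proof -
  let ?n = "real (CARD('n) + 1)"
  define m where "m t = clone - t *\<^sub>R (w \<cdot> clprin v)" for t
  define N where "N = (norm (w \<cdot> clprin v))\<^sup>2"
  have m: "m t \<in> clgamma0" for t
  proof -
    have "m t = (v - t *\<^sub>R w) \<cdot> clprin v" using v by (simp add: m_def cl_simps vec_clprin)
    also have "\<dots> \<in> clgamma0" using v w by (intro clgamma0_mult vec_clgamma0) auto
    finally show ?thesis .
  qed
  have im: "inner (m t) (m t) = 1 - 2 * t * inner w v + t\<^sup>2 * N" for t
  proof -
    have "inner (w \<cdot> clprin v) clone = inner w v" "inner clone (w \<cdot> clprin v) = inner w v"
      using inner_clone_clprin[OF v(1), of w] by (simp_all add: inner_commute)
    moreover have "inner (clone :: 'n cl) clone = 1" using norm_clone by (simp add: norm_eq_sqrt_inner)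
    ultimately show ?thesis
      unfolding N_def power2_norm_eq_inner
      by (simp add: m_def inner_diff_left inner_diff_right power2_eq_square algebra_simps)
  qed
  have tau_m: "\<tau> (clbar (m t)) *v phi k = phi k + t *\<^sub>R ((cliff v ** cliff w) *v phi k)" for t
  proof -
    have "clbar (m t) = clone - t *\<^sub>R (v \<cdot> clprin w)"
      using v w by (simp add: m_def clbar_mult clbar_clrev clbar_vec clrev_vec)
    then show ?thesis using v w
      by (simp add: linear_diff[OF linear_tau] linear_scale[OF linear_tau] tau_vec_clprin mv_simps)
  qed
  define val where "val t = (r powr (- real CARD('n))) *\<^sub>R ((1 - 2 * t * inner w v + t\<^sup>2 * N) powr (- ?n / 2)) *\<^sub>R
     (phi k + t *\<^sub>R ((cliff v ** cliff w) *v phi k))" for t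
  have eq: "F (mact k (r *\<^sub>R m t, 0)) = val t" if "m t \<noteq> 0" for t
  proof -
    define s where "s = norm (m t)"
    have s: "s > 0" using that by (simp add: s_def)
    let ?m = "(1 / s) *\<^sub>R m t"
    have mg: "?m \<in> clgamma" "norm ?m = 1"
      using m[of t] that s clgamma_scaleR[of "1 / s" "m t"] by (auto simp: s_def)
    have K: "mmul k (diag ?m) \<in> Kt" using k mg by (intro Kt_mmul diag_Kt)
    have "mact k (r *\<^sub>R m t, 0) = (r * s) *\<^sub>R mcol (mmul k (diag ?m))"
      using s by (cases k) (simp add: diag_def cl_simps)
    then have "F (mact k (r *\<^sub>R m t, 0)) = ((r * s) powr (- real CARD('n))) *\<^sub>R phi (mmul k (diag ?m))"
      using F unit_mat_scale(2,3)[OF K, of "r * s"] r s by simp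
    also have "phi (mmul k (diag ?m)) = \<tau> (clbar ?m) *v phi k"
      using phi k mg unfolding is_section_iff by blast
    also have "\<dots> = (1 / s) *\<^sub>R (\<tau> (clbar (m t)) *v phi k)"
      by (simp add: linear_scale[OF linear_tau] mv_simps)
    \<comment> \<open>The weight gives s^(1-n), and normalising the argument of tau gives one more
      s^(-1); together they are the power -n of the norm of m.\<close>
    also have "((r * s) powr (- real CARD('n))) *\<^sub>R (1 / s) *\<^sub>R (\<tau> (clbar (m t)) *v phi k)
       = (r powr (- real CARD('n))) *\<^sub>R (inner (m t) (m t) powr (- ?n / 2)) *\<^sub>R (\<tau> (clbar (m t)) *v phi k)"
    proof -
      have "inner (m t) (m t) powr (- ?n / 2) = (s powr 2) powr (- ?n / 2)"
        using s by (simp add: s_def power2_norm_eq_inner)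
      also have "\<dots> = s powr (- real CARD('n) - 1)"
        unfolding powr_powr by (rule arg_cong[where f = "(powr) s"]) (simp add: field_simps)
      also have "\<dots> = s powr (- real CARD('n)) * (1 / s)" using s by (simp add: powr_diff)
      finally show ?thesis using r s by (simp add: powr_mult)
    qed
    finally show ?thesis unfolding tau_m im val_def .
  qed
  have d1: "((\<lambda>t. (1 - 2 * t * inner w v + t\<^sup>2 * N) powr (- ?n / 2)) has_vector_derivative (?n * inner w v)) (at 0)"
    unfolding has_real_derivative_iff_has_vector_derivative[symmetric]
    by (auto intro!: derivative_eq_intros simp: field_simps)
  have d2: "((\<lambda>t. phi k + t *\<^sub>R ((cliff v ** cliff w) *v phi k)) has_vector_derivative (cliff v ** cliff w) *v phi k) (at 0)"
    by (auto intro!: derivative_eq_intros)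
  have "(val has_vector_derivative
    (r powr (- real CARD('n))) *\<^sub>R ((?n * inner w v) *\<^sub>R phi k + (cliff v ** cliff w) *v phi k)) (at 0)"
    using bounded_linear.has_vector_derivative[OF bounded_linear_scaleR_right
        bounded_bilinear.has_vector_derivative[OF bounded_bilinear_scaleR d1 d2], of "r powr (- real CARD('n))"]
    unfolding val_def[abs_def] by (simp add: add.commute)
  \<comment> \<open>The closed form fails where m t = 0, but m 0 = 1, so it holds near 0.\<close>
  moreover have "open {t. m t \<noteq> 0}"
    unfolding m_def by (intro open_Collect_neq continuous_intros)
  moreover have "0 \<in> {t. m t \<noteq> 0}" by (simp add: m_def)
  ultimately show ?thesis
    using has_vector_derivative_transform_within_open[of val _ 0 "{t. m t \<noteq> 0}" "\<lambda>t. F (mact k (r *\<^sub>R m t, 0))"] eq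
    unfolding m_def by fastforce
qed

text \<open>With \<open>mmul \<gamma> k\<close> = k' a_r n_w the velocity of the column splits into
  k' (-r w v', 0), along the orbit under M~ A, and k' (0, -v'/r), along the curve
  \<open>ucurve v\<close> through k'. The ambient derivative of the extended section adds the two
  contributions.\<close>

lemma twist_derivative:
  fixes phi :: "'n mat2 \<Rightarrow> complex^'d"
  assumes phi: "smooth_on Kt phi" "is_section E1 E phi" and g: "\<gamma> \<in> Gt" and k: "k \<in> Kt"
  obtains w where "\<And>a. ((\<lambda>t. twist \<gamma> phi (mmul k (ucurve (frame a) t))) has_vector_derivative
      (norm (mcol (mmul \<gamma> k)) powr (- real CARD('n))) *\<^sub>R
       ((1 / conf \<gamma> k) *\<^sub>R lie_deriv (frame a) phi (unit_mat (mcol (mmul \<gamma> k)))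
        + (real (CARD('n) + 1) * inner w (frame a)) *\<^sub>R phi (unit_mat (mcol (mmul \<gamma> k)))
        + (EE a ** cliff w) *v phi (unit_mat (mcol (mmul \<gamma> k))))) (at 0)"
proof -
  let ?h = "mmul \<gamma> k"
  define z where "z = mcol ?h"
  define r where "r = norm z"
  define k' where "k' = unit_mat z"
  have h: "?h \<in> Gt" using g k by (simp add: Gt_Kt_mmul)
  have r: "r > 0" unfolding r_def z_def by (rule norm_mcol_Gt[OF h])
  note H = Gt_column[OF h, folded z_def, folded r_def k'_def]
  obtain w where w: "isvec w" and e: "?h = mmul k' (mmul (aA r) (nN w))" using H(4) by blast
  have zr: "z = mact k' (r *\<^sub>R clone, 0)" by (subst H(3), cases k') (simp add: cl_simps)
  obtain U F where U: "open U" "cols \<subseteq> U" "\<And>j. Ck j F U" and F: "\<And>x. x \<in> cols \<Longrightarrow> F x = colext phi x"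
    using smooth_onE[OF smooth_on_colext[OF phi(1)]] by metis
  define L where "L = frechet_derivative F (at z)"
  have dF: "(F has_derivative L) (at z)"
    unfolding L_def by (rule Ck_has_derivative[OF U(1,3)]) (use U(2) H(2) in blast)
  have linL: "linear L" using dF by (rule has_derivative_linear)
  have chain: "((\<lambda>t. F (c t)) has_vector_derivative L c') (at 0)"
    if "(c has_vector_derivative c') (at 0)" "c 0 = z" for c c'
    using vector_derivative_diff_chain_within[of c c' 0 UNIV F L] that dF
    by (auto simp: o_def intro: has_derivative_at_withinI)
  have act: "mact ?h (x, y) = mact k' (r *\<^sub>R x + r *\<^sub>R (w \<cdot> y), (1 / r) *\<^sub>R y)" for x y
    unfolding e mact_mmul[of k'] by (simp add: iwasawa_simp cl_simps)
  have "((\<lambda>t. twist \<gamma> phi (mmul k (ucurve (frame a) t))) has_vector_derivative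
      (r powr (- real CARD('n))) *\<^sub>R
       ((1 / conf \<gamma> k) *\<^sub>R lie_deriv (frame a) phi k'
        + (real (CARD('n) + 1) * inner w (frame a)) *\<^sub>R phi k' + (EE a ** cliff w) *v phi k')) (at 0)" for a
  proof -
    let ?v = "frame a :: 'n cl"
    let ?p = "r powr (- real CARD('n))"
    have "((\<lambda>t. F (mcol (mmul \<gamma> (mmul k (ucurve ?v t))))) has_vector_derivative L (mact ?h (0, - clprin ?v))) (at 0)"
      by (rule chain[OF mcol_ucurve_derivative]) (simp add: z_def)
    moreover have "F (mcol (mmul \<gamma> (mmul k (ucurve ?v t)))) = twist \<gamma> phi (mmul k (ucurve ?v t))" for t
      unfolding twist_def by (rule F[OF Gt_column(2)[OF Gt_Kt_mmul[OF g Kt_ucurve[OF k isvec_frame norm_frame]]]])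
    ultimately have A: "((\<lambda>t. twist \<gamma> phi (mmul k (ucurve ?v t))) has_vector_derivative L (mact ?h (0, - clprin ?v))) (at 0)"
      by simp
    \<comment> \<open>The curve r k' exp(s X_v) has column velocity r k' (0, -v') in s. The
      substitution s = t / r^2 matches the required 1/r and produces the factor 1 / u.\<close>
    have B: "L (mact k' (0, - ((1 / r) *\<^sub>R clprin ?v))) = ?p *\<^sub>R (1 / r\<^sup>2) *\<^sub>R lie_deriv ?v phi k'"
    proof -
      have d: "((\<lambda>t. r *\<^sub>R mcol (mmul k' (ucurve ?v ((1 / r\<^sup>2) * t)))) has_vector_derivative
         r *\<^sub>R (1 / r\<^sup>2) *\<^sub>R mact k' (0, - clprin ?v)) (at 0)"
        by (rule bounded_linear.has_vector_derivative[OF bounded_linear_scaleR_right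
            has_vector_derivative_rescale[where g = "\<lambda>t. mcol (mmul k' (ucurve ?v t))"]])
          (use mcol_ucurve_derivative[of midm k' ?v] in simp)
      have "((\<lambda>t. F (r *\<^sub>R mcol (mmul k' (ucurve ?v ((1 / r\<^sup>2) * t))))) has_vector_derivative
         L (r *\<^sub>R (1 / r\<^sup>2) *\<^sub>R mact k' (0, - clprin ?v))) (at 0)"
        by (rule chain[OF d]) (simp add: H(3)[symmetric])
      moreover have "F (r *\<^sub>R mcol (mmul k' (ucurve ?v t))) = ?p *\<^sub>R phi (mmul k' (ucurve ?v t))" for t
        using F unit_mat_scale(2,3)[OF Kt_ucurve[OF H(1) isvec_frame norm_frame] r] by simp
      moreover have "((\<lambda>t. ?p *\<^sub>R phi (mmul k' (ucurve ?v ((1 / r\<^sup>2) * t)))) has_vector_derivative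
         ?p *\<^sub>R (1 / r\<^sup>2) *\<^sub>R lie_deriv ?v phi k') (at 0)"
        by (rule bounded_linear.has_vector_derivative[OF bounded_linear_scaleR_right
            has_vector_derivative_rescale[OF has_lie_deriv[OF phi(1) H(1) isvec_frame norm_frame]]])
      ultimately have "L (r *\<^sub>R (1 / r\<^sup>2) *\<^sub>R mact k' (0, - clprin ?v)) = ?p *\<^sub>R (1 / r\<^sup>2) *\<^sub>R lie_deriv ?v phi k'"
        using vector_derivative_unique_at by simp
      moreover have "r *\<^sub>R (1 / r\<^sup>2) *\<^sub>R mact k' (0, - clprin ?v) = mact k' (0, - ((1 / r) *\<^sub>R clprin ?v))"
        using r by (cases k') (simp add: cl_simps power2_eq_square)
      ultimately show ?thesis by simp
    qed
    have C: "L (mact k' (- (r *\<^sub>R (w \<cdot> clprin ?v)), 0))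
       = ?p *\<^sub>R ((real (CARD('n) + 1) * inner w ?v) *\<^sub>R phi k' + (EE a ** cliff w) *v phi k')"
    proof -
      have "((\<lambda>t. (r *\<^sub>R (clone - t *\<^sub>R (w \<cdot> clprin ?v)), 0 :: 'n cl)) has_vector_derivative (- (r *\<^sub>R (w \<cdot> clprin ?v)), 0)) (at 0)"
        by (auto intro!: derivative_eq_intros)
      from chain[OF bounded_linear.has_vector_derivative[OF bounded_linear_mact_right this, of k']]
      have "((\<lambda>t. F (mact k' (r *\<^sub>R (clone - t *\<^sub>R (w \<cdot> clprin ?v)), 0))) has_vector_derivative
          L (mact k' (- (r *\<^sub>R (w \<cdot> clprin ?v)), 0))) (at 0)"
        by (simp add: zr)
      from vector_derivative_unique_at[OF this colext_diag_derivative[OF phi(2) H(1) r w isvec_frame norm_frame F]]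
      show ?thesis by simp
    qed
    have "mact ?h (0, - clprin ?v) = mact k' (- (r *\<^sub>R (w \<cdot> clprin ?v)), 0) + mact k' (0, - ((1 / r) *\<^sub>R clprin ?v))"
      unfolding act by (cases k') (simp add: cl_simps)
    then have "L (mact ?h (0, - clprin ?v)) = ?p *\<^sub>R ((1 / r\<^sup>2) *\<^sub>R lie_deriv ?v phi k'
        + (real (CARD('n) + 1) * inner w ?v) *\<^sub>R phi k' + (EE a ** cliff w) *v phi k')"
      by (simp add: linear_add[OF linL] B C scaleR_right_distrib)
    moreover have "conf \<gamma> k = r\<^sup>2" by (simp add: conf_norm r_def z_def)
    ultimately show ?thesis using A by simp
  qed
  then show thesis using that unfolding r_def k'_def z_def by blast
qed

lemma EE_sq: "EE a ** EE a = - mat 1"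
  using cliff_sq[of "frame a"] by simp

text \<open>For the weight t^(-2 lambda - n) the scalar term would carry the coefficient n + 2
  lambda + 1. It equals n, and so cancels the Clifford trace -n, exactly at lambda = -1/2.\<close>

lemma dirac_twist:
  fixes phi :: "'n mat2 \<Rightarrow> complex^'d"
  assumes phi: "smooth_on Kt phi" "is_section E1 E phi" and g: "\<gamma> \<in> Gt" and k: "k \<in> Kt"
  shows "conf \<gamma> k *\<^sub>R Dir (twist \<gamma> phi) k = twist \<gamma> (Dir phi) k"
proof -
  let ?z = "mcol (mmul \<gamma> k)"
  let ?k = "unit_mat ?z"
  let ?p = "norm ?z powr (- real CARD('n))"
  let ?n = "real (CARD('n) + 1)"
  have h: "mmul \<gamma> k \<in> Gt" using g k by (simp add: Gt_Kt_mmul)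
  obtain w where w: "\<And>a. ((\<lambda>t. twist \<gamma> phi (mmul k (ucurve (frame a) t))) has_vector_derivative
      ?p *\<^sub>R ((1 / conf \<gamma> k) *\<^sub>R lie_deriv (frame a) phi ?k
        + (?n * inner w (frame a)) *\<^sub>R phi ?k + (EE a ** cliff w) *v phi ?k)) (at 0)"
    using twist_derivative[OF assms] by blast
  have c1: "(\<Sum>a\<in>UNIV. EE a *v (inner w (frame a) *\<^sub>R phi ?k)) = cliff w *v phi ?k"
    by (simp add: cliff_def mv_sum_left mv_simps)
  have c2: "(\<Sum>a\<in>UNIV. EE a *v ((EE a ** cliff w) *v phi ?k)) = - (?n *\<^sub>R (cliff w *v phi ?k))"
  proof -
    have "EE a *v ((EE a ** cliff w) *v phi ?k) = - (cliff w *v phi ?k)" for a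
      unfolding mv_assoc matrix_mul_assoc EE_sq by (simp add: mat_simps mv_simps)
    then show ?thesis by (simp only: sum_constant_scaleR) (simp add: card_option)
  qed
  have "Dir (twist \<gamma> phi) k = (1/2::real) *\<^sub>R (\<Sum>a\<in>UNIV. EE a *v (?p *\<^sub>R ((1 / conf \<gamma> k) *\<^sub>R lie_deriv (frame a) phi ?k
        + ?n *\<^sub>R (inner w (frame a) *\<^sub>R phi ?k) + (EE a ** cliff w) *v phi ?k)))"
    using dirac_eqI[OF w] by simp
  also have "(\<Sum>a\<in>UNIV. EE a *v (?p *\<^sub>R ((1 / conf \<gamma> k) *\<^sub>R lie_deriv (frame a) phi ?k
        + ?n *\<^sub>R (inner w (frame a) *\<^sub>R phi ?k) + (EE a ** cliff w) *v phi ?k)))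
     = ?p *\<^sub>R ((1 / conf \<gamma> k) *\<^sub>R (\<Sum>a\<in>UNIV. EE a *v lie_deriv (frame a) phi ?k)
        + ?n *\<^sub>R (\<Sum>a\<in>UNIV. EE a *v (inner w (frame a) *\<^sub>R phi ?k)) + (\<Sum>a\<in>UNIV. EE a *v ((EE a ** cliff w) *v phi ?k)))"
    by (simp only: scaleR_sum_right sum.distrib[symmetric] mv_simps scaleR_right_distrib)
  also have "\<dots> = ?p *\<^sub>R ((1 / conf \<gamma> k) *\<^sub>R (\<Sum>a\<in>UNIV. EE a *v lie_deriv (frame a) phi ?k))"
    unfolding c1 c2 by simp
  finally have "conf \<gamma> k *\<^sub>R Dir (twist \<gamma> phi) k = ?p *\<^sub>R Dir phi ?k"
    using conf_pos[OF g k] by (simp add: dirac_sum)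
  also have "\<dots> = twist \<gamma> (Dir phi) k"
    unfolding twist_def by (subst (3) Gt_column(3)[OF h])
      (simp only: unit_mat_scale(3)[OF Gt_column(1)[OF h] norm_mcol_Gt[OF h]])
  finally show ?thesis .
qed

end

section \<open>Commutation relations with the conformal factor\<close>

context spinor
begin

text \<open>The commutator c, as Clifford multiplication by the gradient of u.\<close>

definition grad_mult :: "'n mat2 \<Rightarrow> ('n mat2 \<Rightarrow> complex^'d) \<Rightarrow> 'n mat2 \<Rightarrow> complex^'d" where
  "grad_mult \<gamma> phi k = (\<Sum>a\<in>UNIV. dconf \<gamma> a k *\<^sub>R (EE a *v phi k))"

text \<open>As the frame fields are twice the orthonormal ones, this is twice the derivative along
  the gradient of u.\<close>

definition grad_deriv :: "'n mat2 \<Rightarrow> ('n mat2 \<Rightarrow> complex^'d) \<Rightarrow> 'n mat2 \<Rightarrow> complex^'d" where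
  "grad_deriv \<gamma> phi k = (\<Sum>a\<in>UNIV. dconf \<gamma> a k *\<^sub>R lie_deriv (frame a) phi k)"

lemma dirac_conf:
  assumes "smooth_on Kt phi" "k \<in> Kt"
  shows "Dir (\<lambda>k. conf \<gamma> k *\<^sub>R phi k) k = conf \<gamma> k *\<^sub>R Dir phi k + grad_mult \<gamma> phi k"
  using dirac_scaleR[OF assms conf_derivative[of \<gamma> k]]
  by (simp add: grad_mult_def scaleR_sum_right)

lemma grad_mult_square:
  assumes "\<gamma> \<in> Gt" "k \<in> Kt"
  shows "grad_mult \<gamma> (grad_mult \<gamma> phi) k = ((conf \<gamma> k)\<^sup>2 - 2 * mean_conf \<gamma> * conf \<gamma> k + 1) *\<^sub>R phi k"
proof -
  define e where "e = (\<Sum>a\<in>UNIV. dconf \<gamma> a k *\<^sub>R (frame a :: 'n cl))"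
  have e: "isvec e" unfolding e_def by (induction rule: infinite_finite_induct) auto
  have c: "grad_mult \<gamma> psi k = cliff e *v psi k" for psi
    by (simp add: grad_mult_def e_def linear_sum[OF linear_cliff] linear_scale[OF linear_cliff] mv_sum_left mv_simps)
  have "(norm e)\<^sup>2 = (\<Sum>a\<in>UNIV. (inner e (frame a))\<^sup>2)"
    unfolding power2_norm_eq_inner inner_vec_expand[OF e, of e] by (simp add: power2_eq_square)
  moreover have "inner e (frame a) = dconf \<gamma> a k" for a
    by (simp add: e_def inner_sum_left inner_frame if_distrib[where f = "\<lambda>r. _ * r"] cong: if_cong)
  ultimately have n: "(norm e)\<^sup>2 = conf \<gamma> k * (2 * mean_conf \<gamma> - conf \<gamma> k) - 1"
    by (simp add: sum_dconf_sq[OF assms])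
  show ?thesis
    unfolding c mv_assoc cliff_sq[OF e] n
    by (simp add: mv_simps power2_eq_square algebra_simps)
qed

lemma EE_swap: "EE b ** EE a = - (EE a ** EE b) - (if a = b then 2 else 0) *\<^sub>R mat 1"
  using EE_anticommute[of b a] by (auto simp: inner_frame algebra_simps eq_neg_iff_add_eq_0)

lemma sum_if_const: "(\<Sum>a\<in>UNIV. (if a = b then r else 0) *\<^sub>R f a) = r *\<^sub>R f b" for b :: "'x::finite" and f :: "'x \<Rightarrow> 'y::real_vector"
  by (simp add: if_distrib[where f = "\<lambda>r. r *\<^sub>R _"] cong: if_cong)

text \<open>Moving E_b past E_a yields -c D and, from the diagonal of the anticommutator, the
  gradient derivative. The diagonal Hessian is contracted by the Clifford trace -n.\<close>

lemma dirac_grad_mult: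
  fixes phi :: "'n mat2 \<Rightarrow> complex^'d"
  assumes phi: "smooth_on Kt phi" and g: "\<gamma> \<in> Gt" and k: "k \<in> Kt"
  shows "Dir (grad_mult \<gamma> phi) k = (real (CARD('n) + 1) * (conf \<gamma> k - mean_conf \<gamma>)) *\<^sub>R phi k
    - grad_mult \<gamma> (Dir phi) k - grad_deriv \<gamma> phi k"
proof -
  let ?r = "2 * (mean_conf \<gamma> - conf \<gamma> k)"
  let ?L = "\<lambda>b. lie_deriv (frame b) phi k"
  let ?e = "\<lambda>a. dconf \<gamma> a k"
  have "((\<lambda>t. grad_mult \<gamma> phi (mmul k (ucurve (frame b) t))) has_vector_derivative
    (\<Sum>a\<in>UNIV. ?e a *\<^sub>R (EE a *v ?L b) + (if a = b then ?r else 0) *\<^sub>R (EE a *v phi k))) (at 0)" for b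
    unfolding grad_mult_def
  proof (rule has_vector_derivative_sum)
    fix a
    show "((\<lambda>t. dconf \<gamma> a (mmul k (ucurve (frame b) t)) *\<^sub>R (EE a *v phi (mmul k (ucurve (frame b) t)))) has_vector_derivative
      ?e a *\<^sub>R (EE a *v ?L b) + (if a = b then ?r else 0) *\<^sub>R (EE a *v phi k)) (at 0)"
      using bounded_bilinear.has_vector_derivative[OF bounded_bilinear_scaleR dconf_derivative[OF g k, of a b]
        bounded_linear.has_vector_derivative[OF bounded_linear_mv_right[of "EE a"]
          has_lie_deriv[OF phi k isvec_frame[of b] norm_frame]]]
      by simp
  qed
  then have "Dir (grad_mult \<gamma> phi) k = (1/2::real) *\<^sub>R (\<Sum>b\<in>UNIV. EE b *v
      (\<Sum>a\<in>UNIV. ?e a *\<^sub>R (EE a *v ?L b) + (if a = b then ?r else 0) *\<^sub>R (EE a *v phi k)))"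
    by (rule dirac_eqI)
  also have "(\<Sum>b\<in>UNIV. EE b *v (\<Sum>a\<in>UNIV. ?e a *\<^sub>R (EE a *v ?L b) + (if a = b then ?r else 0) *\<^sub>R (EE a *v phi k)))
     = (\<Sum>b\<in>UNIV. \<Sum>a\<in>UNIV. ?e a *\<^sub>R ((EE b ** EE a) *v ?L b)) + (\<Sum>b\<in>UNIV. ?r *\<^sub>R ((EE b ** EE b) *v phi k))"
    by (simp add: sum.distrib sum_if_const mv_simps mv_sum_right mv_assoc)
  also have "(\<Sum>b\<in>UNIV. ?r *\<^sub>R ((EE b ** EE b) *v phi k)) = (2 * (real (CARD('n) + 1) * (conf \<gamma> k - mean_conf \<gamma>))) *\<^sub>R phi k"
  proof -
    have "(\<Sum>b\<in>(UNIV :: 'n option set). ?r *\<^sub>R ((EE b ** EE b) *v phi k)) = (\<Sum>b\<in>(UNIV :: 'n option set). (- ?r) *\<^sub>R phi k)"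
      by (rule sum.cong[OF refl]) (simp add: EE_sq mv_simps algebra_simps)
    then show ?thesis
      by (simp only: sum_constant_scaleR) (simp add: card_option algebra_simps)
  qed
  also have "(\<Sum>b\<in>UNIV. \<Sum>a\<in>UNIV. ?e a *\<^sub>R ((EE b ** EE a) *v ?L b))
     = - (2 *\<^sub>R grad_mult \<gamma> (Dir phi) k) - 2 *\<^sub>R grad_deriv \<gamma> phi k"
  proof -
    have "(\<Sum>b\<in>UNIV. \<Sum>a\<in>UNIV. ?e a *\<^sub>R ((EE b ** EE a) *v ?L b)) = (\<Sum>a\<in>UNIV. \<Sum>b\<in>UNIV. ?e a *\<^sub>R ((EE b ** EE a) *v ?L b))"
      by (rule sum.swap)
    also have "\<dots> = (\<Sum>a\<in>UNIV. \<Sum>b\<in>UNIV. - (?e a *\<^sub>R ((EE a ** EE b) *v ?L b)) - (if b = a then 2 else 0) *\<^sub>R (?e a *\<^sub>R ?L b))"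
    proof (intro sum.cong refl)
      fix a b
      show "?e a *\<^sub>R ((EE b ** EE a) *v ?L b) = - (?e a *\<^sub>R ((EE a ** EE b) *v ?L b)) - (if b = a then 2 else 0) *\<^sub>R (?e a *\<^sub>R ?L b)"
        unfolding EE_swap[of b a] by (auto simp: mv_simps scaleR_right_diff_distrib)
    qed
    also have "\<dots> = - (\<Sum>a\<in>UNIV. ?e a *\<^sub>R (EE a *v (\<Sum>b\<in>UNIV. EE b *v ?L b))) - 2 *\<^sub>R (\<Sum>a\<in>UNIV. ?e a *\<^sub>R ?L a)"
      by (simp only: sum_subtractf sum_if_const sum_negf scaleR_sum_right mv_sum_right mv_assoc)
    also have "(\<Sum>b\<in>UNIV. EE b *v ?L b) = 2 *\<^sub>R Dir phi k" by (simp add: dirac_sum)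
    also have "(\<Sum>a\<in>UNIV. ?e a *\<^sub>R (EE a *v (2 *\<^sub>R Dir phi k))) = 2 *\<^sub>R grad_mult \<gamma> (Dir phi) k"
      by (simp add: grad_mult_def mv_simps scaleR_sum_right mult.commute)
    also have "(\<Sum>a\<in>UNIV. ?e a *\<^sub>R ?L a) = grad_deriv \<gamma> phi k" by (simp add: grad_deriv_def)
    finally show ?thesis .
  qed
  finally show ?thesis
    by (simp add: scaleR_right_distrib scaleR_right_diff_distrib)
qed

text \<open>Differentiating the coefficients gives the Hessian term. Exchanging the frame
  derivatives costs, for each a, n - 1 brackets with b distinct from a, each contributing 2 E_b E_a
  E_b = 2 E_a; hence the coefficient \<open>CARD('n)\<close> = n - 1 of c.\<close>

lemma dirac_grad_deriv:
  fixes phi :: "'n mat2 \<Rightarrow> complex^'d"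
  assumes phi: "smooth_on Kt phi" "is_section E1 E phi" and g: "\<gamma> \<in> Gt" and k: "k \<in> Kt"
  shows "Dir (grad_deriv \<gamma> phi) k = grad_deriv \<gamma> (Dir phi) k
    + (2 * (mean_conf \<gamma> - conf \<gamma> k)) *\<^sub>R Dir phi k + real CARD('n) *\<^sub>R grad_mult \<gamma> phi k"
proof -
  let ?r = "2 * (mean_conf \<gamma> - conf \<gamma> k)"
  let ?L = "\<lambda>b. lie_deriv (frame b) phi k"
  let ?LL = "\<lambda>b a. lie_deriv (frame b) (lie_deriv (frame a) phi) k"
  let ?e = "\<lambda>a. dconf \<gamma> a k"
  have sL: "smooth_on Kt (lie_deriv (frame a) phi)" for a
    by (rule smooth_on_lie_deriv[OF phi(1) isvec_frame norm_frame])
  have "((\<lambda>t. grad_deriv \<gamma> phi (mmul k (ucurve (frame b) t))) has_vector_derivative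
    (\<Sum>a\<in>UNIV. ?e a *\<^sub>R ?LL b a + (if a = b then ?r else 0) *\<^sub>R ?L a)) (at 0)" for b
    unfolding grad_deriv_def
  proof (rule has_vector_derivative_sum)
    fix a
    show "((\<lambda>t. dconf \<gamma> a (mmul k (ucurve (frame b) t)) *\<^sub>R lie_deriv (frame a) phi (mmul k (ucurve (frame b) t))) has_vector_derivative
      ?e a *\<^sub>R ?LL b a + (if a = b then ?r else 0) *\<^sub>R ?L a) (at 0)"
      using bounded_bilinear.has_vector_derivative[OF bounded_bilinear_scaleR dconf_derivative[OF g k, of a b]
          has_lie_deriv[OF sL[of a] k isvec_frame[of b] norm_frame]]
      by simp
  qed
  then have "Dir (grad_deriv \<gamma> phi) k = (1/2::real) *\<^sub>R (\<Sum>b\<in>UNIV. EE b *v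
      (\<Sum>a\<in>UNIV. ?e a *\<^sub>R ?LL b a + (if a = b then ?r else 0) *\<^sub>R ?L a))"
    by (rule dirac_eqI)
  also have "(\<Sum>b\<in>UNIV. EE b *v (\<Sum>a\<in>UNIV. ?e a *\<^sub>R ?LL b a + (if a = b then ?r else 0) *\<^sub>R ?L a))
     = (\<Sum>b\<in>UNIV. \<Sum>a\<in>UNIV. ?e a *\<^sub>R (EE b *v ?LL b a)) + ?r *\<^sub>R (\<Sum>b\<in>UNIV. EE b *v ?L b)"
    by (simp only: sum.distrib sum_if_const mv_simps mv_sum_right scaleR_sum_right)
  also have "?r *\<^sub>R (\<Sum>b\<in>UNIV. EE b *v ?L b) = (2 * ?r) *\<^sub>R Dir phi k"
    by (simp add: dirac_sum)
  also have "(\<Sum>b\<in>UNIV. \<Sum>a\<in>UNIV. ?e a *\<^sub>R (EE b *v ?LL b a))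
     = (\<Sum>b\<in>UNIV. \<Sum>a\<in>UNIV. ?e a *\<^sub>R (EE b *v ?LL a b))
       + (\<Sum>b\<in>UNIV. \<Sum>a\<in>UNIV. (if b = a then 0 else 2) *\<^sub>R (?e a *\<^sub>R (EE a *v phi k)))"
  proof -
    have "EE b *v ?LL b a = EE b *v ?LL a b + (if b = a then 0 else 2) *\<^sub>R (EE a *v phi k)" for a b
    proof (cases "a = b")
      case False
      have "EE b ** (EE a ** EE b) = EE a"
      proof -
        have "EE b ** (EE a ** EE b) = (EE b ** EE a) ** EE b" by (simp add: matrix_mul_assoc)
        also have "\<dots> = - (EE a ** (EE b ** EE b))"
          using False by (simp add: EE_swap[of b a] mat_simps matrix_mul_assoc)
        finally show ?thesis by (simp add: EE_sq mat_simps)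
      qed
      moreover have "?LL b a = ?LL a b + 2 *\<^sub>R ((EE a ** EE b) *v phi k)"
        using lie_bracket_section[OF phi k False] by (simp add: algebra_simps)
      ultimately show ?thesis using False by (simp add: mv_simps mv_assoc)
    qed simp
    then show ?thesis by (simp add: sum.distrib[symmetric] scaleR_right_distrib mult.commute)
  qed
  also have "(\<Sum>b\<in>UNIV. \<Sum>a\<in>UNIV. ?e a *\<^sub>R (EE b *v ?LL a b)) = 2 *\<^sub>R grad_deriv \<gamma> (Dir phi) k"
  proof -
    have "lie_deriv (frame a) (Dir phi) k = (1/2::real) *\<^sub>R (\<Sum>b\<in>UNIV. EE b *v ?LL a b)" for a
    proof -
      have "((\<lambda>t. Dir phi (mmul k (ucurve (frame a) t))) has_vector_derivative (1/2::real) *\<^sub>R (\<Sum>b\<in>UNIV. EE b *v ?LL a b)) (at 0)"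
        unfolding dirac_sum
        by (intro bounded_linear.has_vector_derivative[OF bounded_linear_scaleR_right] has_vector_derivative_sum
            bounded_linear.has_vector_derivative[OF bounded_linear_mv_right]
            has_lie_deriv[OF sL k isvec_frame norm_frame])
      then show ?thesis unfolding lie_deriv_def by (rule vector_derivative_at)
    qed
    then have gd: "2 *\<^sub>R grad_deriv \<gamma> (Dir phi) k = (\<Sum>a\<in>UNIV. \<Sum>b\<in>UNIV. ?e a *\<^sub>R (EE b *v ?LL a b))"
      by (simp add: grad_deriv_def scaleR_sum_right)
    show ?thesis unfolding gd by (rule sum.swap)
  qed
  also have "(\<Sum>b\<in>UNIV. \<Sum>a\<in>UNIV. (if b = a then 0 else 2) *\<^sub>R (?e a *\<^sub>R (EE a *v phi k))) = (2 * real CARD('n)) *\<^sub>R grad_mult \<gamma> phi k"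
  proof -
    have "(\<Sum>b\<in>UNIV. \<Sum>a\<in>UNIV. (if b = a then 0 else 2) *\<^sub>R (?e a *\<^sub>R (EE a *v phi k)))
       = (\<Sum>a\<in>UNIV. (\<Sum>b\<in>(UNIV :: 'n option set). if b = a then 0 else 2) *\<^sub>R (?e a *\<^sub>R (EE a *v phi k)))"
      unfolding scaleR_sum_left by (rule sum.swap)
    moreover have "(\<Sum>b\<in>(UNIV :: 'n option set). if b = a then 0 else 2) = 2 * real CARD('n)" for a
    proof -
      have "(\<Sum>b\<in>(UNIV :: 'n option set). if b = a then 0 else 2) = (\<Sum>b\<in>(UNIV :: 'n option set). 2 - (if b = a then 2 else (0::real)))"
        by (rule sum.cong) auto
      then show ?thesis by (simp add: sum_subtractf card_option)
    qed
    ultimately show ?thesis by (simp add: grad_mult_def scaleR_sum_right)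
  qed
  finally show ?thesis by (simp add: scaleR_right_distrib algebra_simps)
qed

end

section \<open>Covariance of the higher operators\<close>

text \<open>The pointwise vector space structure lets the abstract operator identity be applied to
  spaces of sections.\<close>

instantiation "fun" :: (type, real_vector) real_vector
begin

definition scaleR_fun :: "real \<Rightarrow> ('a \<Rightarrow> 'b) \<Rightarrow> 'a \<Rightarrow> 'b" where
  "scaleR_fun r f = (\<lambda>x. r *\<^sub>R f x)"

instance
  by standard (simp_all add: scaleR_fun_def fun_eq_iff scaleR_add_right scaleR_add_left)

end

lemma scaleR_fun_apply [simp]: "(r *\<^sub>R f) x = r *\<^sub>R f x"
  by (simp add: scaleR_fun_def)

text \<open>Only the values on \<open>Kt\<close> carry meaning. Setting the others to zero turns
  agreement on \<open>Kt\<close> into equality of functions, the form in which the abstract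
  relations are stated.\<close>

definition restr :: "('n::{finite,linorder} mat2 \<Rightarrow> 'b::zero) \<Rightarrow> 'n mat2 \<Rightarrow> 'b" where
  "restr f k = (if k \<in> Kt then f k else 0)"

definition conf_mult :: "'n::{finite,linorder} mat2 \<Rightarrow> ('n mat2 \<Rightarrow> 'b::real_vector) \<Rightarrow> 'n mat2 \<Rightarrow> 'b" where
  "conf_mult \<gamma> f k = conf \<gamma> k *\<^sub>R f k"

lemma conf_mult_funpow: "(conf_mult \<gamma> ^^ j) f k = (conf \<gamma> k) ^ j *\<^sub>R f k"
  by (induction j arbitrary: f) (simp_all add: conf_mult_def)

lemma scaleR_vector_scalar: "complex_of_real r *s x = r *\<^sub>R x" for x :: "complex^'d"
  by (simp add: vec_eq_iff) (simp add: scaleR_conv_of_real)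

lemma colext_column:
  fixes h :: "'n::{finite,linorder} mat2"
  assumes "h \<in> Gt"
  shows "colext phi (mcol h) = (norm (mcol h) powr (- real CARD('n))) *\<^sub>R phi (unit_mat (mcol h))"
  using arg_cong[OF Gt_column(3)[OF assms], of "colext phi"]
    unit_mat_scale(3)[OF Gt_column(1)[OF assms] norm_mcol_Gt[OF assms], of phi] by (rule trans)

text \<open>The exponent splits as -2 l - n = 2 (-l - 1/2) - (n - 1), where u is the square of the
  column norm. For real l the complex power of a positive number is the real power.\<close>

lemma pi_comp_eq_twist:
  fixes phi :: "'n::{finite,linorder} mat2 \<Rightarrow> complex^'d"
  assumes g: "g \<in> Gt" and k: "k \<in> Kt" and lam: "lam = complex_of_real l"
  shows "pi_comp lam g phi k = (conf (cinv g) k powr (- l - 1/2)) *\<^sub>R twist (cinv g) phi k"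
proof -
  let ?h = "mmul (cinv g) k"
  let ?t = "norm (mcol ?h)"
  have h: "?h \<in> Gt" using cinv_Gt(1)[OF g] k by (rule Gt_Kt_mmul)
  have t: "?t > 0" by (rule norm_mcol_Gt[OF h])
  have u: "unit_mat (mcol ?h) = kmat ((1 / ?t) *\<^sub>R mcol ?h)"
    unfolding unit_mat_def using t by (subst inner_powr_half) auto
  have "pi_comp lam g phi k = (complex_of_real ?t powr (- 2 * lam - of_nat (CARD('n) + 1))) *s phi (unit_mat (mcol ?h))"
    unfolding pi_comp_def ginv_eq_cinv[OF g] ind_ext_eq[OF h] u ..
  also have "complex_of_real ?t powr (- 2 * lam - of_nat (CARD('n) + 1)) = complex_of_real (?t powr (- 2 * l - real (CARD('n) + 1)))"
    unfolding lam using powr_of_real[of ?t "- 2 * l - real (CARD('n) + 1)"] t by simp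
  also have "?t powr (- 2 * l - real (CARD('n) + 1)) = conf (cinv g) k powr (- l - 1/2) * ?t powr (- real CARD('n))"
  proof -
    have "conf (cinv g) k = ?t powr 2" using t by (simp add: conf_norm)
    then show ?thesis
      unfolding \<open>conf (cinv g) k = ?t powr 2\<close> powr_powr powr_add[symmetric]
      by (intro arg_cong[where f = "(powr) ?t"]) (simp add: field_simps)
  qed
  also have "complex_of_real (conf (cinv g) k powr (- l - 1/2) * ?t powr (- real CARD('n))) *s phi (unit_mat (mcol ?h))
     = (conf (cinv g) k powr (- l - 1/2)) *\<^sub>R twist (cinv g) phi k"
    unfolding scaleR_vector_scalar twist_def colext_column[OF h] by simp
  finally show ?thesis .
qed

lemma twist_cong:
  assumes "\<And>k. k \<in> Kt \<Longrightarrow> f k = f' k" "\<gamma> \<in> Gt" "k \<in> Kt"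
  shows "twist \<gamma> f k = twist \<gamma> f' k"
  using assms(1)[OF Gt_column(1)[OF Gt_Kt_mmul[OF assms(2,3)]]] by (simp add: twist_def colext_def)

context spinor
begin

definition sections :: "('n mat2 \<Rightarrow> complex^'d) set" where
  "sections = {f. smooth_on Kt f \<and> is_section E1 E f \<and> (\<forall>k. k \<notin> Kt \<longrightarrow> f k = 0)}"

lemma sectionsD:
  assumes "f \<in> sections"
  shows "smooth_on Kt f" "is_section E1 E f" "k \<notin> Kt \<Longrightarrow> f k = 0"
  using assms unfolding sections_def by blast+

lemma restr_sections:
  assumes "smooth_on Kt f" "is_section E1 E f" shows "restr f \<in> sections"
proof -
  have "smooth_on Kt (restr f)" by (rule smooth_on_cong[OF assms(1)]) (simp add: restr_def)
  moreover have "is_section E1 E (restr f)"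
    unfolding is_section_iff
  proof (intro ballI allI impI)
    fix k :: "'n mat2" and m :: "'n cl" assume k: "k \<in> Kt" and m: "m \<in> clgamma \<and> norm m = 1"
    then have "mmul k (diag m) \<in> Kt" by (intro Kt_mmul diag_Kt) auto
    then show "restr f (mmul k (diag m)) = \<tau> (clbar m) *v restr f k"
      using assms(2) k m by (simp add: restr_def is_section_iff)
  qed
  ultimately show ?thesis by (simp add: sections_def restr_def)
qed

abbreviation dirac_op :: "('n mat2 \<Rightarrow> complex^'d) \<Rightarrow> 'n mat2 \<Rightarrow> complex^'d" where
  "dirac_op f \<equiv> restr (Dir f)"

abbreviation twist_op :: "'n mat2 \<Rightarrow> ('n mat2 \<Rightarrow> complex^'d) \<Rightarrow> 'n mat2 \<Rightarrow> complex^'d" where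
  "twist_op \<gamma> f \<equiv> restr (twist \<gamma> f)"

lemma dirac_op_sections: "f \<in> sections \<Longrightarrow> dirac_op f \<in> sections"
  by (intro restr_sections smooth_on_dirac is_section_dirac) (auto simp: sections_def)

lemma twist_op_sections: "f \<in> sections \<Longrightarrow> \<gamma> \<in> Gt \<Longrightarrow> twist_op \<gamma> f \<in> sections"
  by (intro restr_sections smooth_on_twist is_section_twist) (auto simp: sections_def)

lemma conf_mult_sections:
  assumes f: "f \<in> sections" and g: "\<gamma> \<in> Gt" shows "conf_mult \<gamma> f \<in> sections"
proof -
  have "smooth_on Kt (conf_mult \<gamma> f)"
    unfolding conf_mult_def[abs_def] using f
    by (intro smooth_on_bilinear[OF bounded_bilinear_scaleR] smooth_on_conf) (simp add: sections_def)
  moreover have "is_section E1 E (conf_mult \<gamma> f)"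
    using f conf_diag[OF _ _ g] unfolding is_section_iff sections_def conf_mult_def by (simp add: mv_simps)
  ultimately show ?thesis using f by (simp add: sections_def conf_mult_def)
qed

lemma sections_add:
  assumes "f \<in> sections" "h \<in> sections" shows "f + h \<in> sections"
  using assms smooth_on_add[of Kt f h]
  by (simp add: sections_def is_section_iff plus_fun_def mv_simps)

lemma sections_scale:
  assumes "f \<in> sections" shows "r *\<^sub>R f \<in> sections"
  using assms smooth_on_linear_comp[OF bounded_linear_scaleR_right, of Kt f r]
  by (simp add: sections_def is_section_iff scaleR_fun_def mv_simps)

lemma dirac_op_add:
  assumes "f \<in> sections" "h \<in> sections" shows "dirac_op (f + h) = dirac_op f + dirac_op h"
proof
  fix k
  show "dirac_op (f + h) k = (dirac_op f + dirac_op h) k"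
  proof (cases "k \<in> Kt")
    case True
    have "((\<lambda>t. (f + h) (mmul k (ucurve (frame a) t))) has_vector_derivative lie_deriv (frame a) f k + lie_deriv (frame a) h k) (at 0)" for a
      unfolding plus_fun_def using assms True
      by (intro has_vector_derivative_add has_lie_deriv) (auto simp: sections_def)
    then have e: "Dir (f + h) k = (1/2::real) *\<^sub>R (\<Sum>a\<in>UNIV. EE a *v (lie_deriv (frame a) f k + lie_deriv (frame a) h k))"
      by (rule dirac_eqI)
    have "dirac_op (f + h) k = Dir (f + h) k" using True by (simp only: restr_def if_True)
    also have "\<dots> = dirac_op f k + dirac_op h k"
      unfolding e using True by (simp add: restr_def dirac_sum mv_simps sum.distrib scaleR_right_distrib)
    finally show ?thesis by (simp only: plus_fun_apply)
  qed (simp add: restr_def)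
qed

lemma dirac_op_scale:
  assumes "f \<in> sections" shows "dirac_op (r *\<^sub>R f) = r *\<^sub>R dirac_op f"
proof
  fix k
  show "dirac_op (r *\<^sub>R f) k = (r *\<^sub>R dirac_op f) k"
  proof (cases "k \<in> Kt")
    case True
    have "((\<lambda>t. (r *\<^sub>R f) (mmul k (ucurve (frame a) t))) has_vector_derivative r *\<^sub>R lie_deriv (frame a) f k) (at 0)" for a
      unfolding scaleR_fun_def using assms True
      by (intro bounded_linear.has_vector_derivative[OF bounded_linear_scaleR_right] has_lie_deriv) (auto simp: sections_def)
    then have e: "Dir (r *\<^sub>R f) k = (1/2::real) *\<^sub>R (\<Sum>a\<in>UNIV. EE a *v (r *\<^sub>R lie_deriv (frame a) f k))"
      by (rule dirac_eqI)
    have "dirac_op (r *\<^sub>R f) k = Dir (r *\<^sub>R f) k" using True by (simp only: restr_def if_True)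
    also have "\<dots> = r *\<^sub>R dirac_op f k"
      unfolding e using True by (simp add: restr_def dirac_sum mv_simps scaleR_sum_right mult.commute)
    finally show ?thesis by (simp only: scaleR_fun_apply)
  qed (simp add: restr_def)
qed

lemma grad_mult_eq_commutator:
  assumes f: "f \<in> sections"
  shows "dirac_op (conf_mult \<gamma> f) - conf_mult \<gamma> (dirac_op f) = grad_mult \<gamma> f"
proof
  fix k
  show "(dirac_op (conf_mult \<gamma> f) - conf_mult \<gamma> (dirac_op f)) k = grad_mult \<gamma> f k"
  proof (cases "k \<in> Kt")
    case True
    then show ?thesis
      using dirac_conf[OF sectionsD(1)[OF f], of k \<gamma>] by (simp add: restr_def conf_mult_def conf_mult_def[abs_def])
  qed (simp add: restr_def conf_mult_def grad_mult_def sectionsD[OF f])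
qed

lemma covariance_algebra_sections:
  assumes g: "\<gamma> \<in> Gt"
  shows "covariance_algebra sections dirac_op (conf_mult \<gamma>) (mean_conf \<gamma>)"
proof
  let ?D = "dirac_op" and ?M = "conf_mult \<gamma>" and ?C = "grad_mult \<gamma>" and ?\<alpha> = "mean_conf \<gamma>"
  note commut = grad_mult_eq_commutator[where \<gamma> = \<gamma>]
  note S = sections_add sections_scale dirac_op_sections conf_mult_sections[OF _ g]
  fix f h :: "'n mat2 \<Rightarrow> complex^'d" and r :: real
  assume f: "f \<in> sections"
  show "r *\<^sub>R f \<in> sections" "?D f \<in> sections" "?M f \<in> sections"
    using f S by auto
  show "?D (r *\<^sub>R f) = r *\<^sub>R ?D f" by (rule dirac_op_scale[OF f])
  show "?M (r *\<^sub>R f) = r *\<^sub>R ?M f"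
    by (simp add: fun_eq_iff conf_mult_def mult.commute)
  show "f + h \<in> sections" if "h \<in> sections" by (rule sections_add[OF f that])
  show "?D (f + h) = ?D f + ?D h" if "h \<in> sections" by (rule dirac_op_add[OF f that])
  show "?M (f + h) = ?M f + ?M h"
    by (simp add: fun_eq_iff conf_mult_def scaleR_right_distrib)
  \<comment> \<open>Being the commutator of two operators on sections, c maps sections to
    sections.\<close>
  have C_S: "?C f \<in> sections" if f: "f \<in> sections" for f
  proof -
    have "?D (?M f) + (- 1) *\<^sub>R ?M (?D f) \<in> sections"
      using f by (intro S)
    then show ?thesis using commut[OF f] by simp
  qed
  have c: "?C (?M f) = ?M (?C f)"
    by (simp add: fun_eq_iff grad_mult_def conf_mult_def scaleR_sum_right mv_simps mult.commute)
  show "?M (?D (?M f) - ?M (?D f))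
      = ?D (?M (?M f)) - ?M (?D (?M f))"
    unfolding commut[OF f] commut[OF S(4)[OF f]] c ..
  have sq: "?C (?C f) = ?M (?M f) - (2 * ?\<alpha>) *\<^sub>R ?M f + f"
  proof
    fix k
    show "?C (?C f) k = (?M (?M f) - (2 * ?\<alpha>) *\<^sub>R ?M f + f) k"
    proof (cases "k \<in> Kt")
      case True
      then show ?thesis
        by (simp add: grad_mult_square[OF g] conf_mult_def power2_eq_square algebra_simps)
    qed (simp add: conf_mult_def grad_mult_def sectionsD[OF f])
  qed
  show "?D (?M (?D (?M f) - ?M (?D f)))
      - ?M (?D (?D (?M f) - ?M (?D f)))
      = ?M (?M f) - (2 * ?\<alpha>) *\<^sub>R ?M f + f"
    unfolding commut[OF f] commut[OF C_S[OF f]] by (rule sq)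
  let ?n = "real CARD('n)"
  define T where "T f = restr (grad_deriv \<gamma> f)" for f
  have DC: "?D (?C f) = (?n + 1) *\<^sub>R (?M f + (- ?\<alpha>) *\<^sub>R f)
      + (- 1) *\<^sub>R ?C (?D f) + (- 1) *\<^sub>R T f" if f: "f \<in> sections" for f
  proof
    fix k
    show "?D (?C f) k = ((?n + 1) *\<^sub>R (?M f + (- ?\<alpha>) *\<^sub>R f)
      + (- 1) *\<^sub>R ?C (?D f) + (- 1) *\<^sub>R T f) k"
    proof (cases "k \<in> Kt")
      case True
      have "?C (?D f) k = ?C (Dir f) k" using True by (simp add: grad_mult_def restr_def)
      then show ?thesis
        using True dirac_grad_mult[OF sectionsD(1)[OF f] g]
        by (simp add: T_def restr_def conf_mult_def algebra_simps)
    qed (simp add: T_def restr_def conf_mult_def grad_mult_def sectionsD[OF f])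
  qed
  have DT: "?D (T f) = T (?D f) + (- 2) *\<^sub>R (?M (?D f) + (- ?\<alpha>) *\<^sub>R ?D f)
      + ?n *\<^sub>R ?C f"
  proof
    fix k
    show "?D (T f) k = (T (?D f) + (- 2) *\<^sub>R (?M (?D f) + (- ?\<alpha>) *\<^sub>R ?D f)
      + ?n *\<^sub>R ?C f) k"
    proof (cases "k \<in> Kt")
      case True
      have "Dir (T f) k = Dir (grad_deriv \<gamma> f) k" using True by (intro dirac_cong) (simp_all add: T_def restr_def)
      moreover have "grad_deriv \<gamma> (?D f) k = grad_deriv \<gamma> (Dir f) k"
        unfolding grad_deriv_def using lie_deriv_cong[OF _ True isvec_frame norm_frame, of "?D f" "Dir f"]
        by (simp add: restr_def)
      ultimately show ?thesis
        using True dirac_grad_deriv[OF sectionsD(1,2)[OF f] g]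
        by (simp add: T_def restr_def conf_mult_def algebra_simps)
    qed (simp add: T_def restr_def conf_mult_def grad_mult_def sectionsD[OF f])
  qed
  \<comment> \<open>Solving \<open>DC\<close> for T exhibits it as a combination of sections, which
    replaces a direct check of equivariance.\<close>
  have T_S: "T f \<in> sections"
  proof -
    have "T f = (?n + 1) *\<^sub>R (?M f + (- ?\<alpha>) *\<^sub>R f) + (- 1) *\<^sub>R ?C (?D f) + (- 1) *\<^sub>R ?D (?C f)"
      unfolding DC[OF f] by simp
    also have "\<dots> \<in> sections" using f by (intro S C_S)
    finally show ?thesis .
  qed
  have DDC: "?D (?D (?C f)) = (?n + 1) *\<^sub>R (?D (?M f) + (- ?\<alpha>) *\<^sub>R ?D f)
      + (- 1) *\<^sub>R ?D (?C (?D f)) + (- 1) *\<^sub>R ?D (T f)"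
    unfolding DC[OF f] using f T_S by (simp only: dirac_op_add dirac_op_scale S C_S)
  \<comment> \<open>The T terms from D c D and from D T cancel. \<open>DC\<close> contributes n
    [D, u] = n c and \<open>DT\<close> contributes -(n - 1) c, so c remains with coefficient
    1.\<close>
  have key: "?D (?D (?C f)) - ?C (?D (?D f))
      = ?D (?M f) + ?M (?D f) - (2 * ?\<alpha>) *\<^sub>R ?D f"
    unfolding DDC DC[OF dirac_op_sections[OF f]] DT
    unfolding commut[OF f, symmetric]
    by (simp add: algebra_simps) (simp only: mult_2 scaleR_2)
  have "?D (?C f) = ?D (?D (?M f)) + (- 1) *\<^sub>R ?D (?M (?D f))"
  proof -
    have "?C f = ?D (?M f) + (- 1) *\<^sub>R ?M (?D f)"
      using commut[OF f] by simp
    then show ?thesis using f by (simp only: dirac_op_add dirac_op_scale S)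
  qed
  then have "?D (?D (?C f)) = ?D (?D (?D (?M f)))
      + (- 1) *\<^sub>R ?D (?D (?M (?D f)))"
    using f by (simp only: dirac_op_add dirac_op_scale S)
  then have d: "?D (?D (?D (?M f))) - ?D (?D (?M (?D f)))
      = ?D (?D (?C f))" by simp
  have "?D (?D (?D (?M f))) - ?D (?D (?M (?D f)))
      - ?D (?M (?D (?D f))) + ?M (?D (?D (?D f)))
      = ?D (?D (?C f)) - ?C (?D (?D f))"
    unfolding d commut[OF dirac_op_sections[OF dirac_op_sections[OF f]], symmetric]
    by (simp only: diff_diff_eq2 diff_add_eq)
  then show "?D (?D (?D (?M f))) - ?D (?D (?M (?D f)))
      - ?D (?M (?D (?D f))) + ?M (?D (?D (?D f)))
      = ?D (?M f) + ?M (?D f) - (2 * ?\<alpha>) *\<^sub>R ?D f"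
    unfolding key .
qed

text \<open>The Dirac operator at a point of \<open>Kt\<close> uses values on \<open>Kt\<close>
  only, so restricting after every application does not change the result there.\<close>

lemma dirac_m_eq_shifted_power:
  "k \<in> Kt \<Longrightarrow> dirac_m E1 E m f k = shifted_power dirac_op m (restr f) k"
proof (induction m arbitrary: k)
  case 0
  then show ?case by (simp add: restr_def) (rule dirac_cong, simp_all)
next
  case (Suc m)
  let ?P = "shifted_power dirac_op m (restr f)"
  have 1: "Dir (dirac_m E1 E m f) k = dirac_op ?P k" if "k \<in> Kt" for k
  proof -
    have "Dir (dirac_m E1 E m f) k = Dir ?P k" by (rule dirac_cong[OF Suc.IH that])
    then show ?thesis using that by (simp only: restr_def if_True)
  qed
  have "Dir (Dir (dirac_m E1 E m f)) k = Dir (dirac_op ?P) k"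
    by (rule dirac_cong[OF 1 Suc.prems])
  also have "\<dots> = dirac_op (dirac_op ?P) k" using Suc.prems by (simp only: restr_def if_True)
  finally show ?case using Suc by simp
qed

text \<open>Each factor D^2 - j^2 passes through U by two uses of u D U = U D and the linearity of
  U.\<close>

lemma shifted_power_twist:
  assumes f: "f \<in> sections" and g: "\<gamma> \<in> Gt"
  shows "shifted_power (\<lambda>x. conf_mult \<gamma> (dirac_op x)) m (twist_op \<gamma> f) = twist_op \<gamma> (shifted_power dirac_op m f)"
proof -
  interpret covariance_algebra sections dirac_op "conf_mult \<gamma>" "mean_conf \<gamma>"
    by (rule covariance_algebra_sections[OF g])
  have tw: "conf_mult \<gamma> (dirac_op (twist_op \<gamma> f)) = twist_op \<gamma> (dirac_op f)" if f: "f \<in> sections" for f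
  proof
    fix k
    show "conf_mult \<gamma> (dirac_op (twist_op \<gamma> f)) k = twist_op \<gamma> (dirac_op f) k"
    proof (cases "k \<in> Kt")
      case True
      have "Dir (twist_op \<gamma> f) k = Dir (twist \<gamma> f) k"
        using True by (intro dirac_cong) (simp_all add: restr_def)
      moreover have "twist \<gamma> (dirac_op f) k = twist \<gamma> (Dir f) k"
        using True g by (intro twist_cong) (simp_all add: restr_def)
      ultimately show ?thesis
        using True dirac_twist[OF sectionsD(1,2)[OF f] g] by (simp add: restr_def conf_mult_def)
    qed (simp add: restr_def conf_mult_def)
  qed
  show ?thesis
  proof (induction m)
    case 0
    show ?case using tw[OF f] by simp
  next
    case (Suc m)
    let ?P = "shifted_power dirac_op m f"
    have "shifted_power (\<lambda>x. conf_mult \<gamma> (dirac_op x)) (Suc m) (twist_op \<gamma> f)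
       = twist_op \<gamma> (dirac_op (dirac_op ?P)) - (real (Suc m))\<^sup>2 *\<^sub>R twist_op \<gamma> ?P"
      using f by (simp add: Suc tw)
    also have "\<dots> = twist_op \<gamma> (dirac_op (dirac_op ?P) - (real (Suc m))\<^sup>2 *\<^sub>R ?P)"
      by (simp add: fun_eq_iff restr_def twist_def colext_def scaleR_right_diff_distrib mult.commute)
    finally show ?case by (simp only: shifted_power.simps)
  qed
qed

text \<open>For the two parameters the exponent -lambda - 1/2 of u is m and -(m + 1). The operator
  identity is applied to U f, and the positive factor u^(m+1) is divided out.\<close>

lemma dirac_m_covariant:
  assumes phi: "smooth_on Kt phi" "is_section E1 E phi" and g: "g \<in> Gt" and k: "k \<in> Kt"
  shows "dirac_m E1 E m (pi_comp (- 1/2 - of_nat m) g phi) k = pi_comp (1/2 + of_nat m) g (dirac_m E1 E m phi) k"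
proof -
  let ?\<gamma> = "cinv g"
  have G: "?\<gamma> \<in> Gt" by (rule cinv_Gt(1)[OF g])
  interpret covariance_algebra sections dirac_op "conf_mult ?\<gamma>" "mean_conf ?\<gamma>"
    by (rule covariance_algebra_sections[OF G])
  define f where "f = restr phi"
  have f: "f \<in> sections" unfolding f_def by (rule restr_sections[OF phi])
  have tf: "twist_op ?\<gamma> f \<in> sections" by (rule twist_op_sections[OF f G])
  have c: "conf ?\<gamma> k > 0" by (rule conf_pos[OF G k])
  have tw: "twist ?\<gamma> phi k = twist ?\<gamma> f k" if "k \<in> Kt" for k
    using that G by (intro twist_cong) (simp_all add: f_def restr_def)
  have "restr (pi_comp (- 1/2 - of_nat m) g phi) = (conf_mult ?\<gamma> ^^ m) (twist_op ?\<gamma> f)"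
  proof
    fix k
    show "restr (pi_comp (- 1/2 - of_nat m) g phi) k = (conf_mult ?\<gamma> ^^ m) (twist_op ?\<gamma> f) k"
    proof (cases "k \<in> Kt")
      case True
      have "pi_comp (- 1/2 - of_nat m) g phi k = (conf ?\<gamma> k powr (real m)) *\<^sub>R twist ?\<gamma> phi k"
        using pi_comp_eq_twist[OF g True, of "- 1/2 - of_nat m" "- 1/2 - real m"] by simp
      then show ?thesis
        using True tw[OF True] conf_pos[OF G True] by (simp add: restr_def conf_mult_funpow powr_realpow)
    qed (simp add: restr_def conf_mult_funpow)
  qed
  then have L: "dirac_m E1 E m (pi_comp (- 1/2 - of_nat m) g phi) k
      = shifted_power dirac_op m ((conf_mult ?\<gamma> ^^ m) (twist_op ?\<gamma> f)) k"
    using dirac_m_eq_shifted_power[OF k] by simp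
  have "conf ?\<gamma> k ^ Suc m *\<^sub>R shifted_power dirac_op m ((conf_mult ?\<gamma> ^^ m) (twist_op ?\<gamma> f)) k
      = twist_op ?\<gamma> (shifted_power dirac_op m f) k"
    using fun_cong[OF trans[OF shifted_power_conjugate[OF tf, of m, symmetric] shifted_power_twist[OF f G, of m]], of k]
    by (simp only: conf_mult_funpow)
  also have "\<dots> = twist ?\<gamma> (dirac_m E1 E m phi) k"
    using k G twist_cong[OF dirac_m_eq_shifted_power[of _ m phi] G k] by (simp add: restr_def f_def)
  finally have K: "conf ?\<gamma> k ^ Suc m *\<^sub>R shifted_power dirac_op m ((conf_mult ?\<gamma> ^^ m) (twist_op ?\<gamma> f)) k
      = twist ?\<gamma> (dirac_m E1 E m phi) k" .
  have "pi_comp (1/2 + of_nat m) g (dirac_m E1 E m phi) k = (conf ?\<gamma> k powr (- real (Suc m))) *\<^sub>R twist ?\<gamma> (dirac_m E1 E m phi) k"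
  proof -
    have "- (1/2 + real m) - 1/2 = - real (Suc m)" by simp
    then show ?thesis
      using pi_comp_eq_twist[OF g k, of "1/2 + of_nat m" "1/2 + real m" "dirac_m E1 E m phi"] by simp
  qed
  also have "conf ?\<gamma> k powr (- real (Suc m)) = 1 / conf ?\<gamma> k ^ Suc m"
    using c by (simp only: powr_minus powr_realpow) (simp add: divide_inverse)
  also have "(1 / conf ?\<gamma> k ^ Suc m) *\<^sub>R twist ?\<gamma> (dirac_m E1 E m phi) k
      = shifted_power dirac_op m ((conf_mult ?\<gamma> ^^ m) (twist_op ?\<gamma> f)) k"
    unfolding K[symmetric] using c by simp
  finally show ?thesis unfolding L by simp
qed

end

theorem mainTheorem13:
  fixes E1 :: "complex^'d^'d"
    and E :: "'n::{finite,linorder} \<Rightarrow> complex^'d^'d"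
    and m :: nat
    and phi :: "'n mat2 \<Rightarrow> complex^'d"
    and g k :: "'n mat2"
  assumes "spinor_module E1 E"
    and "is_section E1 E phi"
    and "smooth_on Kt phi"
    and "g \<in> Gt"
    and "k \<in> Kt"
  shows "dirac_m E1 E m (pi_comp (- 1/2 - of_nat m) g phi) k
         = pi_comp (1/2 + of_nat m) g (dirac_m E1 E m phi) k"
proof -
  interpret spinor E1 E by unfold_locales (rule assms(1))
  show ?thesis by (rule dirac_m_covariant[OF assms(3,2,4,5)])
qed

end
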